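(* Let $\mathbb{M}$ be a monster model of a complete $C$-minimal expansion of ACVF whose language contains a constant symbol $t$ with $v(t)>0$. Let $D\subseteq\mathrm{RV}^2$ be definable. Then $\operatorname{dp-rank}(D)\le 1$ if and only if $D$ is small over $\Gamma^2$, i.e. $\dim(D\cap(\mathrm{RV}_a\times\mathrm{RV}_b))<2$ for every $(a,b)\in\Gamma^2$.
   Context: ACVF is the theory of algebraically closed non-trivially valued fields; $C$-minimal means every definable subset of the home sort is a finite boolean combination of balls and points. "Definable" means with parameters. $\Gamma$ is the value group, $\mathfrak m$ the maximal ideal, $k$ the residue field (strongly minimal induced structure). $\mathrm{RV}=\mathbb{M}^\times/(1+\mathfrak m)$; $v$ induces a surjection $\mathrm{RV}\to\Gamma$ with kernel $k^\times$, and $\mathrm{RV}_\gamma$ is the fiber over $\gamma$. Each $\mathrm{RV}_a\times\mathrm{RV}_b$ is in definable bijection with $(k^\times)^2$ by translation, and $\dim$ of a definable subset is the Morley rank of its image in $(k^\times)^2$. *)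

theory Defs
  imports
    "HOL-Computational_Algebra.Polynomial"
    "HOL-Library.Extended_Nat"
    "HOL-Library.Disjoint_Sets"
begin

unbundle cardinal_syntax

section \<open>First-order logic\<close>

text \<open>
  The symbols of a language are those with a defined arity. The universe of a structure is the
  whole type \<open>'a\<close>.
\<close>

record ('f, 'r) language =
  farity :: "'f \<Rightarrow> nat option"
  rarity :: "'r \<Rightarrow> nat option"

record ('f, 'r, 'a) struct =
  fint :: "'f \<Rightarrow> 'a list \<Rightarrow> 'a"
  rint :: "'r \<Rightarrow> 'a list \<Rightarrow> bool"

datatype 'f trm = Var nat | Fn 'f "'f trm list"

datatype ('f, 'r) form =
    Equal "'f trm" "'f trm"
  | Rel 'r "'f trm list"
  | Not "('f, 'r) form"
  | And "('f, 'r) form" "('f, 'r) form"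
  | Exists nat "('f, 'r) form"

fun wf_trm :: "('f, 'r) language \<Rightarrow> 'f trm \<Rightarrow> bool" where
  "wf_trm L (Var n) \<longleftrightarrow> True"
| "wf_trm L (Fn f ts) \<longleftrightarrow> farity L f = Some (length ts) \<and> (\<forall>t \<in> set ts. wf_trm L t)"

primrec wf_form :: "('f, 'r) language \<Rightarrow> ('f, 'r) form \<Rightarrow> bool" where
  "wf_form L (Equal s t) \<longleftrightarrow> wf_trm L s \<and> wf_trm L t"
| "wf_form L (Rel r ts) \<longleftrightarrow> rarity L r = Some (length ts) \<and> (\<forall>t \<in> set ts. wf_trm L t)"
| "wf_form L (Not \<phi>) \<longleftrightarrow> wf_form L \<phi>"
| "wf_form L (And \<phi> \<psi>) \<longleftrightarrow> wf_form L \<phi> \<and> wf_form L \<psi>"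
| "wf_form L (Exists n \<phi>) \<longleftrightarrow> wf_form L \<phi>"

definition formulas :: "('f, 'r) language \<Rightarrow> ('f, 'r) form set" where
  "formulas L = {\<phi>. wf_form L \<phi>}"

fun trm_val :: "('f, 'r, 'a) struct \<Rightarrow> (nat \<Rightarrow> 'a) \<Rightarrow> 'f trm \<Rightarrow> 'a" where
  "trm_val M e (Var n) = e n"
| "trm_val M e (Fn f ts) = fint M f (map (trm_val M e) ts)"

primrec sat :: "('f, 'r, 'a) struct \<Rightarrow> (nat \<Rightarrow> 'a) \<Rightarrow> ('f, 'r) form \<Rightarrow> bool" where
  "sat M e (Equal s t) \<longleftrightarrow> trm_val M e s = trm_val M e t"
| "sat M e (Rel r ts) \<longleftrightarrow> rint M r (map (trm_val M e) ts)"
| "sat M e (Not \<phi>) \<longleftrightarrow> \<not> sat M e \<phi>"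
| "sat M e (And \<phi> \<psi>) \<longleftrightarrow> sat M e \<phi> \<and> sat M e \<psi>"
| "sat M e (Exists n \<phi>) \<longleftrightarrow> (\<exists>x. sat M (e(n := x)) \<phi>)"

text \<open>
  Throughout, a formula \<open>\<phi>(x; b)\<close> with parameters is given by a formula and an assignment:
  the variable \<open>0\<close> (or the variables \<open>0\<close>, \<open>1\<close>) is the object variable, and the assignment
  supplies the parameters at the remaining variables.
\<close>

definition definable_sets :: "('f, 'r) language \<Rightarrow> ('f, 'r, 'a) struct \<Rightarrow> 'a set set" where
  "definable_sets L M = {{x. sat M (e(0 := x)) \<phi>} | \<phi> e. \<phi> \<in> formulas L}"


section \<open>Monster models\<close>

definition saturated ::
    "('f, 'r) language \<Rightarrow> ('f, 'r, 'a) struct \<Rightarrow> 'a rel \<Rightarrow> bool" where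
  "saturated L M \<kappa> \<longleftrightarrow>
    (\<forall>A p. |A| <o \<kappa> \<longrightarrow>
       p \<subseteq> {(\<phi>, e). \<phi> \<in> formulas L \<and> (\<forall>n \<ge> 1. e n \<in> A)} \<longrightarrow>
       (\<forall>q \<subseteq> p. finite q \<longrightarrow> (\<exists>x. \<forall>(\<phi>, e) \<in> q. sat M (e(0 := x)) \<phi>)) \<longrightarrow>
       (\<exists>x. \<forall>(\<phi>, e) \<in> p. sat M (e(0 := x)) \<phi>))"

definition elementary_map ::
    "('f, 'r) language \<Rightarrow> ('f, 'r, 'a) struct \<Rightarrow> 'a set \<Rightarrow> ('a \<Rightarrow> 'a) \<Rightarrow> bool" where
  "elementary_map L M A g \<longleftrightarrow>
    (\<forall>\<phi> e. \<phi> \<in> formulas L \<longrightarrow> range e \<subseteq> A \<longrightarrow> sat M (g \<circ> e) \<phi> = sat M e \<phi>)"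

definition automorphism ::
    "('f, 'r) language \<Rightarrow> ('f, 'r, 'a) struct \<Rightarrow> ('a \<Rightarrow> 'a) \<Rightarrow> bool" where
  "automorphism L M h \<longleftrightarrow> bij h \<and>
    (\<forall>f xs. farity L f = Some (length xs) \<longrightarrow> h (fint M f xs) = fint M f (map h xs)) \<and>
    (\<forall>r xs. rarity L r = Some (length xs) \<longrightarrow> rint M r (map h xs) = rint M r xs)"

definition strongly_homogeneous ::
    "('f, 'r) language \<Rightarrow> ('f, 'r, 'a) struct \<Rightarrow> 'a rel \<Rightarrow> bool" where
  "strongly_homogeneous L M \<kappa> \<longleftrightarrow>
    (\<forall>A g. |A| <o \<kappa> \<longrightarrow> elementary_map L M A g \<longrightarrow>
       (\<exists>h. automorphism L M h \<and> (\<forall>x \<in> A. h x = g x)))"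

text \<open>
  The set of formulas is infinite, so \<open>\<kappa>\<close> below is an uncountable cardinal larger than the
  language. A \<open>\<kappa>\<close>-saturated infinite structure has at least \<open>\<kappa>\<close> elements, which is why \<open>\<kappa>\<close> may
  be taken to be a cardinal on the type \<open>'a\<close>. The complete theory of which \<open>M\<close> is a monster
  model is the theory of \<open>M\<close>.
\<close>

definition monster_model :: "('f, 'r) language \<Rightarrow> ('f, 'r, 'a) struct \<Rightarrow> bool" where
  "monster_model L M \<longleftrightarrow>
    (\<exists>\<kappa> :: 'a rel. Card_order \<kappa> \<and> |formulas L| <o \<kappa> \<and>
       saturated L M \<kappa> \<and> strongly_homogeneous L M \<kappa>)"


section \<open>Valued fields\<close>

text \<open>
  The value group is the whole type \<open>'g\<close>. The value \<open>v 0\<close>, which should be \<open>\<infinity>\<close>, is left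
  unspecified, so every use of \<open>v x\<close> is guarded by \<open>x \<noteq> 0\<close>.
\<close>

definition nontrivial_valuation ::
    "('a::field \<Rightarrow> 'g::linordered_ab_group_add) \<Rightarrow> bool" where
  "nontrivial_valuation v \<longleftrightarrow>
    (\<forall>x y. x \<noteq> 0 \<longrightarrow> y \<noteq> 0 \<longrightarrow> v (x * y) = v x + v y) \<and>
    (\<forall>x y. x \<noteq> 0 \<longrightarrow> y \<noteq> 0 \<longrightarrow> x + y \<noteq> 0 \<longrightarrow> min (v x) (v y) \<le> v (x + y)) \<and>
    v ` (- {0}) = UNIV \<and>
    (\<exists>x. x \<noteq> 0 \<and> v x \<noteq> 0)"

text \<open>
  Function and relation symbols of an expansion of the language of valued fields, where
  \<open>VDiv x y\<close> stands for \<open>v x \<le> v y\<close>.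
\<close>

datatype 'f vf_fun = VZero | VOne | VAdd | VMinus | VMult | NewFun 'f

datatype 'r vf_rel = VDiv | NewRel 'r

definition vf_expansion ::
    "('f vf_fun, 'r vf_rel) language \<Rightarrow> ('f vf_fun, 'r vf_rel, 'a::field) struct \<Rightarrow>
     ('a \<Rightarrow> 'g::linordered_ab_group_add) \<Rightarrow> bool" where
  "vf_expansion L M v \<longleftrightarrow>
    farity L VZero = Some 0 \<and> farity L VOne = Some 0 \<and> farity L VAdd = Some 2 \<and>
    farity L VMinus = Some 1 \<and> farity L VMult = Some 2 \<and> rarity L VDiv = Some 2 \<and>
    fint M VZero [] = 0 \<and> fint M VOne [] = 1 \<and>
    (\<forall>x y. fint M VAdd [x, y] = x + y) \<and>
    (\<forall>x. fint M VMinus [x] = - x) \<and>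
    (\<forall>x y. fint M VMult [x, y] = x * y) \<and>
    (\<forall>x y. rint M VDiv [x, y] \<longleftrightarrow> y = 0 \<or> x \<noteq> 0 \<and> v x \<le> v y)"

definition closed_vball :: "('a::field \<Rightarrow> 'g::linordered_ab_group_add) \<Rightarrow> 'a \<Rightarrow> 'g \<Rightarrow> 'a set" where
  "closed_vball v a \<gamma> = {x. x = a \<or> \<gamma> \<le> v (x - a)}"

definition open_vball :: "('a::field \<Rightarrow> 'g::linordered_ab_group_add) \<Rightarrow> 'a \<Rightarrow> 'g \<Rightarrow> 'a set" where
  "open_vball v a \<gamma> = {x. x = a \<or> \<gamma> < v (x - a)}"

inductive_set boolean_combinations :: "'a set set \<Rightarrow> 'a set set" for \<B> where
  basic: "B \<in> \<B> \<Longrightarrow> B \<in> boolean_combinations \<B>"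
| compl: "A \<in> boolean_combinations \<B> \<Longrightarrow> - A \<in> boolean_combinations \<B>"
| union: "A \<in> boolean_combinations \<B> \<Longrightarrow> B \<in> boolean_combinations \<B> \<Longrightarrow>
    A \<union> B \<in> boolean_combinations \<B>"

definition C_minimal ::
    "('f, 'r) language \<Rightarrow> ('f, 'r, 'a::field) struct \<Rightarrow>
     ('a \<Rightarrow> 'g::linordered_ab_group_add) \<Rightarrow> bool" where
  "C_minimal L M v \<longleftrightarrow>
    definable_sets L M \<subseteq> boolean_combinations
      ({closed_vball v a \<gamma> | a \<gamma>. True} \<union> {open_vball v a \<gamma> | a \<gamma>. True} \<union> {{a} | a. True})"


section \<open>The sort RV\<close>

text \<open>
  \<open>RV\<close> is the set of cosets \<open>rv v x\<close> with \<open>x \<noteq> 0\<close>, and \<open>RV_fiber v \<gamma>\<close> is its fiber over \<open>\<gamma>\<close>.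
  For \<open>v x = 0\<close> the coset \<open>x(1 + \<mm>)\<close> coincides, as a set, with the residue class \<open>x + \<mm>\<close>;
  thus \<open>RV_fiber v 0\<close> is literally the multiplicative group of the residue field.
\<close>

definition max_ideal :: "('a::field \<Rightarrow> 'g::linordered_ab_group_add) \<Rightarrow> 'a set" where
  "max_ideal v = {x. x = 0 \<or> 0 < v x}"

definition rv :: "('a::field \<Rightarrow> 'g::linordered_ab_group_add) \<Rightarrow> 'a \<Rightarrow> 'a set" where
  "rv v x = (\<lambda>u. x * (1 + u)) ` max_ideal v"

definition RV_fiber :: "('a::field \<Rightarrow> 'g::linordered_ab_group_add) \<Rightarrow> 'g \<Rightarrow> 'a set set" where
  "RV_fiber v \<gamma> = rv v ` {x. x \<noteq> 0 \<and> v x = \<gamma>}"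

text \<open>
  The subset of \<open>RV\<^sup>2\<close> defined by \<open>\<phi>\<close> with parameters \<open>e\<close>, namely by the formula
  \<open>\<exists>x y. \<xi> = rv x \<and> \<eta> = rv y \<and> \<phi>(x, y; e)\<close> in the variables \<open>\<xi>, \<eta>\<close> of sort \<open>RV\<close>. Every
  formula on \<open>RV\<^sup>2\<close> (with parameters from imaginary sorts replaced by representatives in the
  home sort) is equivalent to one of this form.
\<close>

definition RV2_set ::
    "('f, 'r, 'a::field) struct \<Rightarrow> ('a \<Rightarrow> 'g::linordered_ab_group_add) \<Rightarrow>
     ('f, 'r) form \<Rightarrow> (nat \<Rightarrow> 'a) \<Rightarrow> ('a set \<times> 'a set) set" where
  "RV2_set M v \<phi> e =
    {(rv v x, rv v y) | x y. x \<noteq> 0 \<and> y \<noteq> 0 \<and> sat M (e(0 := x, 1 := y)) \<phi>}"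

definition definable_RV2 ::
    "('f, 'r) language \<Rightarrow> ('f, 'r, 'a::field) struct \<Rightarrow>
     ('a \<Rightarrow> 'g::linordered_ab_group_add) \<Rightarrow> ('a set \<times> 'a set) set set" where
  "definable_RV2 L M v = {RV2_set M v \<phi> e | \<phi> e. \<phi> \<in> formulas L}"


section \<open>dp-rank\<close>

text \<open>
  An ict-pattern of depth \<open>n\<close> in \<open>D\<close> consists of formulas \<open>\<phi> i\<close> and parameters \<open>b i j\<close> such
  that each path \<open>\<eta>\<close> is realized by a point of \<open>D\<close>. In a monster model, realizing the paths is
  the same as their consistency. All infinite ranks are identified with \<open>\<infinity>\<close>, and the rank of the
  empty set is \<open>0\<close> rather than \<open>-\<infinity>\<close>.
\<close>

definition RV2_ict_pattern ::
    "('f, 'r) language \<Rightarrow> ('f, 'r, 'a::field) struct \<Rightarrow>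
     ('a \<Rightarrow> 'g::linordered_ab_group_add) \<Rightarrow> ('a set \<times> 'a set) set \<Rightarrow> nat \<Rightarrow>
     (nat \<Rightarrow> ('f, 'r) form) \<Rightarrow> (nat \<Rightarrow> nat \<Rightarrow> nat \<Rightarrow> 'a) \<Rightarrow> bool" where
  "RV2_ict_pattern L M v D n \<phi> b \<longleftrightarrow>
    (\<forall>i < n. \<phi> i \<in> formulas L) \<and>
    (\<forall>\<eta> :: nat \<Rightarrow> nat. \<exists>p \<in> D. \<forall>i < n. \<forall>j. p \<in> RV2_set M v (\<phi> i) (b i j) \<longleftrightarrow> j = \<eta> i)"

definition dp_rank ::
    "('f, 'r) language \<Rightarrow> ('f, 'r, 'a::field) struct \<Rightarrow>
     ('a \<Rightarrow> 'g::linordered_ab_group_add) \<Rightarrow> ('a set \<times> 'a set) set \<Rightarrow> enat" where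
  "dp_rank L M v D = Sup {enat n | n. \<exists>\<phi> b. RV2_ict_pattern L M v D n \<phi> b}"


section \<open>Morley rank and dimension\<close>

text \<open>
  Morley rank with respect to the family \<open>\<D>\<close> of sets definable with parameters in a saturated
  model, with the same conventions on infinite ranks and the empty set as for the dp-rank.
\<close>

primrec morley_rank_ge :: "'s set set \<Rightarrow> nat \<Rightarrow> 's set \<Rightarrow> bool" where
  "morley_rank_ge \<D> 0 X \<longleftrightarrow> X \<noteq> {}"
| "morley_rank_ge \<D> (Suc n) X \<longleftrightarrow>
    (\<exists>Y :: nat \<Rightarrow> 's set. disjoint_family Y \<and>
       (\<forall>i. Y i \<in> \<D> \<and> Y i \<subseteq> X \<and> morley_rank_ge \<D> n (Y i)))"

definition morley_rank :: "'s set set \<Rightarrow> 's set \<Rightarrow> enat" where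
  "morley_rank \<D> X = Sup {enat n | n. morley_rank_ge \<D> n X}"

text \<open>
  Dividing by elements \<open>c\<close>, \<open>d\<close> of values \<open>a\<close>, \<open>b\<close> translates \<open>RV_fiber v a \<times> RV_fiber v b\<close> to
  \<open>RV_fiber v 0 \<times> RV_fiber v 0\<close>, the square of the multiplicative group of the residue field. The
  dimension of a definable \<open>S \<subseteq> RV_fiber v a \<times> RV_fiber v b\<close> does not depend on the choice of
  \<open>c\<close> and \<open>d\<close>.
\<close>

definition RV2_translate :: "'a::field \<Rightarrow> 'a \<Rightarrow> 'a set \<times> 'a set \<Rightarrow> 'a set \<times> 'a set" where
  "RV2_translate c d = (\<lambda>(p, q). ((\<lambda>z. z / c) ` p, (\<lambda>z. z / d) ` q))"

definition RV2_dim ::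
    "('f, 'r) language \<Rightarrow> ('f, 'r, 'a::field) struct \<Rightarrow>
     ('a \<Rightarrow> 'g::linordered_ab_group_add) \<Rightarrow> 'g \<Rightarrow> 'g \<Rightarrow> ('a set \<times> 'a set) set \<Rightarrow> enat" where
  "RV2_dim L M v a b S =
    (let c = (SOME c. c \<noteq> 0 \<and> v c = a);
         d = (SOME d. d \<noteq> 0 \<and> v d = b)
     in morley_rank (definable_RV2 L M v) (RV2_translate c d ` S))"

definition small_over_value_group ::
    "('f, 'r) language \<Rightarrow> ('f, 'r, 'a::field) struct \<Rightarrow>
     ('a \<Rightarrow> 'g::linordered_ab_group_add) \<Rightarrow> ('a set \<times> 'a set) set \<Rightarrow> bool" where
  "small_over_value_group L M v D \<longleftrightarrow>
    (\<forall>a b. RV2_dim L M v a b (D \<inter> (RV_fiber v a \<times> RV_fiber v b)) < 2)"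

end

theory Submission
  imports Defs
begin

text \<open>
  Everything is done in the home sort. By saturation, the members of a definable family of subsets
  of \<open>M\<close> are boolean combinations of a bounded number of balls. Since balls are laminar, \<open>n\<close> such
  sets have only linearly many cells, so no two-dimensional grid fits into \<open>M\<close>, and (by induction on
  the size of the fibers) none into a relation with finite fibers over \<open>M\<close>. Moreover a ball not
  containing \<open>0\<close> lies in one class of \<open>RV\<close>; hence a definable subset of \<open>RV\<close> is finite or cofinite
  in each fiber over \<open>\<Gamma>\<close>, and finite as soon as it is finite in each fiber.

  If \<open>D\<close> is small over \<open>\<Gamma>\<^sup>2\<close>, then for each \<open>b\<close> only finitely many \<open>x\<close> have an infinite \<open>D\<^sub>x \<inter> RV\<^sub>b\<close>. By
  orthogonality of \<open>RV\<^sub>a\<close> and \<open>\<Gamma>\<close> only finitely many \<open>x\<close> have this for some \<open>b\<close>. So \<open>D\<close> is the union of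
  a relation with finite fibers over the first coordinate and one with finite fibers over the
  second, and neither contains a large grid. Conversely, if \<open>D \<inter> (RV\<^sub>a \<times> RV\<^sub>b)\<close> has dimension \<open>2\<close>, then
  infinitely many \<open>x\<close> in \<open>RV\<^sub>a\<close> have a cofinite \<open>D\<^sub>x \<inter> RV\<^sub>b\<close>. As \<open>RV\<^sub>b\<close> is uncountable, countably many such
  \<open>D\<^sub>x\<close> have infinitely many common points, and these span a grid.
\<close>

section \<open>Definable predicates\<close>

text \<open>Formulas are accessible only through \<open>sat\<close>, so definability is treated as a
  property of predicates on assignments, with the parameters as further entries of the assignment.
  Bounding the number of balls uniformly in the parameters is a compactness argument; it needs
  "being a combination of N pairs of balls" to be definable itself, whence the form of
  \<open>ball_comb\<close>. The same bound eliminates "infinitely many classes" in the fibers of RV,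
  so the locus of large fibers is again a definable family.

  The obstacle for a relation with finite fibers is that the formulas of a pattern see both
  coordinates, while cells are counted in one. After projection to the first coordinate, the sets of
  different rows or columns may overlap. Where they do so on a large scale, a parameter of the
  pattern separates points of the same fiber, and this yields a definable relation with smaller
  fibers.

  Orthogonality is indispensable because smallness bounds the exceptional first coordinates for one
  value at a time, while the splitting of the relation needs their union over all values to be
  finite.\<close>

fun trm_vars :: "'f trm \<Rightarrow> nat set" where
  "trm_vars (Var n) = {n}"
| "trm_vars (Fn f ts) = (\<Union>t \<in> set ts. trm_vars t)"

primrec form_vars :: "('f, 'r) form \<Rightarrow> nat set" where
  "form_vars (Equal s t) = trm_vars s \<union> trm_vars t"
| "form_vars (Rel r ts) = (\<Union>t \<in> set ts. trm_vars t)"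
| "form_vars (Not \<phi>) = form_vars \<phi>"
| "form_vars (And \<phi> \<psi>) = form_vars \<phi> \<union> form_vars \<psi>"
| "form_vars (Exists n \<phi>) = form_vars \<phi>"

lemma finite_trm_vars [simp]: "finite (trm_vars t)"
  by (induction t rule: trm_vars.induct) auto

lemma finite_form_vars [simp]: "finite (form_vars \<phi>)"
  by (induction \<phi>) auto

lemma trm_val_cong: "(\<And>n. n \<in> trm_vars t \<Longrightarrow> e n = e' n) \<Longrightarrow> trm_val M e t = trm_val M e' t"
proof (induction t rule: trm_vars.induct)
  case (2 f ts)
  then have "map (trm_val M e) ts = map (trm_val M e') ts" by auto
  then show ?case by (simp only: trm_val.simps)
qed simp

lemma sat_cong: "(\<And>n. n \<in> form_vars \<phi> \<Longrightarrow> e n = e' n) \<Longrightarrow> sat M e \<phi> \<longleftrightarrow> sat M e' \<phi>"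
proof (induction \<phi> arbitrary: e e')
  case (Equal s t)
  then show ?case using trm_val_cong[of s e e' M] trm_val_cong[of t e e' M] by auto
next
  case (Rel r ts)
  then have "map (trm_val M e) ts = map (trm_val M e') ts"
    by (auto intro!: trm_val_cong)
  then show ?case by (simp only: sat.simps)
next
  case (Exists n \<phi>)
  have "sat M (e(n := x)) \<phi> = sat M (e'(n := x)) \<phi>" for x
    by (rule Exists.IH) (use Exists.prems in auto)
  then show ?case by simp
next
  case (And \<phi> \<psi>)
  have "sat M e \<phi> = sat M e' \<phi>" by (rule And.IH(1)) (use And.prems in auto)
  moreover have "sat M e \<psi> = sat M e' \<psi>" by (rule And.IH(2)) (use And.prems in auto)
  ultimately show ?case by simp
next
  case (Not \<phi>)
  have "sat M e \<phi> = sat M e' \<phi>" by (rule Not.IH) (use Not.prems in auto)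
  then show ?case by simp
qed

section \<open>Substitution of terms in formulas\<close>

fun trm_subst :: "(nat \<Rightarrow> 'f trm) \<Rightarrow> 'f trm \<Rightarrow> 'f trm" where
  "trm_subst \<sigma> (Var n) = \<sigma> n"
| "trm_subst \<sigma> (Fn f ts) = Fn f (map (trm_subst \<sigma>) ts)"

lemma wf_trm_subst: "wf_trm L t \<Longrightarrow> (\<And>n. wf_trm L (\<sigma> n)) \<Longrightarrow> wf_trm L (trm_subst \<sigma> t)"
  by (induction t rule: trm_vars.induct) auto

lemma trm_val_subst: "trm_val M e (trm_subst \<sigma> t) = trm_val M (\<lambda>n. trm_val M e (\<sigma> n)) t"
proof (induction t rule: trm_vars.induct)
  case (2 f ts)
  then have "map (trm_val M e \<circ> trm_subst \<sigma>) ts = map (trm_val M (\<lambda>n. trm_val M e (\<sigma> n))) ts" by auto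
  then show ?case by (simp only: trm_val.simps trm_subst.simps map_map)
qed simp

text \<open>Asserting existence leaves the choice of bound variables to the induction: under a
  quantifier the bound variable is renamed, so that no inserted term is captured.\<close>

lemma form_subst:
  assumes "wf_form L \<phi>" and "\<And>n. wf_trm L (\<sigma> n)"
  shows "\<exists>\<phi>'. wf_form L \<phi>' \<and> (\<forall>e. sat M e \<phi>' \<longleftrightarrow> sat M (\<lambda>n. trm_val M e (\<sigma> n)) \<phi>)"
  using assms
proof (induction \<phi> arbitrary: \<sigma>)
  case (Equal s t)
  show ?case
    by (rule exI[of _ "Equal (trm_subst \<sigma> s) (trm_subst \<sigma> t)"])
      (use Equal in \<open>auto simp: wf_trm_subst trm_val_subst\<close>)
next
  case (Rel r ts)
  have "map (trm_val M e \<circ> trm_subst \<sigma>) ts = map (trm_val M (\<lambda>n. trm_val M e (\<sigma> n))) ts" for e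
    by (auto simp: trm_val_subst)
  then have "sat M e (Rel r (map (trm_subst \<sigma>) ts)) \<longleftrightarrow> sat M (\<lambda>n. trm_val M e (\<sigma> n)) (Rel r ts)" for e
    by (simp only: sat.simps map_map)
  moreover have "wf_form L (Rel r (map (trm_subst \<sigma>) ts))" using Rel by (auto simp: wf_trm_subst)
  ultimately show ?case by blast
next
  case (Not \<phi>)
  from Not.IH[of \<sigma>] Not.prems obtain \<phi>' where
    "wf_form L \<phi>'" "\<forall>e. sat M e \<phi>' \<longleftrightarrow> sat M (\<lambda>n. trm_val M e (\<sigma> n)) \<phi>" by auto
  then show ?case by (intro exI[of _ "form.Not \<phi>'"]) auto
next
  case (And \<phi> \<psi>)
  from And.IH[of \<sigma>] And.prems obtain \<phi>' \<psi>' where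
    "wf_form L \<phi>'" "\<forall>e. sat M e \<phi>' \<longleftrightarrow> sat M (\<lambda>n. trm_val M e (\<sigma> n)) \<phi>"
    "wf_form L \<psi>'" "\<forall>e. sat M e \<psi>' \<longleftrightarrow> sat M (\<lambda>n. trm_val M e (\<sigma> n)) \<psi>" by auto
  then show ?case by (intro exI[of _ "And \<phi>' \<psi>'"]) auto
next
  case (Exists n \<phi>)
  \<comment> \<open>\<open>N\<close> exceeds every variable of the terms put in for variables of
    \<open>\<phi>\<close>; \<open>insert 0\<close> keeps \<open>Max\<close> defined.\<close>
  define N where "N = Suc (Max (insert 0 (\<Union>m \<in> form_vars \<phi>. trm_vars (\<sigma> m))))"
  have fresh: "k \<noteq> N" if "m \<in> form_vars \<phi>" "k \<in> trm_vars (\<sigma> m)" for m k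
  proof -
    have "k \<le> Max (insert 0 (\<Union>m \<in> form_vars \<phi>. trm_vars (\<sigma> m)))"
      using that by (intro Max_ge) auto
    then show ?thesis by (simp add: N_def)
  qed
  have wf: "\<And>k. wf_trm L ((\<sigma>(n := Var N)) k)" using Exists.prems by simp
  from Exists.IH[where \<sigma> = "\<sigma>(n := Var N)", OF _ wf] Exists.prems obtain \<phi>' where \<phi>':
    "wf_form L \<phi>'" "\<And>e. sat M e \<phi>' \<longleftrightarrow> sat M (\<lambda>k. trm_val M e ((\<sigma>(n := Var N)) k)) \<phi>" by auto
  have "sat M (e(N := x)) \<phi>' \<longleftrightarrow> sat M ((\<lambda>k. trm_val M e (\<sigma> k))(n := x)) \<phi>" for e x
    unfolding \<phi>'(2) by (rule sat_cong) (auto intro!: trm_val_cong dest: fresh)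
  then show ?case using \<phi>'(1) by (intro exI[of _ "Exists N \<phi>'"]) auto
qed

definition def_term :: "('f, 'r) language \<Rightarrow> ('f, 'r, 'a) struct \<Rightarrow> ((nat \<Rightarrow> 'a) \<Rightarrow> 'a) \<Rightarrow> bool" where
  "def_term L M \<tau> \<longleftrightarrow> (\<exists>t. wf_trm L t \<and> (\<forall>e. trm_val M e t = \<tau> e))"

text \<open>Definability without parameters, for predicates of the whole assignment. Parameters are
  entries of the assignment, so one such predicate covers a whole family.\<close>

definition def_pred :: "('f, 'r) language \<Rightarrow> ('f, 'r, 'a) struct \<Rightarrow> ((nat \<Rightarrow> 'a) \<Rightarrow> bool) \<Rightarrow> bool" where
  "def_pred L M P \<longleftrightarrow> (\<exists>\<phi> \<in> formulas L. \<forall>e. sat M e \<phi> \<longleftrightarrow> P e)"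

lemma def_predI: "\<phi> \<in> formulas L \<Longrightarrow> (\<And>e. sat M e \<phi> \<longleftrightarrow> P e) \<Longrightarrow> def_pred L M P"
  unfolding def_pred_def by blast

lemma def_term_var: "def_term L M (\<lambda>e. e i)"
  unfolding def_term_def by (rule exI[of _ "Var i"]) simp

lemma def_pred_eq: "def_term L M \<tau> \<Longrightarrow> def_term L M \<sigma> \<Longrightarrow> def_pred L M (\<lambda>e. \<tau> e = \<sigma> e)"
  unfolding def_term_def
  by (elim exE conjE, rule_tac \<phi> = "Equal t ta" in def_predI) (auto simp: formulas_def)

lemma def_pred_not: "def_pred L M P \<Longrightarrow> def_pred L M (\<lambda>e. \<not> P e)"
  unfolding def_pred_def
  by (elim bexE, rule_tac x = "form.Not \<phi>" in bexI) (auto simp: formulas_def)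

lemma def_pred_conj: "def_pred L M P \<Longrightarrow> def_pred L M Q \<Longrightarrow> def_pred L M (\<lambda>e. P e \<and> Q e)"
  unfolding def_pred_def
  by (elim bexE, rule_tac x = "And \<phi> \<phi>'" in bexI) (auto simp: formulas_def)

lemma def_pred_disj:
  assumes "def_pred L M P" "def_pred L M Q" shows "def_pred L M (\<lambda>e. P e \<or> Q e)"
  using def_pred_not[OF def_pred_conj[OF def_pred_not[OF assms(1)] def_pred_not[OF assms(2)]]] by simp

lemma def_pred_imp:
  assumes "def_pred L M P" "def_pred L M Q" shows "def_pred L M (\<lambda>e. P e \<longrightarrow> Q e)"
  using def_pred_disj[OF def_pred_not[OF assms(1)] assms(2)] unfolding imp_conv_disj .

lemma def_pred_iff:
  assumes "def_pred L M P" "def_pred L M Q" shows "def_pred L M (\<lambda>e. P e \<longleftrightarrow> Q e)"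
  using def_pred_conj[OF def_pred_imp[OF assms] def_pred_imp[OF assms(2,1)]]
  by (simp add: iff_conv_conj_imp)

lemma def_pred_const: "def_pred L M (\<lambda>e. b)"
proof -
  have "def_pred L M (\<lambda>e. e 0 = e (0::nat))" by (intro def_pred_eq def_term_var)
  from this def_pred_not[OF this] show ?thesis by (cases b) simp_all
qed

lemma def_pred_ball:
  assumes "finite K" and "\<And>k. k \<in> K \<Longrightarrow> def_pred L M (P k)"
  shows "def_pred L M (\<lambda>e. \<forall>k \<in> K. P k e)"
  using assms
proof (induction K rule: finite_induct)
  case empty
  show ?case using def_pred_const[of L M True] by simp
next
  case (insert k K)
  then have "def_pred L M (\<lambda>e. P k e \<and> (\<forall>k \<in> K. P k e))" by (intro def_pred_conj) auto
  then show ?case by simp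
qed

lemma def_pred_all_less:
  fixes n :: nat
  assumes "\<And>k. k < n \<Longrightarrow> def_pred L M (P k)"
  shows "def_pred L M (\<lambda>e. \<forall>k<n. P k e)"
proof -
  have "def_pred L M (\<lambda>e. \<forall>k \<in> {..<n}. P k e)"
    by (rule def_pred_ball) (use assms in auto)
  then show ?thesis by (simp only: Ball_def lessThan_iff)
qed

lemma def_pred_subst:
  assumes "def_pred L M P" and "\<And>i. def_term L M (\<lambda>e. g e i)"
  shows "def_pred L M (\<lambda>e. P (g e))"
proof -
  from assms(1) obtain \<phi> where \<phi>: "wf_form L \<phi>" "\<And>e. sat M e \<phi> \<longleftrightarrow> P e"
    unfolding def_pred_def formulas_def by blast
  from assms(2) obtain \<sigma> where \<sigma>: "\<And>i. wf_trm L (\<sigma> i)" "\<And>i e. trm_val M e (\<sigma> i) = g e i"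
    unfolding def_term_def by metis
  from form_subst[where L = L and \<phi> = \<phi> and \<sigma> = \<sigma> and M = M, OF \<phi>(1) \<sigma>(1)] obtain \<phi>' where "wf_form L \<phi>'"
    "\<And>e. sat M e \<phi>' \<longleftrightarrow> sat M (\<lambda>n. trm_val M e (\<sigma> n)) \<phi>" by blast
  then show ?thesis
    by (intro def_predI[of \<phi>']) (auto simp: \<phi>(2) \<sigma>(2) formulas_def)
qed

lemma def_pred_finite_support:
  assumes "def_pred L M P"
  obtains K where "\<And>e e'. (\<And>n. n < K \<Longrightarrow> e n = e' n) \<Longrightarrow> P e \<longleftrightarrow> P e'"
proof -
  from assms obtain \<phi> where \<phi>: "\<And>e. sat M e \<phi> \<longleftrightarrow> P e" unfolding def_pred_def by blast
  define K where "K = Suc (Max (insert 0 (form_vars \<phi>)))"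
  have "n < K" if "n \<in> form_vars \<phi>" for n
    using that by (auto simp: K_def less_Suc_eq_le)
  then show ?thesis using sat_cong[of \<phi> _ _ M] \<phi> by (metis that)
qed

lemma def_pred_ex_finite:
  assumes "def_pred L M P" "finite V"
  shows "def_pred L M (\<lambda>e. \<exists>e'. (\<forall>i. i \<notin> V \<longrightarrow> e' i = e i) \<and> P e')"
  using assms(2)
proof (induction V rule: finite_induct)
  case empty
  have "(\<exists>e'. (\<forall>i. i \<notin> {} \<longrightarrow> e' i = e i) \<and> P e') = P e" for e by (auto simp flip: fun_eq_iff)
  then show ?case using assms(1) by simp
next
  case (insert n V)
  then obtain \<phi> where \<phi>: "wf_form L \<phi>"
    "\<And>e. sat M e \<phi> \<longleftrightarrow> (\<exists>e'. (\<forall>i. i \<notin> V \<longrightarrow> e' i = e i) \<and> P e')"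
    unfolding def_pred_def formulas_def by blast
  show ?case
  proof (rule def_predI[of "Exists n \<phi>"])
    show "sat M e (Exists n \<phi>) \<longleftrightarrow> (\<exists>e'. (\<forall>i. i \<notin> insert n V \<longrightarrow> e' i = e i) \<and> P e')" for e
    proof
      assume "\<exists>e'. (\<forall>i. i \<notin> insert n V \<longrightarrow> e' i = e i) \<and> P e'"
      then obtain e' where "\<forall>i. i \<notin> insert n V \<longrightarrow> e' i = e i" "P e'" by blast
      then have "\<exists>e''. (\<forall>i. i \<notin> V \<longrightarrow> e'' i = (e(n := e' n)) i) \<and> P e''"
        by (intro exI[of _ e']) auto
      then have "sat M (e(n := e' n)) \<phi>" unfolding \<phi>(2) .
      then show "sat M e (Exists n \<phi>)" by auto
    next
      assume "sat M e (Exists n \<phi>)"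
      then obtain x e' where "\<forall>i. i \<notin> V \<longrightarrow> e' i = (e(n := x)) i" "P e'" by (auto simp: \<phi>(2))
      then show "\<exists>e'. (\<forall>i. i \<notin> insert n V \<longrightarrow> e' i = e i) \<and> P e'"
        by (intro exI[of _ e']) auto
    qed
  qed (use \<phi>(1) in \<open>simp add: formulas_def\<close>)
qed

text \<open>\<open>V\<close> may be infinite: a definable predicate depends on finitely many
  variables, and changing the others has no effect on it.\<close>

lemma def_pred_ex_vars:
  assumes "def_pred L M P"
  shows "def_pred L M (\<lambda>e. \<exists>e'. (\<forall>i. i \<notin> V \<longrightarrow> e' i = e i) \<and> P e')"
proof -
  obtain K where K: "\<And>e e'. (\<And>n. n < K \<Longrightarrow> e n = e' n) \<Longrightarrow> P e \<longleftrightarrow> P e'"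
    using def_pred_finite_support[OF assms] by blast
  have "(\<exists>e'. (\<forall>i. i \<notin> V \<longrightarrow> e' i = e i) \<and> P e') \<longleftrightarrow>
      (\<exists>e'. (\<forall>i. i \<notin> V \<inter> {..<K} \<longrightarrow> e' i = e i) \<and> P e')" for e
  proof
    assume "\<exists>e'. (\<forall>i. i \<notin> V \<longrightarrow> e' i = e i) \<and> P e'"
    then obtain e' where e': "\<forall>i. i \<notin> V \<longrightarrow> e' i = e i" "P e'" by blast
    then have "P (\<lambda>i. if i < K then e' i else e i)"
      by (intro iffD1[OF K, OF _ e'(2)]) simp
    then show "\<exists>e'. (\<forall>i. i \<notin> V \<inter> {..<K} \<longrightarrow> e' i = e i) \<and> P e'"
      using e'(1) by (intro exI[of _ "\<lambda>i. if i < K then e' i else e i"]) auto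
  qed auto
  then show ?thesis using def_pred_ex_finite[OF assms, of "V \<inter> {..<K}"] by simp
qed

text \<open>The bound element sits at \<open>0\<close> and the old assignment is shifted by one, so
  quantifiers can be treated without naming variables.\<close>

lemma def_pred_ex:
  fixes M :: "('f, 'r, 'a) struct" and Q :: "'a \<Rightarrow> (nat \<Rightarrow> 'a) \<Rightarrow> bool"
  assumes "def_pred L M (\<lambda>e. Q (e 0) (\<lambda>i. e (Suc i)))"
  shows "def_pred L M (\<lambda>e. \<exists>x. Q x e)"
proof -
  have "def_pred L M (\<lambda>e. \<exists>e'. (\<forall>i. i \<notin> {0} \<longrightarrow> e' i = e (i - 1)) \<and> Q (e' 0) (\<lambda>i. e' (Suc i)))"
    by (rule def_pred_subst[OF def_pred_ex_vars[OF assms, of "{0}"], of "\<lambda>e i. e (i - 1)"])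
      (rule def_term_var)
  moreover have "(\<exists>e'. (\<forall>i. i \<notin> {0} \<longrightarrow> e' i = e (i - 1)) \<and> Q (e' 0) (\<lambda>i. e' (Suc i))) \<longleftrightarrow>
      (\<exists>x. Q x e)" for e
  proof
    assume "\<exists>e'. (\<forall>i. i \<notin> {0} \<longrightarrow> e' i = e (i - 1)) \<and> Q (e' 0) (\<lambda>i. e' (Suc i))"
    then show "\<exists>x. Q x e" by auto
  next
    assume "\<exists>x. Q x e"
    then obtain x where "Q x e" by blast
    then show "\<exists>e'. (\<forall>i. i \<notin> {0} \<longrightarrow> e' i = e (i - 1)) \<and> Q (e' 0) (\<lambda>i. e' (Suc i))"
      by (intro exI[of _ "case_nat x e"]) (auto split: nat.split)
  qed
  ultimately show ?thesis by simp
qed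

lemma def_pred_all:
  assumes "def_pred L M (\<lambda>e. Q (e 0) (\<lambda>i. e (Suc i)))"
  shows "def_pred L M (\<lambda>e. \<forall>x. Q x e)"
  using def_pred_not[OF def_pred_ex[OF def_pred_not[OF assms]]] by simp

text \<open>Even entries hold the quantified sequence, odd entries the old assignment. This allows
  lists of arbitrary finite length, such as centers and radii of balls, to be quantified in one
  step.\<close>

lemma def_pred_ex_seq:
  fixes M :: "('f, 'r, 'a) struct" and Q :: "(nat \<Rightarrow> 'a) \<Rightarrow> (nat \<Rightarrow> 'a) \<Rightarrow> bool"
  assumes "def_pred L M (\<lambda>e. Q (\<lambda>i. e (2 * i)) (\<lambda>i. e (2 * i + 1)))"
  shows "def_pred L M (\<lambda>e. \<exists>a. Q a e)"
proof -
  have "def_pred L M (\<lambda>e. \<exists>e'. (\<forall>i. i \<notin> Collect even \<longrightarrow> e' i = e (i div 2)) \<and>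
      Q (\<lambda>i. e' (2 * i)) (\<lambda>i. e' (2 * i + 1)))"
    by (rule def_pred_subst[OF def_pred_ex_vars[OF assms, of "Collect even"], of "\<lambda>e i. e (i div 2)"])
      (rule def_term_var)
  moreover have "(\<exists>e'. (\<forall>i. i \<notin> Collect even \<longrightarrow> e' i = e (i div 2)) \<and>
      Q (\<lambda>i. e' (2 * i)) (\<lambda>i. e' (2 * i + 1))) \<longleftrightarrow> (\<exists>a. Q a e)" for e
  proof
    assume "\<exists>e'. (\<forall>i. i \<notin> Collect even \<longrightarrow> e' i = e (i div 2)) \<and>
      Q (\<lambda>i. e' (2 * i)) (\<lambda>i. e' (2 * i + 1))"
    then show "\<exists>a. Q a e" by auto
  next
    assume "\<exists>a. Q a e"
    then obtain a where "Q a e" by blast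
    then show "\<exists>e'. (\<forall>i. i \<notin> Collect even \<longrightarrow> e' i = e (i div 2)) \<and>
        Q (\<lambda>i. e' (2 * i)) (\<lambda>i. e' (2 * i + 1))"
      by (intro exI[of _ "\<lambda>i. if even i then a (i div 2) else e (i div 2)"]) auto
  qed
  ultimately show ?thesis by simp
qed

lemmas def_intros = def_term_var def_pred_eq def_pred_not def_pred_conj def_pred_disj
  def_pred_imp def_pred_iff def_pred_ex def_pred_all

section \<open>Saturation for countable types, in one and in countably many variables\<close>

lemma countable_saturation:
  assumes "monster_model L M"
    and P: "\<And>n. def_pred L M (P n)"
    and fin: "\<And>m. \<exists>x. \<forall>n<m. P n (case_nat x (c n))"
  shows "\<exists>x. \<forall>n::nat. P n (case_nat x (c n))"
proof -
  obtain \<kappa> where \<kappa>: "Card_order \<kappa>" "|formulas L| <o \<kappa>" "saturated L M \<kappa>"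
    using assms(1) unfolding monster_model_def by blast
  obtain \<phi> where \<phi>: "\<And>n. \<phi> n \<in> formulas L" "\<And>n e. sat M e (\<phi> n) \<longleftrightarrow> P n e"
    using P unfolding def_pred_def by metis
  define A where "A = (\<Union>n. range (c n))"
  \<comment> \<open>The entry at \<open>0\<close> is a dummy, overwritten by the realization
    \<open>x\<close>.\<close>
  define p where "p = range (\<lambda>n. (\<phi> n, case_nat (c 0 0) (c n)))"
  have eq: "(case_nat y e)(0 := x) = case_nat x e" for x y and e :: "nat \<Rightarrow> 'c"
    by (auto split: nat.split)
  \<comment> \<open>The trivial equations show that there are infinitely many formulas, so a
    countable parameter set is smaller than \<open>\<kappa>\<close>.\<close>
  have "inj (\<lambda>n. Equal (Var n) (Var n) :: ('a, 'b) form)" by (auto simp: inj_def)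
  moreover have "range (\<lambda>n. Equal (Var n) (Var n)) \<subseteq> formulas L" by (auto simp: formulas_def)
  ultimately have "|UNIV :: nat set| \<le>o |formulas L|" by (metis card_of_ordLeq)
  moreover have "|A| \<le>o |UNIV :: nat set|"
    unfolding A_def
    by (intro card_of_UNION_ordLeq_infinite ballI)
      (use card_of_mono1[OF subset_UNIV] card_of_image in auto)
  ultimately have A: "|A| <o \<kappa>" using \<kappa>(2) by (metis ordLeq_ordLess_trans ordLeq_transitive)
  have p: "p \<subseteq> {(\<phi>, e). \<phi> \<in> formulas L \<and> (\<forall>n \<ge> 1. e n \<in> A)}"
    using \<phi>(1) by (auto simp: p_def A_def split: nat.split) blast
  have q: "\<exists>x. \<forall>(\<phi>, e) \<in> q. sat M (e(0 := x)) \<phi>" if "q \<subseteq> p" "finite q" for q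
  proof -
    obtain I where I: "finite I" "q = (\<lambda>n. (\<phi> n, case_nat (c 0 0) (c n))) ` I"
      using \<open>q \<subseteq> p\<close> \<open>finite q\<close> finite_subset_image[of q _ UNIV] unfolding p_def by blast
    obtain m where m: "\<And>n. n \<in> I \<Longrightarrow> n < m" using finite_nat_bounded[OF I(1)] by auto
    obtain x where "\<forall>n<m. P n (case_nat x (c n))" using fin by blast
    then have "\<forall>n \<in> I. sat M ((case_nat (c 0 0) (c n))(0 := x)) (\<phi> n)"
      unfolding eq \<phi>(2) using m by blast
    then show ?thesis unfolding I(2) by blast
  qed
  have "\<forall>q \<subseteq> p. finite q \<longrightarrow> (\<exists>x. \<forall>(\<phi>, e) \<in> q. sat M (e(0 := x)) \<phi>)"
    by (intro allI impI q)
  with \<kappa>(3)[unfolded saturated_def, THEN spec, THEN spec, THEN mp, OF A, THEN mp, OF p]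
  obtain x where "\<forall>(\<phi>, e) \<in> p. sat M (e(0 := x)) \<phi>" by (elim impE exE)
  then have "sat M ((case_nat (c 0 0) (c n))(0 := x)) (\<phi> n)" for n unfolding p_def by blast
  then show ?thesis unfolding eq \<phi>(2) by blast
qed

text \<open>The entries of a realization are chosen one at a time by saturation in one variable. As
  \<open>Q\<close> is decreasing in \<open>n\<close>, finitely many conditions amount to the
  strongest of them.\<close>

lemma countable_saturation_seq:
  assumes MM: "monster_model L M"
    and Q: "\<And>n. def_pred L M (Q n)"
    and decr: "\<And>m n e. m \<le> n \<Longrightarrow> Q n e \<Longrightarrow> Q m e"
    and ex: "\<And>n. \<exists>e. Q n e"
  shows "\<exists>e. \<forall>n::nat. Q n e"
proof -
  \<comment> \<open>The invariant of the recursion: \<open>Q n\<close> can still be satisfied once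
    the entries below \<open>k\<close> are fixed.\<close>
  define R where "R k n e \<longleftrightarrow> (\<exists>e'. (\<forall>i. i \<notin> {k..} \<longrightarrow> e' i = e i) \<and> Q n e')" for k n e
  have R_def_pred: "def_pred L M (R k n)" for k n
    unfolding R_def by (rule def_pred_ex_vars) (rule Q)
  have step: "\<exists>x. \<forall>n. R (Suc k) n (s(k := x))" if s: "\<forall>n. R k n s" for k s
  proof -
    define P where "P n e = R (Suc k) n (\<lambda>i. if i = k then e 0 else e (Suc i))" for n e
    have eq: "P n (case_nat x s) \<longleftrightarrow> R (Suc k) n (s(k := x))" for n x
      unfolding P_def by (rule arg_cong[of _ _ "R (Suc k) n"]) auto
    have "\<exists>x. \<forall>n. P n (case_nat x s)"
    proof (rule countable_saturation[OF MM])
      show "def_pred L M (P n)" for n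
        unfolding P_def
        by (rule def_pred_subst[OF R_def_pred], case_tac "i = k") (auto intro: def_term_var)
      fix m
      obtain e where e: "\<And>i. i \<notin> {k..} \<Longrightarrow> e i = s i" "Q m e" using s unfolding R_def by blast
      then have "P n (case_nat (e k) s)" if "n < m" for n
        unfolding eq R_def using decr[of n m e] that by (intro exI[of _ e]) auto
      then show "\<exists>x. \<forall>n<m. P n (case_nat x s)" by blast
    qed
    then show ?thesis unfolding eq .
  qed
  define s where "s = rec_nat undefined (\<lambda>k s. s(k := SOME x. \<forall>n. R (Suc k) n (s(k := x))))"
  have s_Suc: "s (Suc k) = (s k)(k := SOME x. \<forall>n. R (Suc k) n ((s k)(k := x)))" for k
    by (simp add: s_def)
  have s: "\<forall>n. R k n (s k)" for k
  proof (induction k)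
    case 0
    show ?case using ex by (auto simp: R_def)
  next
    case (Suc k)
    from someI_ex[OF step[OF Suc.IH]] show ?case unfolding s_Suc .
  qed
  \<comment> \<open>Entry \<open>i\<close> is settled at stage \<open>Suc i\<close>. Each
    \<open>Q n\<close> looks at finitely many entries only, so it passes from a stage
    \<open>s K\<close> to the diagonal.\<close>
  have stable: "s (k + d) i = s k i" if "i < k" for k d i
    using that by (induction d) (auto simp: s_Suc)
  have "Q n (\<lambda>i. s (Suc i) i)" for n
  proof -
    obtain K where K: "\<And>e e'. (\<And>n. n < K \<Longrightarrow> e n = e' n) \<Longrightarrow> Q n e \<longleftrightarrow> Q n e'"
      using def_pred_finite_support[OF Q] by blast
    obtain e' where e': "\<And>i. i < K \<Longrightarrow> e' i = s K i" "Q n e'"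
      using spec[OF s[of K], of n] unfolding R_def by (meson atLeast_iff not_le)
    moreover have "s K i = s (Suc i) i" if "i < K" for i
      using stable[of i "Suc i" "K - Suc i"] that by simp
    ultimately show ?thesis by (intro iffD1[OF K, OF _ e'(2)]) simp
  qed
  then show ?thesis by blast
qed

section \<open>Valuations, balls and the classes of RV\<close>

lemma card_image_le_of_factor:
  assumes "finite (g ` X)" and "\<And>x y. x \<in> X \<Longrightarrow> y \<in> X \<Longrightarrow> g x = g y \<Longrightarrow> f x = f y"
  shows "finite (f ` X)" and "card (f ` X) \<le> card (g ` X)"
proof -
  define h where "h z = f (SOME x. x \<in> X \<and> g x = z)" for z
  have "h (g x) = f x" if "x \<in> X" for x
    unfolding h_def using that someI[of "\<lambda>y. y \<in> X \<and> g y = g x" x] by (intro assms(2)) auto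
  then have "f ` X = h ` g ` X" by (force simp: image_image)
  then show "finite (f ` X)" and "card (f ` X) \<le> card (g ` X)"
    using assms(1) card_image_le by auto
qed

text \<open>The members containing a point form a chain, so a nonempty trace is determined by its
  smallest member. The additional \<open>1\<close> accounts for points in no member.\<close>

lemma laminar_cells:
  assumes "finite \<B>" and lam: "\<And>B C. B \<in> \<B> \<Longrightarrow> C \<in> \<B> \<Longrightarrow> B \<subseteq> C \<or> C \<subseteq> B \<or> B \<inter> C = {}"
  shows "finite ((\<lambda>x. {B \<in> \<B>. x \<in> B}) ` X)"
    and "card ((\<lambda>x. {B \<in> \<B>. x \<in> B}) ` X) \<le> card \<B> + 1"
proof -
  let ?tr = "\<lambda>x. {B \<in> \<B>. x \<in> B}"
  have "?tr ` X \<subseteq> Pow \<B>" by auto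
  then show fin: "finite (?tr ` X)" using assms(1) finite_subset by blast
  have mem: "\<Inter>T \<in> \<B>" if T: "T \<in> ?tr ` X" "T \<noteq> {}" for T
  proof -
    obtain x where x: "T = ?tr x" using T(1) by blast
    then have "finite T" using assms(1) by simp
    then obtain B where B: "B \<in> T" "\<And>C. C \<in> T \<Longrightarrow> C \<subseteq> B \<Longrightarrow> C = B"
      using finite_has_minimal[of T] T(2) by metis
    have "B \<subseteq> C" if "C \<in> T" for C
      using lam[of B C] B that unfolding x by blast
    then have "\<Inter>T = B" using B(1) by blast
    then show ?thesis using B(1) x by simp
  qed
  have "inj_on Inter (?tr ` X - {{}})"
  proof (rule inj_onI)
    have char: "T = {B \<in> \<B>. \<Inter>T \<subseteq> B}" if "T \<in> ?tr ` X" for T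
    proof -
      from that obtain x where "T = ?tr x" by blast
      then show ?thesis by blast
    qed
    fix S T assume "S \<in> ?tr ` X - {{}}" "T \<in> ?tr ` X - {{}}" "\<Inter>S = \<Inter>T"
    then show "S = T" using char[of S] char[of T] by simp
  qed
  then have "card (?tr ` X - {{}}) \<le> card \<B>"
    using mem by (intro card_inj_on_le[OF _ _ assms(1)]) auto
  moreover have "card (?tr ` X) \<le> card (?tr ` X - {{}}) + 1"
    using fin card_Diff_singleton_if[of "?tr ` X" "{}"] by (simp split: if_splits)
  ultimately show "card (?tr ` X) \<le> card \<B> + 1" by linarith
qed

locale valued_field =
  fixes v :: "'a::field \<Rightarrow> 'g::linordered_ab_group_add"
  assumes valuation: "nontrivial_valuation v"
begin

lemma v_mult: "x \<noteq> 0 \<Longrightarrow> y \<noteq> 0 \<Longrightarrow> v (x * y) = v x + v y"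
  using valuation by (simp add: nontrivial_valuation_def)

lemma v_add: "x \<noteq> 0 \<Longrightarrow> y \<noteq> 0 \<Longrightarrow> x + y \<noteq> 0 \<Longrightarrow> min (v x) (v y) \<le> v (x + y)"
  using valuation by (simp add: nontrivial_valuation_def)

lemma v_surj: "\<exists>x. x \<noteq> 0 \<and> v x = \<gamma>"
proof -
  have "\<gamma> \<in> v ` (- {0})" using valuation by (simp add: nontrivial_valuation_def)
  then show ?thesis by auto
qed

lemma v_one: "v 1 = 0"
  using v_mult[of 1 1] by simp

lemma v_uminus: "v (- x) = v x"
proof (cases "x = 0")
  case False
  have "v (-1) + v (-1) = 0" using v_mult[of "-1" "-1"] v_one by simp
  then have "v (-1) = 0" by simp
  then show ?thesis using v_mult[of "-1" x] False by simp
qed simp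

lemma v_minus_commute: "v (x - y) = v (y - x)"
  using v_uminus[of "x - y"] by simp

lemma v_divide: "x \<noteq> 0 \<Longrightarrow> y \<noteq> 0 \<Longrightarrow> v (x / y) = v x - v y"
  using v_mult[of "x / y" y] by (simp add: algebra_simps)

text \<open>Comparison of values with \<open>v 0\<close> read as infinity, in agreement with
  \<open>VDiv\<close>; this makes it first order in the home sort.\<close>

definition vle :: "'a \<Rightarrow> 'a \<Rightarrow> bool" where
  "vle x y \<longleftrightarrow> y = 0 \<or> x \<noteq> 0 \<and> v x \<le> v y"

lemma vle_trans: "vle x y \<Longrightarrow> vle y z \<Longrightarrow> vle x z"
  unfolding vle_def by auto

lemma vle_total: "vle x y \<or> vle y x"
  unfolding vle_def by auto

lemma vle_uminus: "vle x (- y) = vle x y" "vle (- x) y = vle x y"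
  unfolding vle_def by (auto simp: v_uminus)

lemma vle_minus_commute: "vle d (x - y) = vle d (y - x)" "vle (x - y) d = vle (y - x) d"
  using vle_uminus[of d "x - y"] vle_uminus[of "x - y" d] by simp_all

lemma vle_add: "vle d x \<Longrightarrow> vle d y \<Longrightarrow> vle d (x + y)"
  unfolding vle_def using v_add[of x y] by (cases "x = 0"; cases "y = 0") (auto intro: order_trans[rotated] simp: min_def split: if_splits)

lemma not_vle_add: "\<not> vle x d \<Longrightarrow> \<not> vle y d \<Longrightarrow> \<not> vle (x + y) d"
  unfolding vle_def using v_add[of x y] by (cases "x = 0"; cases "y = 0") (auto simp: min_le_iff_disj)

lemma rv_eq_open_vball: "x \<noteq> 0 \<Longrightarrow> rv v x = open_vball v x (v x)"
proof (intro set_eqI iffI)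
  fix y assume x: "x \<noteq> 0"
  { assume "y \<in> rv v x"
    then obtain u where "u = 0 \<or> 0 < v u" "y = x * (1 + u)"
      unfolding rv_def max_ideal_def by auto
    moreover have "x * (1 + u) - x = x * u" by (simp add: algebra_simps)
    ultimately show "y \<in> open_vball v x (v x)"
      using x v_mult[of x u] by (cases "u = 0") (auto simp: open_vball_def) }
  { assume y: "y \<in> open_vball v x (v x)"
    show "y \<in> rv v x"
      unfolding rv_def
    proof (rule image_eqI)
      show "y = x * (1 + (y - x) / x)" using x by (simp add: field_simps)
      show "(y - x) / x \<in> max_ideal v"
        using y x v_divide[of "y - x" x] by (cases "y = x") (auto simp: open_vball_def max_ideal_def)
    qed }
qed

text \<open>Classes are open balls with radius the value of the center, and any point of a ball is a
  center. Written with \<open>vle\<close>, equality in RV becomes definable in the home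
  sort.\<close>

lemma rv_eq_iff: "x \<noteq> 0 \<Longrightarrow> y \<noteq> 0 \<Longrightarrow> rv v x = rv v y \<longleftrightarrow> \<not> vle (x - y) x"
proof
  assume nz: "x \<noteq> 0" "y \<noteq> 0"
  { assume "rv v x = rv v y"
    then have "y \<in> rv v x" using rv_eq_open_vball[OF nz(2)] by (simp add: open_vball_def)
    then have "y = x \<or> v x < v (x - y)"
      unfolding rv_eq_open_vball[OF nz(1)] open_vball_def by (simp add: v_minus_commute[of x y])
    then show "\<not> vle (x - y) x" using nz by (auto simp: vle_def) }
  { assume less: "\<not> vle (x - y) x"
    have open_iff: "open_vball v z (v z) = {w. \<not> vle (z - w) z}" if "z \<noteq> 0" for z
      using that unfolding open_vball_def vle_def by (auto simp: v_minus_commute[of z])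
    have "v x = v y"
    proof (cases "x = y")
      case False
      then have lt: "v x < v (x - y)" using less nz by (auto simp: vle_def)
      then have "min (v x) (v (x - y)) \<le> v y"
        using v_add[of x "y - x"] False nz by (simp add: v_minus_commute[of y x])
      moreover have "min (v y) (v (x - y)) \<le> v x" using v_add[of y "x - y"] False nz by simp
      ultimately show ?thesis using lt by (auto simp: min_le_iff_disj)
    qed simp
    then have vx: "vle z x = vle z y" for z using nz by (simp add: vle_def)
    have "\<not> vle (x - w) x \<longleftrightarrow> \<not> vle (y - w) y" for w
    proof -
      have "\<not> vle (y - w) x" if "\<not> vle (x - w) x"
        using not_vle_add[of "y - x" x "x - w"] less that vle_minus_commute(2)[of x y x] by simp
      moreover have "\<not> vle (x - w) x" if "\<not> vle (y - w) x"
        using not_vle_add[of "x - y" x "y - w"] less that by simp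
      ultimately show ?thesis using vx by blast
    qed
    then show "rv v x = rv v y"
      unfolding rv_eq_open_vball[OF nz(1)] rv_eq_open_vball[OF nz(2)] using open_iff nz by simp }
qed

lemma rv_eq_imp_v_eq: "x \<noteq> 0 \<Longrightarrow> y \<noteq> 0 \<Longrightarrow> rv v x = rv v y \<Longrightarrow> v x = v y"
proof -
  assume nz: "x \<noteq> 0" "y \<noteq> 0" and "rv v x = rv v y"
  then have "\<not> vle (x - y) x" "\<not> vle (y - x) y"
    using rv_eq_iff[of x y] rv_eq_iff[of y x] by simp_all
  then show ?thesis
    using nz v_add[of x "y - x"] v_add[of y "x - y"]
    by (cases "x = y") (auto simp: vle_def v_minus_commute[of x y] min_le_iff_disj)
qed

lemma rv_mult_iff:
  assumes "c \<noteq> 0" "x \<noteq> 0" "y \<noteq> 0"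
  shows "rv v (c * x) = rv v (c * y) \<longleftrightarrow> rv v x = rv v y"
proof -
  have "c * x - c * y = c * (x - y)" by (simp add: algebra_simps)
  then have "vle (c * x - c * y) (c * x) \<longleftrightarrow> vle (x - y) x"
    using assms v_mult[of c x] v_mult[of c "x - y"] by (auto simp: vle_def)
  then show ?thesis using assms rv_eq_iff by simp
qed

lemma rv_divide: "(\<lambda>z. z / c) ` rv v x = rv v (x / c)"
  unfolding rv_def by (simp add: image_image)

text \<open>Subsets of RV are represented by their preimages in the home sort, the unions of classes
  of nonzero elements.\<close>

definition rv_inv :: "('a \<Rightarrow> bool) \<Rightarrow> bool" where
  "rv_inv A \<longleftrightarrow> (\<forall>x. A x \<longrightarrow> x \<noteq> 0) \<and>
    (\<forall>x y. A x \<longrightarrow> y \<noteq> 0 \<longrightarrow> rv v x = rv v y \<longrightarrow> A y)"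

lemma rv_invD: "rv_inv A \<Longrightarrow> A x \<Longrightarrow> x \<noteq> 0"
  "rv_inv A \<Longrightarrow> A x \<Longrightarrow> y \<noteq> 0 \<Longrightarrow> rv v x = rv v y \<Longrightarrow> A y"
  unfolding rv_inv_def by blast+

abbreviation rv_set :: "('a \<Rightarrow> bool) \<Rightarrow> 'a set set" where
  "rv_set A \<equiv> rv v ` Collect A"

abbreviation rv_part :: "('a \<Rightarrow> bool) \<Rightarrow> 'g \<Rightarrow> 'a set set" where
  "rv_part A \<gamma> \<equiv> rv v ` {x. A x \<and> v x = \<gamma>}"

lemma rv_mem_part_iff: "rv_inv A \<Longrightarrow> x \<noteq> 0 \<Longrightarrow> rv v x \<in> rv_part A \<gamma> \<longleftrightarrow> A x \<and> v x = \<gamma>"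
proof -
  assume A: "rv_inv A" "x \<noteq> 0"
  { fix y assume "A y" "rv v x = rv v y"
    then have "A x" "v x = v y" using A rv_invD rv_eq_imp_v_eq by metis+ }
  then show ?thesis by auto
qed

text \<open>
  A ball is given by its center \<open>a\<close> and an element \<open>d\<close> whose value is the radius; for \<open>d = 0\<close> the
  closed ball is the point \<open>a\<close> and the open one is empty.
\<close>

definition same_side :: "'a \<Rightarrow> 'a \<Rightarrow> 'a \<Rightarrow> 'a \<Rightarrow> bool" where
  "same_side a d x x' \<longleftrightarrow> (vle d (x - a) \<longleftrightarrow> vle d (x' - a)) \<and> (vle (x - a) d \<longleftrightarrow> vle (x' - a) d)"

text \<open>A boolean combination of balls is a union of cells, that is, invariant under having the
  same trace on the balls. Each index provides a closed and an open ball with common center and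
  radius. In this form the condition is first order in a definable family.\<close>

definition ball_comb :: "nat \<Rightarrow> ('a \<Rightarrow> bool) \<Rightarrow> bool" where
  "ball_comb N A \<longleftrightarrow> (\<exists>a d. \<forall>x x'. (\<forall>k<N. same_side (a k) (d k) x x') \<longrightarrow> (A x \<longleftrightarrow> A x'))"

lemma ball_combD:
  assumes "\<forall>x x'. (\<forall>k<N. same_side (a k) (d k) x x') \<longrightarrow> (A x \<longleftrightarrow> A x')"
    and "\<And>k. k < N \<Longrightarrow> same_side (a k) (d k) x x'"
  shows "A x \<longleftrightarrow> A x'"
  by (rule mp[OF spec[OF spec[OF assms(1)]]]) (simp add: assms(2))

lemma ball_combI:
  assumes "\<And>x x'. (\<And>k. k < N \<Longrightarrow> same_side (a k) (d k) x x') \<Longrightarrow> A x \<longleftrightarrow> A x'"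
  shows "ball_comb N A"
  unfolding ball_comb_def
  by (rule exI[of _ a], rule exI[of _ d], intro allI impI, rule assms) simp

lemma ball_comb_mono:
  assumes "ball_comb m A" "m \<le> n"
  shows "ball_comb n A"
proof -
  from assms(1) obtain a d
    where "\<forall>x x'. (\<forall>k<m. same_side (a k) (d k) x x') \<longrightarrow> (A x \<longleftrightarrow> A x')"
    unfolding ball_comb_def by (elim exE)
  note ad = ball_combD[OF this]
  show ?thesis by (rule ball_combI[of n a d], rule ad) (use assms(2) in auto)
qed

lemma ball_comb_basic:
  assumes "\<And>x x'. same_side a d x x' \<Longrightarrow> A x \<longleftrightarrow> A x'"
  shows "\<exists>N. ball_comb N A"
  unfolding ball_comb_def
  by (rule exI[of _ 1], rule exI[of _ "\<lambda>_. a"], rule exI[of _ "\<lambda>_. d"]) (use assms in auto)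

lemma boolean_combination_imp_ball_comb:
  assumes "S \<in> boolean_combinations
      ({closed_vball v a \<gamma> | a \<gamma>. True} \<union> {open_vball v a \<gamma> | a \<gamma>. True} \<union> {{a} | a. True})"
  shows "\<exists>N. ball_comb N (\<lambda>x. x \<in> S)"
  using assms
proof (induction rule: boolean_combinations.induct)
  case (basic B)
  then consider a \<gamma> where "B = closed_vball v a \<gamma>" | a \<gamma> where "B = open_vball v a \<gamma>"
    | a where "B = {a}" by blast
  then show ?case
  proof cases
    case 1
    obtain d where d: "d \<noteq> 0" "v d = \<gamma>" using v_surj by blast
    then have "B = {x. vle d (x - a)}" unfolding 1 closed_vball_def vle_def by auto
    then show ?thesis by (intro ball_comb_basic[of a d]) (auto simp: same_side_def)
  next
    case 2
    obtain d where d: "d \<noteq> 0" "v d = \<gamma>" using v_surj by blast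
    then have "B = {x. \<not> vle (x - a) d}" unfolding 2 open_vball_def vle_def by auto
    then show ?thesis by (intro ball_comb_basic[of a d]) (auto simp: same_side_def)
  next
    case 3
    then have "B = {x. vle 0 (x - a)}" unfolding vle_def by auto
    then show ?thesis by (intro ball_comb_basic[of a 0]) (auto simp: same_side_def)
  qed
next
  case (compl A)
  then show ?case by (auto simp: ball_comb_def)
next
  case (union A B)
  then obtain m n where mn: "ball_comb m (\<lambda>x. x \<in> A)" "ball_comb n (\<lambda>x. x \<in> B)" by blast
  from mn(1) obtain a d
    where "\<forall>x x'. (\<forall>k<m. same_side (a k) (d k) x x') \<longrightarrow> (x \<in> A \<longleftrightarrow> x' \<in> A)"
    unfolding ball_comb_def by (elim exE)
  note m = ball_combD[where A = "\<lambda>x. x \<in> A", OF this]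
  from mn(2) obtain a' d'
    where "\<forall>x x'. (\<forall>k<n. same_side (a' k) (d' k) x x') \<longrightarrow> (x \<in> B \<longleftrightarrow> x' \<in> B)"
    unfolding ball_comb_def by (elim exE)
  note n = ball_combD[where A = "\<lambda>x. x \<in> B", OF this]
  have "ball_comb (m + n) (\<lambda>x. x \<in> A \<union> B)"
  proof (rule ball_combI)
    fix x x'
    assume *: "\<And>k. k < m + n \<Longrightarrow> same_side (if k < m then a k else a' (k - m))
      (if k < m then d k else d' (k - m)) x x'"
    have "x \<in> A \<longleftrightarrow> x' \<in> A"
    proof (rule m)
      show "same_side (a k) (d k) x x'" if "k < m" for k using *[of k] that by simp
    qed
    moreover have "x \<in> B \<longleftrightarrow> x' \<in> B"
    proof (rule n)
      show "same_side (a' k) (d' k) x x'" if "k < n" for k using *[of "m + k"] that by simp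
    qed
    ultimately show "x \<in> A \<union> B \<longleftrightarrow> x' \<in> A \<union> B" by blast
  qed
  then show ?case by blast
qed

text \<open>Every point of a ball is a center of it. Two balls with a common point can therefore be
  made concentric, and are then compared by their radii.\<close>

lemma balls_laminar:
  assumes "B \<in> {{x. vle d (x - a)}, {x. \<not> vle (x - a) d}}"
    and "C \<in> {{x. vle d' (x - a')}, {x. \<not> vle (x - a') d'}}"
  shows "B \<subseteq> C \<or> C \<subseteq> B \<or> B \<inter> C = {}"
proof (rule ccontr)
  assume not: "\<not> ?thesis"
  then obtain x where x: "x \<in> B" "x \<in> C" by blast
  have closed: "{y. vle d (y - a)} = {y. vle d (y - x)}" if "vle d (x - a)" for d a
    using that vle_add[of d "_ - x" "x - a"] vle_add[of d "_ - a" "a - x"]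
      vle_minus_commute(1)[of d a x] by auto
  have "open": "{y. \<not> vle (y - a) d} = {y. \<not> vle (y - x) d}" if "\<not> vle (x - a) d" for d a
    using that not_vle_add[of "_ - x" d "x - a"] not_vle_add[of "_ - a" d "a - x"]
      vle_minus_commute(2)[of a x d] by auto
  have "B \<in> {{y. vle d (y - x)}, {y. \<not> vle (y - x) d}}"
    using assms(1) x(1) closed[of d a] "open"[of a d] by auto
  moreover have "C \<in> {{y. vle d' (y - x)}, {y. \<not> vle (y - x) d'}}"
    using assms(2) x(2) closed[of d' a'] "open"[of a' d'] by auto
  ultimately show False using not vle_total vle_trans by blast
qed

text \<open>Each \<open>A i\<close> is constant on the cells of its \<open>N\<close> closed and
  \<open>N\<close> open balls. So the traces on the \<open>A i\<close> factor through the traces on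
  at most \<open>2 * N * card I\<close> laminar balls.\<close>

lemma card_cells_le:
  assumes "finite I" and bc: "\<And>i. i \<in> I \<Longrightarrow> ball_comb N (A i)"
  shows "finite ((\<lambda>x. {i \<in> I. A i x}) ` X)"
    and "card ((\<lambda>x. {i \<in> I. A i x}) ` X) \<le> 2 * N * card I + 1"
proof -
  obtain a d where ad: "\<And>i x x'. i \<in> I \<Longrightarrow> (\<And>k. k < N \<Longrightarrow> same_side (a i k) (d i k) x x') \<Longrightarrow> A i x \<longleftrightarrow> A i x'"
    using bc unfolding ball_comb_def by metis
  define \<B> where "\<B> = (\<lambda>(i, k). {x. vle (d i k) (x - a i k)}) ` (I \<times> {..<N}) \<union>
    (\<lambda>(i, k). {x. \<not> vle (x - a i k) (d i k)}) ` (I \<times> {..<N})"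
  have fin: "finite \<B>" using assms(1) by (simp add: \<B>_def)
  have card: "card \<B> \<le> 2 * N * card I"
  proof -
    have "card (f ` (I \<times> {..<N})) \<le> card I * N" for f :: "_ \<Rightarrow> 'a set"
      using card_image_le[of "I \<times> {..<N}" f] assms(1) by (simp add: card_cartesian_product)
    then show ?thesis
      unfolding \<B>_def mult_2 distrib_right
      by (intro order_trans[OF card_Un_le] add_mono) (simp_all add: mult.commute)
  qed
  have form: "\<exists>a d. B \<in> {{x. vle d (x - a)}, {x. \<not> vle (x - a) d}}" if "B \<in> \<B>" for B
    using that unfolding \<B>_def Un_iff
    by (elim disjE imageE) (simp_all add: case_prod_beta, blast+)
  have lam: "B \<subseteq> C \<or> C \<subseteq> B \<or> B \<inter> C = {}" if BC: "B \<in> \<B>" "C \<in> \<B>" for B C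
    using form[OF BC(1)] form[OF BC(2)] by (elim exE) (rule balls_laminar)
  have factor: "{i \<in> I. A i x} = {i \<in> I. A i y}"
    if eq: "{B \<in> \<B>. x \<in> B} = {B \<in> \<B>. y \<in> B}" for x y
  proof -
    have "A i x \<longleftrightarrow> A i y" if i: "i \<in> I" for i
    proof (rule ad[OF i])
      fix k assume k: "k < N"
      have mem: "{x. vle (d i k) (x - a i k)} \<in> \<B>" "{x. \<not> vle (x - a i k) (d i k)} \<in> \<B>"
        using i k by (auto simp: \<B>_def)
      have iff: "x \<in> B \<longleftrightarrow> y \<in> B" if "B \<in> \<B>" for B using eq that by auto
      show "same_side (a i k) (d i k) x y"
        using iff[OF mem(1)] iff[OF mem(2)] by (simp add: same_side_def)
    qed
    then show ?thesis by blast
  qed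
  have cells: "finite ((\<lambda>x. {B \<in> \<B>. x \<in> B}) ` X)" "card ((\<lambda>x. {B \<in> \<B>. x \<in> B}) ` X) \<le> card \<B> + 1"
    by (rule laminar_cells[OF fin], rule lam, assumption, assumption)+
  show "finite ((\<lambda>x. {i \<in> I. A i x}) ` X)"
    by (rule card_image_le_of_factor(1)[where f = "\<lambda>x. {i \<in> I. A i x}", OF cells(1)]) (rule factor)
  have "card ((\<lambda>x. {i \<in> I. A i x}) ` X) \<le> card ((\<lambda>x. {B \<in> \<B>. x \<in> B}) ` X)"
    by (rule card_image_le_of_factor(2)[where f = "\<lambda>x. {i \<in> I. A i x}", OF cells(1)]) (rule factor)
  then show "card ((\<lambda>x. {i \<in> I. A i x}) ` X) \<le> 2 * N * card I + 1"
    using cells(2) card by linarith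
qed

text \<open>Different classes mean that leading terms do not cancel: this is the equality case of
  the ultrametric inequality.\<close>

lemma v_diff_eq_min:
  assumes "x \<noteq> 0" "a \<noteq> 0" "rv v x \<noteq> rv v a"
  shows "x - a \<noteq> 0" and "v (x - a) = min (v x) (v a)"
proof -
  show nz: "x - a \<noteq> 0" using assms(3) by auto
  have "vle (x - a) x" "vle (a - x) a" using assms rv_eq_iff by metis+
  then have "v (x - a) \<le> v x" "v (x - a) \<le> v a"
    using nz assms by (auto simp: vle_def v_minus_commute[of x a])
  moreover have "min (v x) (v a) \<le> v (x - a)"
    using v_add[of x "- a"] assms nz by (simp add: v_uminus)
  ultimately show "v (x - a) = min (v x) (v a)" by (simp add: antisym)
qed

lemma same_side_of_v_eq:
  assumes "x \<noteq> 0" "x' \<noteq> 0" "v x = v x'" "rv v x \<noteq> rv v a" "rv v x' \<noteq> rv v a"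
  shows "same_side a d x x'"
proof (cases "a = 0")
  case True
  then show ?thesis using assms by (simp add: same_side_def vle_def)
next
  case False
  note v_diff_eq_min[OF assms(1) False assms(4)] v_diff_eq_min[OF assms(2) False assms(5)]
  then show ?thesis using assms(3) by (simp add: same_side_def vle_def)
qed

text \<open>The exceptional classes are those of the centers: for \<open>x\<close> outside the class
  of \<open>a\<close>, \<open>v (x - a)\<close> depends on \<open>v x\<close> alone, hence so does
  the position of \<open>x\<close> relative to any ball around \<open>a\<close>.\<close>

lemma ball_comb_exceptional:
  assumes "ball_comb N A"
  shows "\<exists>Q. finite Q \<and> card Q \<le> N \<and>
    (\<forall>x x'. x \<noteq> 0 \<longrightarrow> x' \<noteq> 0 \<longrightarrow> v x = v x' \<longrightarrow> rv v x \<notin> Q \<longrightarrow> rv v x' \<notin> Q \<longrightarrow> (A x \<longleftrightarrow> A x'))"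
proof -
  from assms obtain a d
    where "\<forall>x x'. (\<forall>k<N. same_side (a k) (d k) x x') \<longrightarrow> (A x \<longleftrightarrow> A x')"
    unfolding ball_comb_def by (elim exE)
  note ad = ball_combD[OF this]
  show ?thesis
  proof (rule exI[of _ "(\<lambda>k. rv v (a k)) ` {..<N}"], intro conjI allI impI)
    show "card ((\<lambda>k. rv v (a k)) ` {..<N}) \<le> N" using card_image_le[of "{..<N}"] by simp
    fix x x'
    assume *: "x \<noteq> 0" "x' \<noteq> 0" "v x = v x'"
      "rv v x \<notin> (\<lambda>k. rv v (a k)) ` {..<N}" "rv v x' \<notin> (\<lambda>k. rv v (a k)) ` {..<N}"
    show "A x \<longleftrightarrow> A x'"
    proof (rule ad)
      fix k assume "k < N"
      then show "same_side (a k) (d k) x x'" using * by (intro same_side_of_v_eq) auto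
    qed
  qed simp
qed

lemma rv_part_dichotomy:
  assumes "rv_inv A" "ball_comb N A"
  shows "finite (rv_part A \<gamma>) \<and> card (rv_part A \<gamma>) \<le> N \<or>
    finite (RV_fiber v \<gamma> - rv_part A \<gamma>) \<and> card (RV_fiber v \<gamma> - rv_part A \<gamma>) \<le> N"
proof -
  obtain Q where Q: "finite Q" "card Q \<le> N"
    "\<forall>x x'. x \<noteq> 0 \<longrightarrow> x' \<noteq> 0 \<longrightarrow> v x = v x' \<longrightarrow> rv v x \<notin> Q \<longrightarrow> rv v x' \<notin> Q \<longrightarrow> (A x \<longleftrightarrow> A x')"
    using ball_comb_exceptional[OF assms(2)] by (elim exE conjE)
  have "rv_part A \<gamma> \<subseteq> Q \<or> RV_fiber v \<gamma> - rv_part A \<gamma> \<subseteq> Q"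
  proof (cases "rv_part A \<gamma> \<subseteq> Q")
    case False
    then obtain x where x: "A x" "v x = \<gamma>" "rv v x \<notin> Q" by auto
    have "rv v y \<in> rv_part A \<gamma>" if "y \<noteq> 0" "v y = \<gamma>" "rv v y \<notin> Q" for y
    proof -
      have "A y" using Q(3)[rule_format, of x y] x that rv_invD(1)[OF assms(1) x(1)] by simp
      then show ?thesis using that by simp
    qed
    then show ?thesis by (auto simp: RV_fiber_def)
  qed simp
  then show ?thesis
  proof
    assume "rv_part A \<gamma> \<subseteq> Q"
    from finite_subset[OF this Q(1)] card_mono[OF Q(1) this] Q(2) show ?thesis by simp
  next
    assume "RV_fiber v \<gamma> - rv_part A \<gamma> \<subseteq> Q"
    from finite_subset[OF this Q(1)] card_mono[OF Q(1) this] Q(2) show ?thesis by simp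
  qed
qed

end

section \<open>Infinity of the residue field and its consequences for definable subsets of
  RV\<close>

lemma prod_root_exists:
  fixes R :: "'a::alg_closed_field set"
  assumes "finite R" "R \<noteq> {}"
  shows "\<exists>x. (\<Prod>a\<in>R. (x - a)) = -1"
proof -
  define p where "p = (\<Prod>a\<in>R. [:- a, 1:]) + 1"
  have "degree (\<Prod>a\<in>R. [:- a, 1:]) = card R"
    by (subst degree_prod_eq_sum_degree) auto
  moreover have "card R > 0" using assms by (simp add: card_gt_0_iff)
  ultimately have "degree p > 0" unfolding p_def by (subst degree_add_eq_left) auto
  then obtain x where "poly p x = 0" using alg_closed_imp_poly_has_root by blast
  then have "(\<Prod>a\<in>R. (x - a)) + 1 = 0" by (simp add: p_def poly_prod)
  then show ?thesis by (intro exI[of _ x]) (simp add: eq_neg_iff_add_eq_0)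
qed

locale alg_closed_valued_field = valued_field v
  for v :: "'a::alg_closed_field \<Rightarrow> 'g::linordered_ab_group_add"
begin

text \<open>
  If the residue field had finitely many elements, with representatives \<open>R\<close>, then an element \<open>x\<close>
  with \<open>(\<Prod>a\<in>R. (x - a)) = -1\<close> would be integral with a residue different from all of them.
\<close>

lemma infinite_RV_fiber_0: "infinite (RV_fiber v 0)"
proof
  assume fin: "finite (RV_fiber v 0)"
  have "\<forall>p \<in> RV_fiber v 0. \<exists>x. x \<noteq> 0 \<and> v x = 0 \<and> p = rv v x" unfolding RV_fiber_def by auto
  then obtain r where r: "\<And>p. p \<in> RV_fiber v 0 \<Longrightarrow> r p \<noteq> 0 \<and> v (r p) = 0 \<and> p = rv v (r p)" by metis
  define R where "R = insert 0 (r ` RV_fiber v 0)"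
  have R: "finite R" "R \<noteq> {}" using fin by (auto simp: R_def)
  have R_int: "a = 0 \<or> v a = 0" if "a \<in> R" for a using that r by (auto simp: R_def)
  obtain x where x: "(\<Prod>a\<in>R. (x - a)) = -1" using prod_root_exists[OF R] by blast
  then have nz: "x - a \<noteq> 0" if "a \<in> R" for a
    using that R(1) prod_zero_iff[of R "\<lambda>a. x - a"] by auto
  have v_prod: "v (\<Prod>a\<in>T. (x - a)) = (\<Sum>a\<in>T. v (x - a))" if "T \<subseteq> R" for T
    using finite_subset[OF that R(1)] that
  proof (induction T rule: finite_induct)
    case (insert a T)
    then have "x - a \<noteq> 0" "(\<Prod>a\<in>T. (x - a)) \<noteq> 0" using nz by (auto simp: prod_zero_iff)
    then show ?case using insert by (simp add: v_mult)
  qed (simp add: v_one)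
  \<comment> \<open>The values of the factors sum to the value of \<open>-1\<close>. A negative
    \<open>v x\<close> would make all of them negative; otherwise all are nonnegative, and the
    factor of the representative of the residue of \<open>x\<close> has positive value.\<close>
  have sum0: "(\<Sum>a\<in>R. v (x - a)) = 0" using v_prod[of R] x v_uminus[of 1] v_one by simp
  have "x \<noteq> 0" using nz[of 0] by (simp add: R_def)
  have "\<not> v x < 0"
  proof
    assume neg: "v x < 0"
    have "v (x - a) < 0" if "a \<in> R" for a
    proof (cases "a = 0")
      case False
      then have "v a = 0" using R_int that by blast
      then have "rv v x \<noteq> rv v a" using rv_eq_imp_v_eq[OF \<open>x \<noteq> 0\<close> False] neg by auto
      then show ?thesis using v_diff_eq_min(2)[OF \<open>x \<noteq> 0\<close> False] \<open>v a = 0\<close> neg by simp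
    qed (use neg in simp)
    then have "(\<Sum>a\<in>R. v (x - a)) < (\<Sum>a\<in>R. 0)" using R by (intro sum_strict_mono) auto
    then show False using sum0 by simp
  qed
  then have vx: "0 \<le> v x" by simp
  have int: "0 \<le> v (x - a)" if "a \<in> R" for a
  proof (cases "a = 0")
    case False
    then show ?thesis
      using v_add[of x "- a"] \<open>x \<noteq> 0\<close> nz[OF that] vx R_int[OF that] by (simp add: v_uminus)
  qed (use vx in simp)
  have "\<exists>a \<in> R. 0 < v (x - a)"
  proof (cases "v x = 0")
    case True
    then have mem: "rv v x \<in> RV_fiber v 0" using \<open>x \<noteq> 0\<close> by (auto simp: RV_fiber_def)
    then have eq: "rv v x = rv v (r (rv v x))" "r (rv v x) \<noteq> 0" using r by blast+
    have "r (rv v x) \<in> R" using mem by (simp add: R_def)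
    moreover from eq rv_eq_iff[OF \<open>x \<noteq> 0\<close> eq(2)] have "\<not> vle (x - r (rv v x)) x" by simp
    ultimately show ?thesis using True \<open>x \<noteq> 0\<close> nz by (intro bexI[of _ "r (rv v x)"]) (auto simp: vle_def)
  next
    case False
    then show ?thesis using vx by (intro bexI[of _ 0]) (auto simp: R_def)
  qed
  then have "0 < (\<Sum>a\<in>R. v (x - a))" using R(1) int by (metis sum_pos2)
  then show False using sum0 by simp
qed

lemma infinite_RV_fiber: "infinite (RV_fiber v \<gamma>)"
proof
  assume fin: "finite (RV_fiber v \<gamma>)"
  obtain c where c: "c \<noteq> 0" "v c = \<gamma>" using v_surj by blast
  have "RV_fiber v 0 \<subseteq> (\<lambda>p. (\<lambda>z. z / c) ` p) ` RV_fiber v \<gamma>"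
  proof
    fix p assume "p \<in> RV_fiber v 0"
    then obtain x where x: "x \<noteq> 0" "v x = 0" "p = rv v x" by (auto simp: RV_fiber_def)
    then have "p = (\<lambda>z. z / c) ` rv v (c * x)" using c by (simp add: rv_divide)
    moreover have "rv v (c * x) \<in> RV_fiber v \<gamma>" using c x v_mult[of c x] by (auto simp: RV_fiber_def)
    ultimately show "p \<in> (\<lambda>p. (\<lambda>z. z / c) ` p) ` RV_fiber v \<gamma>" by blast
  qed
  then show False using fin infinite_RV_fiber_0 finite_surj by blast
qed

text \<open>As the fibers of RV are infinite, the alternatives of the dichotomy exclude each other.
  More than \<open>N\<close> classes in one fiber thus already mean cofinitely many, which makes
  infinity a definable condition.\<close>

lemma infinite_rv_part_iff:
  assumes "rv_inv A" "ball_comb N A"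
  shows "infinite (rv_part A \<gamma>) \<longleftrightarrow> finite (RV_fiber v \<gamma> - rv_part A \<gamma>)"
    and "infinite (rv_part A \<gamma>) \<Longrightarrow> card (RV_fiber v \<gamma> - rv_part A \<gamma>) \<le> N"
    and "finite (rv_part A \<gamma>) \<Longrightarrow> card (rv_part A \<gamma>) \<le> N"
proof -
  have "rv_part A \<gamma> \<subseteq> RV_fiber v \<gamma>" using rv_invD(1)[OF assms(1)] by (auto simp: RV_fiber_def)
  then have "RV_fiber v \<gamma> = rv_part A \<gamma> \<union> (RV_fiber v \<gamma> - rv_part A \<gamma>)" by blast
  then have *: "infinite (rv_part A \<gamma>) \<or> infinite (RV_fiber v \<gamma> - rv_part A \<gamma>)"
    using infinite_RV_fiber by (metis finite_Un)
  then show "infinite (rv_part A \<gamma>) \<longleftrightarrow> finite (RV_fiber v \<gamma> - rv_part A \<gamma>)"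
    and "infinite (rv_part A \<gamma>) \<Longrightarrow> card (RV_fiber v \<gamma> - rv_part A \<gamma>) \<le> N"
    and "finite (rv_part A \<gamma>) \<Longrightarrow> card (rv_part A \<gamma>) \<le> N"
    using rv_part_dichotomy[OF assms, of \<gamma>] by blast+
qed

text \<open>A class of \<open>A\<close> outside the exceptional set would bring along almost all of
  its fiber. So every class of \<open>A\<close> is exceptional, and the bound \<open>N\<close> holds
  over all values together.\<close>

lemma finite_rv_set:
  assumes "rv_inv A" "ball_comb N A" and fin: "\<And>\<gamma>. finite (rv_part A \<gamma>)"
  shows "finite (rv_set A) \<and> card (rv_set A) \<le> N"
proof -
  obtain Q where Q: "finite Q" "card Q \<le> N"
    "\<forall>x x'. x \<noteq> 0 \<longrightarrow> x' \<noteq> 0 \<longrightarrow> v x = v x' \<longrightarrow> rv v x \<notin> Q \<longrightarrow> rv v x' \<notin> Q \<longrightarrow> (A x \<longleftrightarrow> A x')"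
    using ball_comb_exceptional[OF assms(2)] by (elim exE conjE)
  have "rv_set A \<subseteq> Q"
  proof (rule ccontr)
    assume "\<not> rv_set A \<subseteq> Q"
    then obtain x where x: "A x" "rv v x \<notin> Q" by auto
    have "RV_fiber v (v x) \<subseteq> Q \<union> rv_part A (v x)"
      unfolding RV_fiber_def using Q(3)[rule_format, of x] x rv_invD(1)[OF assms(1) x(1)] by auto
    then show False using infinite_RV_fiber[of "v x"] Q(1) fin[of "v x"] finite_subset by auto
  qed
  from finite_subset[OF this Q(1)] card_mono[OF Q(1) this] Q(2) show ?thesis by simp
qed

text \<open>For a representative outside the classes of the centers, \<open>v (x - a)\<close> is
  \<open>v x\<close> if \<open>a = 0\<close> and \<open>min (v x) (v a)\<close> otherwise; only
  comparisons of \<open>v x\<close> with the values of centers and radii matter. Infinite fibers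
  supply such a representative over every value. The unspecified \<open>v 0\<close> may occur as a
  harmless additional cut.\<close>

lemma v_invariant_cuts:
  assumes "ball_comb N A" and inv: "\<And>x y. x \<noteq> 0 \<Longrightarrow> y \<noteq> 0 \<Longrightarrow> v x = v y \<Longrightarrow> A x \<Longrightarrow> A y"
  obtains C where "finite C"
    "\<And>x y. x \<noteq> 0 \<Longrightarrow> y \<noteq> 0 \<Longrightarrow> (\<And>c. c \<in> C \<Longrightarrow> (c < v x \<longleftrightarrow> c < v y) \<and> (v x < c \<longleftrightarrow> v y < c)) \<Longrightarrow>
      A x \<Longrightarrow> A y"
proof -
  from assms(1) obtain a d
    where "\<forall>x x'. (\<forall>k<N. same_side (a k) (d k) x x') \<longrightarrow> (A x \<longleftrightarrow> A x')"
    unfolding ball_comb_def by (elim exE)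
  note ad = ball_combD[OF this]
  define Q where "Q = (\<lambda>k. rv v (a k)) ` {..<N}"
  have generic: "\<exists>x'. x' \<noteq> 0 \<and> v x' = v x \<and> rv v x' \<notin> Q" for x
  proof -
    have "\<not> RV_fiber v (v x) \<subseteq> Q" using infinite_RV_fiber finite_subset by (auto simp: Q_def)
    then show ?thesis by (auto simp: RV_fiber_def)
  qed
  show ?thesis
  proof (rule that[of "v ` a ` {..<N} \<union> v ` d ` {..<N}"])
    fix x y assume nz: "x \<noteq> 0" "y \<noteq> 0" and "A x" and
      cut: "\<And>c. c \<in> v ` a ` {..<N} \<union> v ` d ` {..<N} \<Longrightarrow> (c < v x \<longleftrightarrow> c < v y) \<and> (v x < c \<longleftrightarrow> v y < c)"
    obtain x' where x': "x' \<noteq> 0" "v x' = v x" "rv v x' \<notin> Q" using generic by blast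
    obtain y' where y': "y' \<noteq> 0" "v y' = v y" "rv v y' \<notin> Q" using generic by blast
    have "A x' \<longleftrightarrow> A y'"
    proof (rule ad)
      fix k assume k: "k < N"
      have cuts: "(v (d k) < v x \<longleftrightarrow> v (d k) < v y) \<and> (v x < v (d k) \<longleftrightarrow> v y < v (d k))"
        "(v (a k) < v x \<longleftrightarrow> v (a k) < v y) \<and> (v x < v (a k) \<longleftrightarrow> v y < v (a k))"
        using k by (auto intro!: cut[of "v (d k)"] cut[of "v (a k)"])
      show "same_side (a k) (d k) x' y'"
      proof (cases "a k = 0")
        case True
        then show ?thesis using cuts x' y' by (auto simp: same_side_def vle_def not_less[symmetric])
      next
        case False
        have "rv v x' \<noteq> rv v (a k)" "rv v y' \<noteq> rv v (a k)" using x' y' k by (auto simp: Q_def)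
        note v_diff_eq_min[OF x'(1) False this(1)] v_diff_eq_min[OF y'(1) False this(2)]
        then show ?thesis using cuts x'(2) y'(2)
          by (auto simp: same_side_def vle_def not_less[symmetric])
      qed
    qed
    then show "A y" using inv[of x x'] inv[of y' y] nz x' y' \<open>A x\<close> by simp
  qed simp
qed

end

section \<open>Grids over relations with finite fibers\<close>

text \<open>Packs two parameter sequences into one, in the even-odd coding of
  \<open>def_pred_ex_seq\<close>.\<close>

definition interleave :: "(nat \<Rightarrow> 'b) \<Rightarrow> (nat \<Rightarrow> 'b) \<Rightarrow> nat \<Rightarrow> 'b" where
  "interleave a b i = (if even i then a (i div 2) else b (i div 2))"

lemma interleave_simps [simp]:
  "(\<lambda>i. interleave a b (2 * i)) = a" "(\<lambda>i. interleave a b (2 * i + 1)) = b"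
  "(\<lambda>i. interleave a b (Suc (2 * i))) = b"
  by (auto simp: interleave_def)

text \<open>Rows are chosen greedily. The set of rows bad for the chosen \<open>i\<close> varies
  with the column, but by the pigeonhole principle it is constant on infinitely many columns. It has
  fewer than \<open>r\<close> elements, so with \<open>i\<close> itself at most \<open>r\<close>
  rows are spent per choice. Only earlier rows are controlled against later ones, which is enough to
  tell rows apart.\<close>

lemma select_rows:
  fixes Bad :: "nat \<Rightarrow> nat \<Rightarrow> nat \<Rightarrow> bool"
  assumes "finite R" "infinite C" "s * r \<le> card R"
    and "\<And>i R' C'. i \<in> R \<Longrightarrow> R' \<subseteq> R - {i} \<Longrightarrow> C' \<subseteq> C \<Longrightarrow> infinite C' \<Longrightarrow>
      (\<And>i' j. i' \<in> R' \<Longrightarrow> j \<in> C' \<Longrightarrow> Bad i i' j) \<Longrightarrow> card R' < r"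
    and "0 < r"
  shows "\<exists>f C'. f ` {..<s} \<subseteq> R \<and> C' \<subseteq> C \<and> infinite C' \<and>
    (\<forall>b<s. \<forall>a<b. f a \<noteq> f b \<and> (\<forall>j \<in> C'. \<not> Bad (f a) (f b) j))"
  using assms
proof (induction s arbitrary: R C)
  case 0
  then show ?case by auto
next
  case (Suc s)
  have "card R \<noteq> 0" using Suc.prems(3) \<open>0 < r\<close> by auto
  then obtain i where i: "i \<in> R" by fastforce
  define T where "T j = {i' \<in> R - {i}. Bad i i' j}" for j
  have "T ` C \<subseteq> Pow R" by (auto simp: T_def)
  then have "finite (T ` C)" using Suc.prems(1) finite_subset by blast
  then obtain j0 where j0: "j0 \<in> C" "infinite {j \<in> C. T j = T j0}"
    using pigeonhole_infinite[OF Suc.prems(2)] by blast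
  define C1 where "C1 = {j \<in> C. T j = T j0}"
  define R1 where "R1 = R - insert i (T j0)"
  have "card (T j0) < r"
  proof (rule Suc.prems(4)[OF i])
    show "infinite C1" using j0(2) by (simp add: C1_def)
    show "Bad i i' j" if "i' \<in> T j0" "j \<in> C1" for i' j using that by (auto simp: C1_def T_def)
  qed (auto simp: T_def C1_def)
  moreover have "finite (T j0)" using Suc.prems(1) by (simp add: T_def)
  ultimately have "card (insert i (T j0)) \<le> r" by (simp add: card_insert_if)
  then have "card R \<le> card R1 + r"
    using diff_card_le_card_Diff[of "insert i (T j0)" R] \<open>finite (T j0)\<close> by (simp add: R1_def)
  then have "s * r \<le> card R1" using Suc.prems(3) by simp
  moreover have "finite R1" "infinite C1" "R1 \<subseteq> R" "C1 \<subseteq> C"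
    using Suc.prems(1) j0(2) by (auto simp: R1_def C1_def)
  moreover have "card R' < r" if "i' \<in> R1" "R' \<subseteq> R1 - {i'}" "C' \<subseteq> C1" "infinite C'"
    "\<And>k j. k \<in> R' \<Longrightarrow> j \<in> C' \<Longrightarrow> Bad i' k j" for i' R' C'
    by (rule Suc.prems(4)[of i' R' C']) (use that \<open>R1 \<subseteq> R\<close> \<open>C1 \<subseteq> C\<close> in auto)
  ultimately obtain f C' where f: "f ` {..<s} \<subseteq> R1" "C' \<subseteq> C1" "infinite C'"
    "\<And>a b. b < s \<Longrightarrow> a < b \<Longrightarrow> f a \<noteq> f b \<and> (\<forall>j \<in> C'. \<not> Bad (f a) (f b) j)"
    using Suc.IH[of R1 C1] \<open>0 < r\<close> by auto
  have R1: "i' \<in> R \<and> i \<noteq> i' \<and> \<not> Bad i i' j" if "i' \<in> R1" "j \<in> C1" for i' j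
  proof -
    have "i' \<notin> T j" using that by (auto simp: R1_def C1_def)
    then show ?thesis using that by (auto simp: R1_def T_def)
  qed
  have "C' \<noteq> {}" using f(3) by auto
  then have C'_ne: "\<exists>j. j \<in> C'" by blast
  show ?case
  proof (intro exI[of _ "case_nat i f"] exI[of _ C'] conjI allI impI ballI)
    have "f k \<in> R" if "k < s" for k using f(1) \<open>R1 \<subseteq> R\<close> that by blast
    then show "case_nat i f ` {..<Suc s} \<subseteq> R" using i by (auto split: nat.split)
    show "C' \<subseteq> C" using f(2) \<open>C1 \<subseteq> C\<close> by blast
    show "infinite C'" by fact
    fix a b :: nat assume ab: "b < Suc s" "a < b"
    then obtain b' where b': "b = Suc b'" "b' < s" by (cases b) auto
    then have fb: "f b' \<in> R1" using f(1) by auto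
    show "case_nat i f a \<noteq> case_nat i f b"
      using ab b' f(4)[of b'] R1[OF fb] C'_ne f(2) by (cases a) auto
    show "\<not> Bad (case_nat i f a) (case_nat i f b) j" if "j \<in> C'" for j
      using ab b' f(4)[of b'] R1[OF fb, of j] that f(2) by (cases a) auto
  qed
qed

text \<open>After each choice the pigeonhole principle leaves infinitely many columns with the same
  bad rows for the chosen one. Here the cost is paid in the other direction: every column removes
  fewer than \<open>r\<close> of the finitely many rows.\<close>

lemma select_columns:
  fixes Bad :: "nat \<Rightarrow> nat \<Rightarrow> nat \<Rightarrow> bool"
  assumes "finite R" "infinite C"
    and "\<And>j R' C'. j \<in> C \<Longrightarrow> R' \<subseteq> R \<Longrightarrow> C' \<subseteq> C - {j} \<Longrightarrow> infinite C' \<Longrightarrow>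
      (\<And>i j'. i \<in> R' \<Longrightarrow> j' \<in> C' \<Longrightarrow> Bad j j' i) \<Longrightarrow> card R' < r"
  shows "\<exists>g R'. g ` {..<s} \<subseteq> C \<and> R' \<subseteq> R \<and> card R \<le> card R' + s * r \<and>
    (\<forall>b<s. \<forall>a<b. g a \<noteq> g b \<and> (\<forall>i \<in> R'. \<not> Bad (g a) (g b) i))"
  using assms
proof (induction s arbitrary: R C)
  case 0
  then show ?case by auto
next
  case (Suc s)
  obtain j where j: "j \<in> C" using Suc.prems(2) by fastforce
  define T where "T j' = {i \<in> R. Bad j j' i}" for j'
  have "T ` (C - {j}) \<subseteq> Pow R" by (auto simp: T_def)
  then have "finite (T ` (C - {j}))" using Suc.prems(1) finite_subset by blast
  moreover have "infinite (C - {j})" using Suc.prems(2) by simp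
  ultimately obtain j0 where j0: "j0 \<in> C - {j}" "infinite {j' \<in> C - {j}. T j' = T j0}"
    using pigeonhole_infinite by blast
  define C1 where "C1 = {j' \<in> C - {j}. T j' = T j0}"
  define R1 where "R1 = R - T j0"
  have "card (T j0) < r"
  proof (rule Suc.prems(3)[OF j])
    show "infinite C1" using j0(2) by (simp add: C1_def)
    show "Bad j j' i" if "i \<in> T j0" "j' \<in> C1" for i j' using that by (auto simp: C1_def T_def)
  qed (auto simp: T_def C1_def)
  moreover have "finite (T j0)" using Suc.prems(1) by (simp add: T_def)
  ultimately have cardR: "card R \<le> card R1 + r"
    using diff_card_le_card_Diff[of "T j0" R] by (simp add: R1_def)
  have sub: "finite R1" "infinite C1" "R1 \<subseteq> R" "C1 \<subseteq> C"
    using Suc.prems(1) j0(2) by (auto simp: R1_def C1_def)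
  moreover have "card R' < r" if "j' \<in> C1" "R' \<subseteq> R1" "C' \<subseteq> C1 - {j'}" "infinite C'"
    "\<And>i k. i \<in> R' \<Longrightarrow> k \<in> C' \<Longrightarrow> Bad j' k i" for j' R' C'
    by (rule Suc.prems(3)[of j' R' C']) (use that sub in auto)
  ultimately obtain g R' where g: "g ` {..<s} \<subseteq> C1" "R' \<subseteq> R1" "card R1 \<le> card R' + s * r"
    "\<And>a b. b < s \<Longrightarrow> a < b \<Longrightarrow> g a \<noteq> g b \<and> (\<forall>i \<in> R'. \<not> Bad (g a) (g b) i)"
    using Suc.IH[of R1 C1] by auto
  have C1: "j \<noteq> j' \<and> (i \<in> R1 \<longrightarrow> \<not> Bad j j' i)" if "j' \<in> C1" for i j'
    using that by (auto simp: R1_def C1_def T_def)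
  show ?case
  proof (intro exI[of _ "case_nat j g"] exI[of _ R'] conjI allI impI ballI)
    have "g k \<in> C" if "k < s" for k using g(1) sub(4) that by blast
    then show "case_nat j g ` {..<Suc s} \<subseteq> C" using j by (auto split: nat.split)
    show "R' \<subseteq> R" using g(2) sub by blast
    show "card R \<le> card R' + Suc s * r" using cardR g(3) by simp
    fix a b :: nat assume ab: "b < Suc s" "a < b"
    then obtain b' where b': "b = Suc b'" "b' < s" by (cases b) auto
    then have gb: "g b' \<in> C1" using g(1) by auto
    show "case_nat j g a \<noteq> case_nat j g b"
      using ab b' g(4)[of b'] C1[OF gb] by (cases a) auto
    show "\<not> Bad (case_nat j g a) (case_nat j g b) i" if "i \<in> R'" for i
      using ab b' g(4)[of b'] C1[OF gb, of i] that g(2) by (cases a) auto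
  qed
qed

text \<open>A pattern of depth two on representatives, where \<open>F0\<close> detects the row and
  \<open>F1\<close> the column. The index sets are explicit so that the grid can be thinned
  out.\<close>

definition ict_grid ::
    "('a \<Rightarrow> 'b \<Rightarrow> 'p \<Rightarrow> bool) \<Rightarrow> ('a \<Rightarrow> 'b \<Rightarrow> 'p \<Rightarrow> bool) \<Rightarrow> ('a \<Rightarrow> 'b \<Rightarrow> bool) \<Rightarrow> nat set \<Rightarrow> nat set \<Rightarrow>
      (nat \<Rightarrow> 'p) \<Rightarrow> (nat \<Rightarrow> 'p) \<Rightarrow> bool" where
  "ict_grid F0 F1 D R C b0 b1 \<longleftrightarrow> (\<forall>i \<in> R. \<forall>j \<in> C. \<exists>x y. D x y \<and>
    (\<forall>i' \<in> R. F0 x y (b0 i') \<longleftrightarrow> i' = i) \<and> (\<forall>j' \<in> C. F1 x y (b1 j') \<longleftrightarrow> j' = j))"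

section \<open>Definable families in a C-minimal monster model\<close>

locale c_minimal_monster = alg_closed_valued_field v
  for v :: "'a::alg_closed_field \<Rightarrow> 'g::linordered_ab_group_add" +
  fixes L :: "('f vf_fun, 'r vf_rel) language"
    and M :: "('f vf_fun, 'r vf_rel, 'a) struct"
  assumes expansion: "vf_expansion L M v"
    and C_min: "C_minimal L M v"
    and monster: "monster_model L M"
begin

abbreviation "Dtm \<equiv> def_term L M"
abbreviation "Dfn \<equiv> def_pred L M"

lemma def_term_zero: "Dtm (\<lambda>e. 0)"
  unfolding def_term_def
  by (rule exI[of _ "Fn VZero []"]) (use expansion in \<open>simp add: vf_expansion_def\<close>)

lemma def_term_minus:
  assumes "Dtm \<sigma>" "Dtm \<tau>" shows "Dtm (\<lambda>e. \<sigma> e - \<tau> e)"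
proof -
  obtain s t where "wf_trm L s" "\<forall>e. trm_val M e s = \<sigma> e" "wf_trm L t" "\<forall>e. trm_val M e t = \<tau> e"
    using assms unfolding def_term_def by blast
  then show ?thesis
    unfolding def_term_def
    by (intro exI[of _ "Fn VAdd [s, Fn VMinus [t]]"]) (use expansion in \<open>simp add: vf_expansion_def\<close>)
qed

lemma def_term_mult:
  assumes "Dtm \<sigma>" "Dtm \<tau>" shows "Dtm (\<lambda>e. \<sigma> e * \<tau> e)"
proof -
  obtain s t where "wf_trm L s" "\<forall>e. trm_val M e s = \<sigma> e" "wf_trm L t" "\<forall>e. trm_val M e t = \<tau> e"
    using assms unfolding def_term_def by blast
  then show ?thesis
    unfolding def_term_def
    by (intro exI[of _ "Fn VMult [s, t]"]) (use expansion in \<open>simp add: vf_expansion_def\<close>)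
qed

lemma def_pred_vle:
  assumes "Dtm \<sigma>" "Dtm \<tau>" shows "Dfn (\<lambda>e. vle (\<sigma> e) (\<tau> e))"
proof -
  obtain s t where "wf_trm L s" "\<forall>e. trm_val M e s = \<sigma> e" "wf_trm L t" "\<forall>e. trm_val M e t = \<tau> e"
    using assms unfolding def_term_def by blast
  then show ?thesis
    by (intro def_predI[of "Rel VDiv [s, t]"])
      (use expansion in \<open>simp_all add: vf_expansion_def formulas_def vle_def\<close>)
qed

lemma def_pred_zero: "Dtm \<tau> \<Longrightarrow> Dfn (\<lambda>e. \<tau> e = 0)"
  by (intro def_pred_eq def_term_zero)

definition veq :: "'a \<Rightarrow> 'a \<Rightarrow> bool" where
  "veq x y \<longleftrightarrow> x \<noteq> 0 \<and> y \<noteq> 0 \<and> v x = v y"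

definition rveq :: "'a \<Rightarrow> 'a \<Rightarrow> bool" where
  "rveq x y \<longleftrightarrow> x \<noteq> 0 \<and> y \<noteq> 0 \<and> rv v x = rv v y"

lemma def_pred_veq: "Dtm \<sigma> \<Longrightarrow> Dtm \<tau> \<Longrightarrow> Dfn (\<lambda>e. veq (\<sigma> e) (\<tau> e))"
proof -
  assume "Dtm \<sigma>" "Dtm \<tau>"
  moreover have "veq x y \<longleftrightarrow> \<not> x = 0 \<and> \<not> y = 0 \<and> vle x y \<and> vle y x" for x y
    by (auto simp: veq_def vle_def)
  ultimately show ?thesis by (simp only:) (intro def_intros def_pred_zero def_pred_vle)
qed

lemma def_pred_rveq: "Dtm \<sigma> \<Longrightarrow> Dtm \<tau> \<Longrightarrow> Dfn (\<lambda>e. rveq (\<sigma> e) (\<tau> e))"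
proof -
  assume "Dtm \<sigma>" "Dtm \<tau>"
  moreover have "rveq x y \<longleftrightarrow> \<not> x = 0 \<and> \<not> y = 0 \<and> \<not> vle (x - y) x" for x y
    using rv_eq_iff[of x y] by (auto simp: rveq_def)
  ultimately show ?thesis
    by (simp only:) (intro def_intros def_pred_zero def_pred_vle def_term_minus)
qed

lemma def_pred_same_side:
  "Dtm \<alpha> \<Longrightarrow> Dtm \<delta> \<Longrightarrow> Dtm \<sigma> \<Longrightarrow> Dtm \<tau> \<Longrightarrow> Dfn (\<lambda>e. same_side (\<alpha> e) (\<delta> e) (\<sigma> e) (\<tau> e))"
  unfolding same_side_def by (intro def_intros def_pred_vle def_term_minus)

lemmas vf_intros = def_intros def_term_zero def_term_minus def_term_mult
  def_pred_vle def_pred_zero def_pred_veq def_pred_rveq def_pred_same_side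

text \<open>The object variable is entry \<open>0\<close> and the parameters are shifted behind it.
  Uniform bounds are bounds over all parameters of such a family.\<close>

definition def1 :: "('a \<Rightarrow> (nat \<Rightarrow> 'a) \<Rightarrow> bool) \<Rightarrow> bool" where
  "def1 F \<longleftrightarrow> Dfn (\<lambda>e. F (e 0) (\<lambda>i. e (Suc i)))"

definition def2 :: "('a \<Rightarrow> 'a \<Rightarrow> (nat \<Rightarrow> 'a) \<Rightarrow> bool) \<Rightarrow> bool" where
  "def2 F \<longleftrightarrow> Dfn (\<lambda>e. F (e 0) (e 1) (\<lambda>i. e (Suc (Suc i))))"

lemma def1_subst:
  assumes "def1 F" "Dtm \<tau>" "\<And>i. Dtm (\<lambda>e. g e i)"
  shows "Dfn (\<lambda>e. F (\<tau> e) (g e))"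
proof -
  have "Dtm (\<lambda>e. case_nat (\<tau> e) (g e) i)" for i using assms by (cases i) simp_all
  from def_pred_subst[OF assms(1)[unfolded def1_def], of "\<lambda>e. case_nat (\<tau> e) (g e)", OF this]
  show ?thesis by simp
qed

lemma def2_subst:
  assumes "def2 F" "Dtm \<sigma>" "Dtm \<tau>" "\<And>i. Dtm (\<lambda>e. g e i)"
  shows "Dfn (\<lambda>e. F (\<sigma> e) (\<tau> e) (g e))"
proof -
  have "Dtm (\<lambda>e. case_nat (\<sigma> e) (case_nat (\<tau> e) (g e)) i)" for i
    using assms by (cases i; cases "i - 1") simp_all
  from def_pred_subst[OF assms(1)[unfolded def2_def], of "\<lambda>e. case_nat (\<sigma> e) (case_nat (\<tau> e) (g e))", OF this]
  show ?thesis by simp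
qed

lemma definable_ball_comb:
  assumes "def1 F"
  shows "\<exists>n. ball_comb n (\<lambda>x. F x e)"
proof -
  obtain \<phi> where \<phi>: "\<phi> \<in> formulas L" "\<And>e. sat M e \<phi> \<longleftrightarrow> F (e 0) (\<lambda>i. e (Suc i))"
    using assms unfolding def1_def def_pred_def by blast
  have "{x. F x e} = {x. sat M ((case_nat 0 e)(0 := x)) \<phi>}" unfolding \<phi>(2) by simp
  then have "{x. F x e} \<in> definable_sets L M" unfolding definable_sets_def using \<phi>(1) by blast
  then have "\<exists>n. ball_comb n (\<lambda>x. x \<in> {x. F x e})"
    using C_min boolean_combination_imp_ball_comb unfolding C_minimal_def by blast
  then show ?thesis by simp
qed

text \<open>If no bound worked, the definable conditions of not being a combination of
  \<open>n\<close> pairs of balls would be decreasing in \<open>n\<close> and each satisfiable. A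
  common realization would give a definable set contradicting C-minimality.\<close>

lemma uniform_ball_comb:
  assumes F: "def1 F"
  shows "\<exists>N. \<forall>e. ball_comb N (\<lambda>x. F x e)"
proof (rule ccontr)
  assume "\<not> ?thesis"
  then have ex: "\<exists>e. \<not> ball_comb n (\<lambda>x. F x e)" for n by blast
  have "\<exists>e. \<forall>n. \<not> ball_comb n (\<lambda>x. F x e)"
  proof (rule countable_saturation_seq[OF monster])
    show "Dfn (\<lambda>e. \<not> ball_comb n (\<lambda>x. F x e))" for n
      unfolding ball_comb_def
      by (rule def_pred_not, rule def_pred_ex_seq, rule def_pred_ex_seq, rule def_pred_all,
          rule def_pred_all, rule def_pred_imp, rule def_pred_all_less)
        (intro vf_intros def1_subst[OF F])+
  qed (use ex ball_comb_mono in blast)+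
  then show False using definable_ball_comb[OF F] by blast
qed

text \<open>A finite part has at most \<open>N\<close> classes, so \<open>Suc N\<close> different
  ones witness infinity, and their existence is first order.\<close>

lemma infinite_rv_part_ex:
  assumes "rv_inv A" "ball_comb N A" "w \<noteq> 0"
  shows "infinite (rv_part A (v w)) \<longleftrightarrow> (\<exists>a. (\<forall>k<Suc N. A (a k) \<and> veq (a k) w) \<and>
    (\<forall>k<Suc N. \<forall>l<k. \<not> rveq (a k) (a l)))"
proof
  assume "infinite (rv_part A (v w))"
  then obtain T where T: "T \<subseteq> rv_part A (v w)" "finite T" "card T = Suc N"
    using infinite_arbitrarily_large[of "rv_part A (v w)" "Suc N"] by blast
  then obtain h where h: "bij_betw h {..<Suc N} T"
    using ex_bij_betw_nat_finite[OF T(2)] T(3) by (auto simp: atLeast0LessThan)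
  have "\<exists>x. A x \<and> v x = v w \<and> h k = rv v x" if "k < Suc N" for k
    using h T(1) that by (force simp: bij_betw_def)
  then obtain a where a: "\<And>k. k < Suc N \<Longrightarrow> A (a k) \<and> v (a k) = v w \<and> h k = rv v (a k)" by metis
  have "\<not> rveq (a k) (a l)" if "k < Suc N" "l < k" for k l
  proof -
    have "h k \<noteq> h l" using inj_on_eq_iff[OF bij_betw_imp_inj_on[OF h], of k l] that by simp
    then show ?thesis using a[of k] a[of l] that by (auto simp: rveq_def)
  qed
  then show "\<exists>a. (\<forall>k<Suc N. A (a k) \<and> veq (a k) w) \<and> (\<forall>k<Suc N. \<forall>l<k. \<not> rveq (a k) (a l))"
    using a rv_invD(1)[OF assms(1)] assms(3) by (intro exI[of _ a]) (auto simp: veq_def)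
next
  assume "\<exists>a. (\<forall>k<Suc N. A (a k) \<and> veq (a k) w) \<and> (\<forall>k<Suc N. \<forall>l<k. \<not> rveq (a k) (a l))"
  then obtain a where a: "\<And>k. k < Suc N \<Longrightarrow> A (a k) \<and> veq (a k) w"
    "\<And>k l. k < Suc N \<Longrightarrow> l < k \<Longrightarrow> \<not> rveq (a k) (a l)" by blast
  have "inj_on (\<lambda>k. rv v (a k)) {..<Suc N}"
  proof (rule linorder_inj_onI')
    fix l k assume "l \<in> {..<Suc N}" "k \<in> {..<Suc N}" "l < k"
    then show "rv v (a l) \<noteq> rv v (a k)"
      using a(1)[of k] a(1)[of l] a(2)[of k l] by (auto simp: rveq_def veq_def)
  qed
  then have "card ((\<lambda>k. rv v (a k)) ` {..<Suc N}) = Suc N" by (simp add: card_image)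
  moreover have sub: "(\<lambda>k. rv v (a k)) ` {..<Suc N} \<subseteq> rv_part A (v w)"
    using a(1) by (auto simp: veq_def)
  ultimately show "infinite (rv_part A (v w))"
    using infinite_rv_part_iff(3)[OF assms(1,2), of "v w"] card_mono[OF _ sub] by auto
qed

lemma def1_infinite_rv_part:
  assumes F: "def1 F" and inv: "\<And>e. rv_inv (\<lambda>x. F x e)"
  shows "def1 (\<lambda>w e. w \<noteq> 0 \<and> infinite (rv_part (\<lambda>x. F x e) (v w)))"
proof -
  obtain N where N: "\<And>e. ball_comb N (\<lambda>x. F x e)" using uniform_ball_comb[OF F] by blast
  have "(w \<noteq> 0 \<and> infinite (rv_part (\<lambda>x. F x e) (v w))) \<longleftrightarrow> \<not> w = 0 \<and>
      (\<exists>a. (\<forall>k<Suc N. F (a k) e \<and> veq (a k) w) \<and> (\<forall>k<Suc N. \<forall>l<k. \<not> rveq (a k) (a l)))" for w e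
    using infinite_rv_part_ex[OF inv N] by blast
  then show ?thesis
    unfolding def1_def
    by (simp only:) (intro def_pred_ex_seq def_pred_all_less vf_intros def1_subst[OF F])
qed

definition snd_inv :: "('a \<Rightarrow> 'a \<Rightarrow> (nat \<Rightarrow> 'a) \<Rightarrow> bool) \<Rightarrow> bool" where
  "snd_inv F \<longleftrightarrow> (\<forall>x y y' b. F x y' b \<longrightarrow> rv v y = rv v y' \<longrightarrow> F x y b)"

text \<open>The fiber loses the class of \<open>y'\<close>: it satisfies \<open>F\<close>, so by
  invariance it contains no remaining \<open>y\<close>.\<close>

lemma fiber_drop:
  assumes "snd_inv F" "finite (rv_set (G x)) \<and> card (rv_set (G x)) \<le> Suc m"
  shows "finite (rv_set (\<lambda>y. G x y \<and> \<not> F x y b \<and> (\<exists>y'. G x y' \<and> F x y' b))) \<and>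
    card (rv_set (\<lambda>y. G x y \<and> \<not> F x y b \<and> (\<exists>y'. G x y' \<and> F x y' b))) \<le> m"
proof (cases "\<exists>y'. G x y' \<and> F x y' b")
  case True
  then obtain y' where y': "G x y'" "F x y' b" by blast
  have sub: "rv_set (\<lambda>y. G x y \<and> \<not> F x y b \<and> (\<exists>y'. G x y' \<and> F x y' b)) \<subseteq> rv_set (G x) - {rv v y'}"
    using assms(1) y' unfolding snd_inv_def by auto
  have "finite (rv_set (G x) - {rv v y'})" using assms(2) by simp
  moreover have "card (rv_set (G x) - {rv v y'}) \<le> m"
    using conjunct2[OF assms(2)] y'(1) by (simp add: card_Diff_singleton)
  ultimately show ?thesis using finite_subset[OF sub] card_mono[OF _ sub] by linarith
next
  case False
  then have "Collect (\<lambda>y. G x y \<and> \<not> F x y b \<and> (\<exists>y'. G x y' \<and> F x y' b)) = {}" by blast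
  then show ?thesis by (simp only: image_empty finite.emptyI card.empty simp_thms le0)
qed

text \<open>
  For a grid in \<open>G\<close>, let \<open>A\<^sub>i = {x. \<exists>y. G x y \<and> F0 x y (b0 i)}\<close>. If \<open>A\<^sub>i\<close> contains the first coordinates
  of a large part of the grid outside row \<open>i\<close>, that part lies in a definable relation with smaller
  fibers. Otherwise, after thinning out the rows, the row of a point is the first \<open>i\<close> for which \<open>A\<^sub>i\<close>
  contains its first coordinate. The same applies to columns, so the grid has quadratically many
  cells, exceeding the linear bound.
\<close>

lemma no_grid_finite_fibers:
  assumes F: "def2 F0" "def2 F1" "snd_inv F0" "snd_inv F1"
    and G: "def2 G"
  shows "\<exists>r. \<forall>c R C b0 b1. (\<forall>x. finite (rv_set (\<lambda>y. G x y c)) \<and> card (rv_set (\<lambda>y. G x y c)) \<le> m) \<longrightarrow>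
    finite R \<longrightarrow> r \<le> card R \<longrightarrow> infinite C \<longrightarrow> \<not> ict_grid F0 F1 (\<lambda>x y. G x y c) R C b0 b1"
  using G
proof (induction m arbitrary: G)
  case 0
  show ?case
  proof (intro exI[of _ 1] allI impI notI)
    fix c R C b0 b1
    assume *: "\<forall>x. finite (rv_set (\<lambda>y. G x y c)) \<and> card (rv_set (\<lambda>y. G x y c)) \<le> 0"
      and R: "finite R" "1 \<le> card R" and C: "infinite C"
      and grid: "ict_grid F0 F1 (\<lambda>x y. G x y c) R C b0 b1"
    obtain i j where "i \<in> R" "j \<in> C" using R C by fastforce
    then obtain x y where "G x y c" using grid unfolding ict_grid_def by blast
    moreover have "Collect (\<lambda>y. G x y c) = {}" using *[rule_format, of x] by (auto simp: card_eq_0_iff)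
    ultimately show False by blast
  qed
next
  case (Suc m)
  \<comment> \<open>The parameters of \<open>G\<close> are the even entries, a parameter of the
    pattern the odd ones. The induction hypothesis is applied with entries of an unknown grid as
    parameters, so its bound must be uniform in them.\<close>
  define shrink where "shrink F x y e \<longleftrightarrow> G x y (\<lambda>i. e (2 * i)) \<and> \<not> F x y (\<lambda>i. e (2 * i + 1)) \<and>
    (\<exists>y'. G x y' (\<lambda>i. e (2 * i)) \<and> F x y' (\<lambda>i. e (2 * i + 1)))" for F x y e
  define proj where "proj F x e \<longleftrightarrow> (\<exists>y'. G x y' (\<lambda>i. e (2 * i)) \<and> F x y' (\<lambda>i. e (2 * i + 1)))" for F x e
  have def_shrink: "def2 (shrink F)" if "def2 F" for F
    unfolding def2_def shrink_def by (intro vf_intros def2_subst[OF Suc.prems] def2_subst[OF that])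
  have def_proj: "def1 (proj F)" if "def2 F" for F
    unfolding def1_def proj_def by (intro vf_intros def2_subst[OF Suc.prems] def2_subst[OF that])
  obtain r0 where r0: "\<And>c R C b0 b1.
      \<lbrakk>\<forall>x. finite (rv_set (\<lambda>y. shrink F0 x y c)) \<and> card (rv_set (\<lambda>y. shrink F0 x y c)) \<le> m;
       finite R; r0 \<le> card R; infinite C; ict_grid F0 F1 (\<lambda>x y. shrink F0 x y c) R C b0 b1\<rbrakk> \<Longrightarrow> False"
    using Suc.IH[OF def_shrink[OF F(1)]] by (elim exE) (rule that, blast)
  obtain r1 where r1: "\<And>c R C b0 b1.
      \<lbrakk>\<forall>x. finite (rv_set (\<lambda>y. shrink F1 x y c)) \<and> card (rv_set (\<lambda>y. shrink F1 x y c)) \<le> m;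
       finite R; r1 \<le> card R; infinite C; ict_grid F0 F1 (\<lambda>x y. shrink F1 x y c) R C b0 b1\<rbrakk> \<Longrightarrow> False"
    using Suc.IH[OF def_shrink[OF F(2)]] by (elim exE) (rule that, blast)
  obtain N0 where N0: "\<And>e. ball_comb N0 (\<lambda>x. proj F0 x e)"
    using uniform_ball_comb[OF def_proj[OF F(1)]] by blast
  obtain N1 where N1: "\<And>e. ball_comb N1 (\<lambda>x. proj F1 x e)"
    using uniform_ball_comb[OF def_proj[OF F(2)]] by blast
  define N where "N = max N0 N1"
  \<comment> \<open>Chosen so that \<open>s * s > 4 * N * s + 1\<close>: an \<open>s\<close> by
    \<open>s\<close> grid has more cells than \<open>2 * s\<close> combinations of \<open>N\<close>
    pairs of balls allow.\<close>
  define s where "s = 4 * N + 2"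
  \<comment> \<open>Enough rows for either induction hypothesis; \<open>Suc\<close> makes
    \<open>r\<close> positive, as \<open>select_rows\<close> demands.\<close>
  define r where "r = Suc (max r0 r1)"
  show ?case
  \<comment> \<open>Selecting rows divides their number by \<open>r\<close>; selecting
    \<open>s\<close> columns then costs up to \<open>s * r\<close> rows and must leave
    \<open>s\<close>.\<close>
  proof (intro exI[of _ "(s + s * r) * r"] allI impI notI)
    fix c R C b0 b1
    assume fib: "\<forall>x. finite (rv_set (\<lambda>y. G x y c)) \<and> card (rv_set (\<lambda>y. G x y c)) \<le> Suc m"
      and R: "finite R" "(s + s * r) * r \<le> card R" and C: "infinite C"
      and grid: "ict_grid F0 F1 (\<lambda>x y. G x y c) R C b0 b1"
    have fib_shrink: "\<forall>x. finite (rv_set (\<lambda>y. shrink F x y (interleave c b))) \<and>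
        card (rv_set (\<lambda>y. shrink F x y (interleave c b))) \<le> m" if "snd_inv F" for F b
      using fiber_drop[OF that, of "\<lambda>x y. G x y c" _ m b] fib by (simp add: shrink_def)
    have "\<forall>i \<in> R. \<forall>j \<in> C. \<exists>p. G (fst p) (snd p) c \<and>
        (\<forall>i' \<in> R. F0 (fst p) (snd p) (b0 i') \<longleftrightarrow> i' = i) \<and> (\<forall>j' \<in> C. F1 (fst p) (snd p) (b1 j') \<longleftrightarrow> j' = j)"
      using grid unfolding ict_grid_def by auto
    then obtain p where p: "\<forall>i \<in> R. \<forall>j \<in> C. G (fst (p i j)) (snd (p i j)) c \<and>
        (\<forall>i' \<in> R. F0 (fst (p i j)) (snd (p i j)) (b0 i') \<longleftrightarrow> i' = i) \<and>
        (\<forall>j' \<in> C. F1 (fst (p i j)) (snd (p i j)) (b1 j') \<longleftrightarrow> j' = j)"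
      by metis
    define X where "X i j = fst (p i j)" for i j
    define Y where "Y i j = snd (p i j)" for i j
    have pG: "G (X i j) (Y i j) c" if "i \<in> R" "j \<in> C" for i j
      using p that by (simp add: X_def Y_def)
    have p0: "F0 (X i j) (Y i j) (b0 i') \<longleftrightarrow> i' = i" if "i \<in> R" "j \<in> C" "i' \<in> R" for i j i'
      using p that by (simp add: X_def Y_def)
    have p1: "F1 (X i j) (Y i j) (b1 j') \<longleftrightarrow> j' = j" if "i \<in> R" "j \<in> C" "j' \<in> C" for i j j'
      using p that by (simp add: X_def Y_def)
    define A0 where "A0 i x \<longleftrightarrow> proj F0 x (interleave c (b0 i))" for i x
    define A1 where "A1 j x \<longleftrightarrow> proj F1 x (interleave c (b1 j))" for j x
    have A0_diag: "A0 i (X i j)" if "i \<in> R" "j \<in> C" for i j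
      unfolding A0_def proj_def using pG[OF that] p0[OF that that(1)] by auto
    have A1_diag: "A1 j (X i j)" if "i \<in> R" "j \<in> C" for i j
      unfolding A1_def proj_def using pG[OF that] p1[OF that that(2)] by auto
    \<comment> \<open>A grid point of a row other than \<open>i\<close> lies outside
      \<open>F0\<close> at \<open>b0 i\<close>. If its first coordinate satisfies
      \<open>A0 i\<close> all the same, the point belongs to \<open>shrink F0\<close>, to which the
      induction hypothesis applies.\<close>
    have rows: "card R' < r" if i: "i \<in> R" "R' \<subseteq> R - {i}" "C' \<subseteq> C" "infinite C'"
      and bad: "\<And>i' j. i' \<in> R' \<Longrightarrow> j \<in> C' \<Longrightarrow> A0 i (X i' j)" for i R' C'
    proof (rule ccontr)
      assume "\<not> card R' < r"
      then have "r0 \<le> card R'" by (simp add: r_def)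
      moreover have "ict_grid F0 F1 (\<lambda>x y. shrink F0 x y (interleave c (b0 i))) R' C' b0 b1"
        unfolding ict_grid_def
      proof (intro ballI)
        fix k j assume kj: "k \<in> R'" "j \<in> C'"
        then have kj': "k \<in> R" "j \<in> C" "i \<noteq> k" using i by auto
        have "shrink F0 (X k j) (Y k j) (interleave c (b0 i))"
          using bad[OF kj] pG[OF kj'(1,2)] p0[OF kj'(1,2) i(1)] kj'(3)
          by (simp add: shrink_def A0_def proj_def)
        then show "\<exists>x y. shrink F0 x y (interleave c (b0 i)) \<and>
            (\<forall>i' \<in> R'. F0 x y (b0 i') = (i' = k)) \<and> (\<forall>j' \<in> C'. F1 x y (b1 j') = (j' = j))"
          using p0[OF kj'(1,2)] p1[OF kj'(1,2)] i
          by (intro exI[of _ "X k j"] exI[of _ "Y k j"]) auto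
      qed
      moreover have "finite R'" using i(2) R(1) finite_subset by blast
      ultimately show False using r0[OF fib_shrink[OF F(3)]] i(4) by blast
    qed
    have cols: "card R' < r" if j: "j \<in> C" "R' \<subseteq> R" "C' \<subseteq> C - {j}" "infinite C'"
      and bad: "\<And>i j'. i \<in> R' \<Longrightarrow> j' \<in> C' \<Longrightarrow> A1 j (X i j')" for j R' C'
    proof (rule ccontr)
      assume "\<not> card R' < r"
      then have "r1 \<le> card R'" by (simp add: r_def)
      moreover have "ict_grid F0 F1 (\<lambda>x y. shrink F1 x y (interleave c (b1 j))) R' C' b0 b1"
        unfolding ict_grid_def
      proof (intro ballI)
        fix i k assume ik: "i \<in> R'" "k \<in> C'"
        then have ik': "i \<in> R" "k \<in> C" "j \<noteq> k" using j by auto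
        have "shrink F1 (X i k) (Y i k) (interleave c (b1 j))"
          using bad[OF ik] pG[OF ik'(1,2)] p1[OF ik'(1,2) j(1)] ik'(3)
          by (simp add: shrink_def A1_def proj_def)
        then show "\<exists>x y. shrink F1 x y (interleave c (b1 j)) \<and>
            (\<forall>i' \<in> R'. F0 x y (b0 i') = (i' = i)) \<and> (\<forall>j' \<in> C'. F1 x y (b1 j') = (j' = k))"
          using p0[OF ik'(1,2)] p1[OF ik'(1,2)] j
          by (intro exI[of _ "X i k"] exI[of _ "Y i k"]) auto
      qed
      moreover have "finite R'" using j(2) R(1) finite_subset by blast
      ultimately show False using r1[OF fib_shrink[OF F(4)]] j(4) by blast
    qed
    have "\<exists>f C'. f ` {..<s + s * r} \<subseteq> R \<and> C' \<subseteq> C \<and> infinite C' \<and>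
        (\<forall>b<s + s * r. \<forall>a<b. f a \<noteq> f b \<and> (\<forall>j \<in> C'. \<not> A0 (f a) (X (f b) j)))"
      by (rule select_rows[OF R(1) C R(2)], rule rows) (auto simp: r_def)
    then obtain f C' where f: "f ` {..<s + s * r} \<subseteq> R" "C' \<subseteq> C" "infinite C'"
      and f_all: "\<forall>b<s + s * r. \<forall>a<b. f a \<noteq> f b \<and> (\<forall>j \<in> C'. \<not> A0 (f a) (X (f b) j))"
      by (elim exE conjE)
    have f_ne: "f a \<noteq> f b" if "b < s + s * r" "a < b" for a b
      using f_all that by simp
    have f_A0: "\<not> A0 (f a) (X (f b) j)" if "b < s + s * r" "a < b" "j \<in> C'" for a b j
      using f_all that by simp
    have "\<exists>g R'. g ` {..<s} \<subseteq> C' \<and> R' \<subseteq> f ` {..<s + s * r} \<and>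
        card (f ` {..<s + s * r}) \<le> card R' + s * r \<and>
        (\<forall>b<s. \<forall>a<b. g a \<noteq> g b \<and> (\<forall>i \<in> R'. \<not> A1 (g a) (X i (g b))))"
      by (rule select_columns[OF _ f(3)], simp, rule cols) (use f(1,2) in auto)
    then obtain g R' where g: "g ` {..<s} \<subseteq> C'" "R' \<subseteq> f ` {..<s + s * r}"
      "card (f ` {..<s + s * r}) \<le> card R' + s * r"
      and g_all: "\<forall>b<s. \<forall>a<b. g a \<noteq> g b \<and> (\<forall>i \<in> R'. \<not> A1 (g a) (X i (g b)))"
      by (elim exE conjE)
    have g_ne: "g a \<noteq> g b" if "b < s" "a < b" for a b
      using g_all that by simp
    have g_A1: "\<not> A1 (g a) (X i (g b))" if "b < s" "a < b" "i \<in> R'" for a b i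
      using g_all that by simp
    have "inj_on f {..<s + s * r}" using f_ne by (intro linorder_inj_onI') auto
    then have "s \<le> card R'" using g(3) by (simp add: card_image)
    then obtain R'' where R'': "R'' \<subseteq> R'" "card R'' = s" "finite R''"
      using obtain_subset_with_card_n by metis
    have g_inj: "inj_on g {..<s}" using g_ne by (intro linorder_inj_onI') auto
    define C'' where "C'' = g ` {..<s}"
    have C'': "card C'' = s" "finite C''" "C'' \<subseteq> C"
      using g_inj g(1) f(2) by (auto simp: C''_def card_image)
    have R''R: "R'' \<subseteq> R" using R'' g(2) f(1) by blast
    define A where "A = case_sum A0 A1"
    define I where "I = Inl ` R'' \<union> Inr ` C''"
    have "ball_comb N (A0 i)" "ball_comb N (A1 i)" for i
      unfolding A0_def[abs_def] A1_def[abs_def]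
      by (rule ball_comb_mono[OF N0], simp add: N_def, rule ball_comb_mono[OF N1], simp add: N_def)
    then have bcA: "ball_comb N (A i)" for i by (cases i) (simp_all add: A_def)
    have cardI: "card I = 2 * s" "finite I"
      using R'' C'' card_Plus[of R'' C''] by (auto simp: I_def Plus_def)
    define tr where "tr x = {i \<in> I. A i x}" for x
    \<comment> \<open>Of two different selected rows, the set \<open>A0\<close> of the earlier one
      contains the first coordinates of its own points and misses those of the later row. The same
      holds for columns and \<open>A1\<close>, so a trace determines both indices.\<close>
    have "inj_on (\<lambda>(i, j). tr (X i j)) (R'' \<times> C'')"
    proof (rule inj_onI, clarify)
      fix i j i' j' assume ij: "i \<in> R''" "j \<in> C''" "i' \<in> R''" "j' \<in> C''" and eq: "tr (X i j) = tr (X i' j')"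
      have eq0: "A0 k (X i j) \<longleftrightarrow> A0 k (X i' j')" if "k \<in> R''" for k
      proof -
        have "Inl k \<in> tr (X i j) \<longleftrightarrow> Inl k \<in> tr (X i' j')" using eq by simp
        then show ?thesis using that by (simp add: tr_def A_def I_def)
      qed
      have eq1: "A1 k (X i j) \<longleftrightarrow> A1 k (X i' j')" if "k \<in> C''" for k
      proof -
        have "Inr k \<in> tr (X i j) \<longleftrightarrow> Inr k \<in> tr (X i' j')" using eq by simp
        then show ?thesis using that by (simp add: tr_def A_def I_def)
      qed
      have "i \<in> f ` {..<s + s * r}" "i' \<in> f ` {..<s + s * r}" using ij R''(1) g(2) by blast+
      then obtain a a' where a: "i = f a" "a < s + s * r" "i' = f a'" "a' < s + s * r" by blast
      have jC': "j \<in> C'" "j' \<in> C'" using ij g(1) by (auto simp: C''_def)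
      have mem: "i \<in> R" "i' \<in> R" "j \<in> C" "j' \<in> C" using ij R''R C''(3) by auto
      have "\<not> a < a'" using f_A0[of a' a j'] a jC' eq0[OF ij(1)] A0_diag[OF mem(1,3)] by auto
      moreover have "\<not> a' < a" using f_A0[of a a' j] a jC' eq0[OF ij(3)] A0_diag[OF mem(2,4)] by auto
      ultimately have i: "i = i'" using a by simp
      obtain d d' where d: "j = g d" "d < s" "j' = g d'" "d' < s" using ij by (auto simp: C''_def)
      have iR': "i \<in> R'" "i' \<in> R'" using ij R'' by auto
      have "\<not> d < d'" using g_A1[of d' d i'] d iR' eq1[OF ij(2)] A1_diag[OF mem(1,3)] by auto
      moreover have "\<not> d' < d" using g_A1[of d d' i] d iR' eq1[OF ij(4)] A1_diag[OF mem(2,4)] by auto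
      ultimately show "i = i' \<and> j = j'" using d i by simp
    qed
    then have "card ((\<lambda>(i, j). tr (X i j)) ` (R'' \<times> C'')) = s * s"
      using R'' C'' by (simp add: card_image card_cartesian_product)
    moreover have "card ((\<lambda>(i, j). tr (X i j)) ` (R'' \<times> C'')) \<le> card (tr ` UNIV)"
      using card_cells_le(1)[OF cardI(2) bcA, where X = UNIV] by (intro card_mono) (auto simp: tr_def)
    moreover have "card (tr ` UNIV) \<le> 2 * N * (2 * s) + 1"
      using card_cells_le(2)[OF cardI(2) bcA, where X = UNIV] cardI(1) by (simp add: tr_def)
    ultimately have "s * s \<le> 2 * N * (2 * s) + 1" by linarith
    also have "\<dots> < s * s" by (simp add: s_def algebra_simps)
    finally show False by simp
  qed
qed

end

section \<open>Orthogonality of the residue field and the value group\<close>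

lemma finite_max_exists:
  fixes f :: "'b \<Rightarrow> 'c::linorder"
  assumes "finite T" "T \<noteq> {}"
  shows "\<exists>p\<in>T. \<forall>q\<in>T. f q \<le> f p"
proof -
  have "Max (f ` T) \<in> f ` T" using assms by simp
  then obtain p where "p \<in> T" "f p = Max (f ` T)" by auto
  then show ?thesis using assms(1) by (intro bexI[of _ p]) auto
qed

lemma finite_min_exists:
  fixes f :: "'b \<Rightarrow> 'c::linorder"
  assumes "finite T" "T \<noteq> {}"
  shows "\<exists>p\<in>T. \<forall>q\<in>T. f p \<le> f q"
proof -
  have "Min (f ` T) \<in> f ` T" using assms by simp
  then obtain p where "p \<in> T" "f p = Min (f ` T)" by auto
  then show ?thesis using assms(1) by (intro bexI[of _ p]) auto
qed

lemma finite_if_card_bound: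
  assumes "\<And>T. T \<subseteq> A \<Longrightarrow> finite T \<Longrightarrow> T \<noteq> {} \<Longrightarrow> card T \<le> n"
  shows "finite A"
proof (rule ccontr)
  assume "infinite A"
  then obtain T where T: "T \<subseteq> A" "finite T" "card T = Suc n"
    using infinite_arbitrarily_large[of A "Suc n"] by blast
  then have "T \<noteq> {}" by auto
  then show False using assms[OF T(1,2)] T(3) by simp
qed

context c_minimal_monster
begin

text \<open>
  Suppose the union is cofinite in \<open>RV\<^sub>\<gamma>\<close>, and let \<open>S\<close> be the set of those \<open>w\<close> below which the union is
  still finite in \<open>RV\<^sub>\<gamma>\<close>. For almost all \<open>x\<close>, the set of \<open>w\<close> with \<open>K x w\<close> is coinitial in the complement
  of \<open>S\<close>, hence contains an initial segment of it, since it has only finitely many cut points. So some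
  \<open>w\<close> belongs to too many \<open>x\<close>.
\<close>

lemma orthogonality:
  assumes K: "def2 K"
    and inv: "\<And>w. rv_inv (\<lambda>x. K x w b)"
    and v_inv: "\<And>x w w'. K x w b \<Longrightarrow> w \<noteq> 0 \<and> (w' \<noteq> 0 \<longrightarrow> v w' = v w \<longrightarrow> K x w' b)"
    and fin: "\<And>w \<gamma>. finite (rv_part (\<lambda>x. K x w b) \<gamma>)"
  shows "finite (rv_set (\<lambda>x. \<exists>w. K x w b))"
proof -
  define X where "X x \<longleftrightarrow> (\<exists>w. K x w b)" for x
  \<comment> \<open>The sets \<open>B w\<close> increase with \<open>v w\<close>. They are uniformly
    definable, so in each fiber they have at most \<open>N3\<close> classes or omit at most
    \<open>N3\<close>.\<close>
  define B where "B w x \<longleftrightarrow> (\<exists>w'. \<not> w' = 0 \<and> \<not> w = 0 \<and> \<not> vle w w' \<and> K x w' b)" for w x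
  have B_iff: "B w x \<longleftrightarrow> (\<exists>w'. w' \<noteq> 0 \<and> v w' < v w \<and> K x w' b)" if "w \<noteq> 0" for w x
    using that unfolding B_def vle_def by auto
  have "def1 (\<lambda>x e. K x (e 0) (\<lambda>i. e (Suc i)))"
    unfolding def1_def by (intro vf_intros def2_subst[OF K])
  from uniform_ball_comb[OF this] obtain N2 where "\<forall>e. ball_comb N2 (\<lambda>x. K x (e 0) (\<lambda>i. e (Suc i)))" ..
  from this[THEN spec, of "case_nat _ b"] have N2: "ball_comb N2 (\<lambda>x. K x w b)" for w by simp
  have "def1 (\<lambda>x e. \<exists>w'. \<not> w' = 0 \<and> \<not> e 0 = 0 \<and> \<not> vle (e 0) w' \<and> K x w' (\<lambda>i. e (Suc i)))"
    unfolding def1_def by (intro vf_intros def2_subst[OF K])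
  from uniform_ball_comb[OF this] obtain N3 where
    "\<forall>e. ball_comb N3 (\<lambda>x. \<exists>w'. \<not> w' = 0 \<and> \<not> e 0 = 0 \<and> \<not> vle (e 0) w' \<and> K x w' (\<lambda>i. e (Suc i)))" ..
  from this[THEN spec, of "case_nat _ b"] have N3: "ball_comb N3 (B w)" for w
    unfolding B_def[abs_def] by simp
  have "def1 (\<lambda>x e. \<exists>w. K x w e)"
    unfolding def1_def by (intro vf_intros def2_subst[OF K])
  from definable_ball_comb[OF this, of b] obtain N4 where N4: "ball_comb N4 X"
    unfolding X_def[abs_def] ..
  have "def1 (\<lambda>w e. K (e 0) w (\<lambda>i. e (Suc i)))"
    unfolding def1_def by (intro vf_intros def2_subst[OF K])
  from definable_ball_comb[OF this, of "case_nat _ b"]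
  have N5: "\<exists>n. ball_comb n (\<lambda>w. K x w b)" for x by simp
  have K_nz: "x \<noteq> 0" "w \<noteq> 0" if "K x w b" for x w
    using that rv_invD(1)[OF inv] v_inv by blast+
  have K_rv: "K y w b" if "K x w b" "y \<noteq> 0" "rv v x = rv v y" for x y w
    using rv_invD(2)[OF inv, of x w y] that by blast
  have invX: "rv_inv X" unfolding rv_inv_def X_def using K_nz K_rv by blast
  have invB: "rv_inv (B w)" for w unfolding rv_inv_def B_def using K_nz K_rv by blast
  have "finite (rv_part X \<gamma>)" for \<gamma>
  proof (rule ccontr)
    assume infX: "infinite (rv_part X \<gamma>)"
    define S where "S = {w. w \<noteq> 0 \<and> finite (rv_part (B w) \<gamma>)}"
    define XS where "XS x \<longleftrightarrow> (\<exists>w \<in> S. K x w b)" for x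
    have B_mono: "B w x \<Longrightarrow> v w \<le> v u \<Longrightarrow> B u x" if "w \<noteq> 0" "u \<noteq> 0" for w u x
      using that by (auto simp: B_iff)
    have S_down: "w \<in> S" if "u \<in> S" "w \<noteq> 0" "v w \<le> v u" for u w
    proof -
      have "rv_part (B w) \<gamma> \<subseteq> rv_part (B u) \<gamma>" using B_mono[of w u] that by (auto simp: S_def)
      then show ?thesis using that finite_subset by (auto simp: S_def)
    qed
    \<comment> \<open>Finitely many classes with witnesses in \<open>S\<close> are compared at the
      largest of the witness values. Those with that value as witness number at most
      \<open>N2\<close>, those with a smaller one at most \<open>N3\<close>.\<close>
    have finXS: "finite (rv_part XS \<gamma>)"
    proof (rule finite_if_card_bound)
      fix T assume T: "T \<subseteq> rv_part XS \<gamma>" "finite T" "T \<noteq> {}"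
      have "\<forall>p \<in> T. \<exists>w. w \<in> S \<and> p \<in> rv_part (\<lambda>x. K x w b) \<gamma>"
        using T(1) unfolding XS_def by blast
      then obtain w where w: "\<And>p. p \<in> T \<Longrightarrow> w p \<in> S \<and> p \<in> rv_part (\<lambda>x. K x (w p) b) \<gamma>" by metis
      obtain q where q: "q \<in> T" "\<And>p. p \<in> T \<Longrightarrow> v (w p) \<le> v (w q)"
        using finite_max_exists[OF T(2,3), of "\<lambda>p. v (w p)"] by blast
      have wq: "w q \<in> S" "w q \<noteq> 0" using w[OF q(1)] by (auto simp: S_def)
      have sub: "T \<subseteq> rv_part (B (w q)) \<gamma> \<union> rv_part (\<lambda>x. K x (w q) b) \<gamma>"
      proof
        fix p assume p: "p \<in> T"
        obtain x where x: "p = rv v x" "K x (w p) b" "v x = \<gamma>" using w[OF p] by auto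
        show "p \<in> rv_part (B (w q)) \<gamma> \<union> rv_part (\<lambda>x. K x (w q) b) \<gamma>"
        proof (cases "v (w p) = v (w q)")
          case True
          then have "K x (w q) b" using v_inv[OF x(2)] wq(2) by simp
          then show ?thesis using x by blast
        next
          case False
          then have "B (w q) x" using q(2)[OF p] B_iff[OF wq(2)] K_nz(2)[OF x(2)] x(2) by force
          then show ?thesis using x by blast
        qed
      qed
      have fB: "finite (rv_part (B (w q)) \<gamma>)" using wq by (simp add: S_def)
      have "card T \<le> card (rv_part (B (w q)) \<gamma> \<union> rv_part (\<lambda>x. K x (w q) b) \<gamma>)"
        using fB fin sub by (intro card_mono) auto
      also have "\<dots> \<le> N3 + N2"
        using card_Un_le infinite_rv_part_iff(3)[OF invB N3 fB] infinite_rv_part_iff(3)[OF inv N2 fin]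
        by (meson add_mono order_trans)
      finally show "card T \<le> N3 + N2" .
    qed
    \<comment> \<open>For \<open>w\<close> outside \<open>S\<close> the set \<open>B w\<close> is
      infinite over \<open>\<gamma>\<close>, while witnesses in \<open>S\<close> account for
      finitely many classes only.\<close>
    have no_min: "\<exists>u. u \<noteq> 0 \<and> u \<notin> S \<and> v u < v w" if w: "w \<noteq> 0" "w \<notin> S" for w
    proof -
      have "\<not> rv_part (B w) \<gamma> \<subseteq> rv_part XS \<gamma>" using w finXS finite_subset by (auto simp: S_def)
      then obtain x where x: "B w x" "v x = \<gamma>" "\<not> XS x" by auto
      then obtain u where "u \<noteq> 0" "v u < v w" "K x u b" using B_iff[OF w(1)] by blast
      then show ?thesis using x(3) by (auto simp: XS_def)
    qed
    obtain w0 where w0: "w0 \<noteq> 0" "w0 \<notin> S"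
    proof (rule ccontr)
      assume "\<not> thesis"
      then have "\<And>w. w \<noteq> 0 \<Longrightarrow> w \<in> S" using that by blast
      then have "X x \<Longrightarrow> XS x" for x using K_nz by (auto simp: X_def XS_def)
      then have sub: "rv_part X \<gamma> \<subseteq> rv_part XS \<gamma>" by auto
      show False using finite_subset[OF sub finXS] infX by simp
    qed
    define Z where "Z = {p \<in> RV_fiber v \<gamma>. \<forall>w. w \<noteq> 0 \<longrightarrow> w \<notin> S \<longrightarrow> p \<in> rv_part (B w) \<gamma>}"
    \<comment> \<open>If each of finitely many classes is omitted by some \<open>B w\<close>, then
      by monotonicity all are omitted at the smallest of these values, where at most
      \<open>N3\<close> can be.\<close>
    have finZ: "finite (RV_fiber v \<gamma> - Z)"
    proof (rule finite_if_card_bound)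
      fix T assume T: "T \<subseteq> RV_fiber v \<gamma> - Z" "finite T" "T \<noteq> {}"
      have "\<forall>p \<in> T. \<exists>w. w \<noteq> 0 \<and> w \<notin> S \<and> p \<notin> rv_part (B w) \<gamma>"
        using T(1) unfolding Z_def by blast
      then obtain w where w: "\<And>p. p \<in> T \<Longrightarrow> w p \<noteq> 0 \<and> w p \<notin> S \<and> p \<notin> rv_part (B (w p)) \<gamma>" by metis
      obtain q where q: "q \<in> T" "\<And>p. p \<in> T \<Longrightarrow> v (w q) \<le> v (w p)"
        using finite_min_exists[OF T(2,3), of "\<lambda>p. v (w p)"] by blast
      have "p \<notin> rv_part (B (w q)) \<gamma>" if p: "p \<in> T" for p
      proof
        assume "p \<in> rv_part (B (w q)) \<gamma>"
        then have "p \<in> rv_part (B (w p)) \<gamma>"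
          using B_mono[of "w q" "w p"] w[OF p] w[OF q(1)] q(2)[OF p] by blast
        then show False using w[OF p] by simp
      qed
      then have sub: "T \<subseteq> RV_fiber v \<gamma> - rv_part (B (w q)) \<gamma>" using T(1) by blast
      have inf: "infinite (rv_part (B (w q)) \<gamma>)" using w[OF q(1)] by (auto simp: S_def)
      note infinite_rv_part_iff(1,2)[OF invB N3, of "w q" \<gamma>]
      then show "card T \<le> N3" using inf card_mono[OF _ sub] by linarith
    qed
    have "infinite Z"
    proof
      assume "finite Z"
      moreover have "RV_fiber v \<gamma> \<subseteq> (RV_fiber v \<gamma> - Z) \<union> Z" by blast
      ultimately show False using infinite_RV_fiber[of \<gamma>] finZ finite_subset by blast
    qed
    then have "infinite (Z - rv_part XS \<gamma>)" using Diff_infinite_finite[OF finXS] by blast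
    from infinite_arbitrarily_large[OF this, of "Suc N2"]
    obtain T where T: "T \<subseteq> Z - rv_part XS \<gamma>" "finite T" "card T = Suc N2" by blast
    have "\<forall>p \<in> T. \<exists>x. x \<noteq> 0 \<and> v x = \<gamma> \<and> p = rv v x"
      using T(1) unfolding Z_def RV_fiber_def by blast
    then obtain x where x: "\<And>p. p \<in> T \<Longrightarrow> x p \<noteq> 0 \<and> v (x p) = \<gamma> \<and> p = rv v (x p)" by metis
    have coinitial: "\<exists>u. u \<noteq> 0 \<and> u \<notin> S \<and> v u < v w \<and> K (x p) u b"
      if p: "p \<in> T" and w: "w \<noteq> 0" "w \<notin> S" for p w
    proof -
      have "rv v (x p) \<in> rv_part (B w) \<gamma>" using T(1) p w x[OF p] unfolding Z_def by auto
      then have "B w (x p)" using rv_mem_part_iff[OF invB] x[OF p] by blast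
      then obtain u where u: "u \<noteq> 0" "v u < v w" "K (x p) u b" using B_iff[OF w(1)] by blast
      moreover have "\<not> XS (x p)" using T(1) p x[OF p] by blast
      ultimately show ?thesis by (auto simp: XS_def)
    qed
    define cuts where "cuts p C \<longleftrightarrow> finite C \<and> (\<forall>w u. w \<noteq> 0 \<longrightarrow> u \<noteq> 0 \<longrightarrow>
      (\<forall>c \<in> C. (c < v w \<longleftrightarrow> c < v u) \<and> (v w < c \<longleftrightarrow> v u < c)) \<longrightarrow> K (x p) w b \<longrightarrow> K (x p) u b)" for p C
    have "\<exists>C. cuts p C" for p
    proof -
      obtain n where n: "ball_comb n (\<lambda>w. K (x p) w b)" using N5 by blast
      show ?thesis
      proof (rule v_invariant_cuts[OF n])
        show "K (x p) u b" if "w \<noteq> 0" "u \<noteq> 0" "v w = v u" "K (x p) w b" for w u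
          using v_inv[OF that(4), of u] that by simp
        fix C assume "finite C" and C: "\<And>w u. w \<noteq> 0 \<Longrightarrow> u \<noteq> 0 \<Longrightarrow>
          (\<And>c. c \<in> C \<Longrightarrow> (c < v w \<longleftrightarrow> c < v u) \<and> (v w < c \<longleftrightarrow> v u < c)) \<Longrightarrow> K (x p) w b \<Longrightarrow> K (x p) u b"
        have "K (x p) u b" if "w \<noteq> 0" "u \<noteq> 0" "K (x p) w b"
          "\<forall>c \<in> C. (c < v w \<longleftrightarrow> c < v u) \<and> (v w < c \<longleftrightarrow> v u < c)" for w u
          by (rule C[OF that(1,2) _ that(3)]) (use that(4) in blast)
        with \<open>finite C\<close> show ?thesis unfolding cuts_def by blast
      qed
    qed
    then have "\<forall>p. \<exists>C. cuts p C" by blast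
    from choice[OF this] obtain C where C_all: "\<forall>p. cuts p (C p)" ..
    have C1: "finite (C p)" for p
      by (rule conjunct1[OF C_all[THEN spec, of p, unfolded cuts_def]])
    have C2: "K (x p) u b" if "w \<noteq> 0" "u \<noteq> 0" "K (x p) w b"
      "\<forall>c \<in> C p. (c < v w \<longleftrightarrow> c < v u) \<and> (v w < c \<longleftrightarrow> v u < c)" for p w u
      using C_all[THEN spec, of p, unfolded cuts_def, THEN conjunct2, THEN spec, THEN spec, of w u] that
      by (elim impE) assumption+
    \<comment> \<open>Cuts that are values of elements of \<open>S\<close> lie below every value
      outside \<open>S\<close>, so only the remaining ones can obstruct. \<open>w1\<close> will lie
      below all of these; \<open>v w0\<close> serves as a starting point if there are none.\<close>
    define C' where "C' = {c \<in> \<Union>p\<in>T. C p. \<exists>u. u \<noteq> 0 \<and> u \<notin> S \<and> v u = c}"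
    have "finite C'" using T(2) C1 by (simp add: C'_def)
    then have "finite (insert (v w0) C')" "insert (v w0) C' \<noteq> {}" by auto
    from finite_min_exists[OF this, of "\<lambda>c. c"] obtain c0
      where c0: "c0 \<in> insert (v w0) C'" "\<And>c. c \<in> C' \<Longrightarrow> c0 \<le> c" by blast
    obtain u0 where u0: "u0 \<noteq> 0" "u0 \<notin> S" "v u0 = c0" using c0(1) w0 by (auto simp: C'_def)
    obtain w1 where w1: "w1 \<noteq> 0" "w1 \<notin> S" "v w1 < c0" using no_min[OF u0(1,2)] u0(3) by blast
    \<comment> \<open>No cut separates \<open>w1\<close> from a witness further down. So
      \<open>w1\<close> is a witness for all \<open>Suc N2\<close> classes of \<open>T\<close>, one
      more than possible.\<close>
    have "K (x p) w1 b" if p: "p \<in> T" for p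
    proof -
      obtain u where u: "u \<noteq> 0" "u \<notin> S" "v u < v w1" "K (x p) u b"
        using coinitial[OF p w1(1,2)] by blast
      have "(c < v u \<longleftrightarrow> c < v w1) \<and> (v u < c \<longleftrightarrow> v w1 < c)" if c: "c \<in> C p" for c
      proof (cases "c \<in> C'")
        case True
        then show ?thesis using c0(2)[OF True] w1(3) u(3) by auto
      next
        case False
        obtain z where z: "z \<noteq> 0" "v z = c" using v_surj by blast
        then have "z \<in> S" using False c p by (auto simp: C'_def)
        then have "c < v u" using S_down[of z u] u(1,2) z by force
        then show ?thesis using u(3) by auto
      qed
      then show ?thesis using C2[OF u(1) w1(1) u(4)] by blast
    qed
    then have sub: "T \<subseteq> rv_part (\<lambda>x. K x w1 b) \<gamma>" using x by blast
    have "card T \<le> N2"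
      using card_mono[OF fin sub] infinite_rv_part_iff(3)[OF inv N2 fin, of w1 \<gamma>] by linarith
    then show False using T(3) by simp
  qed
  then show ?thesis using finite_rv_set[OF invX N4] unfolding X_def by blast
qed

section \<open>Relations between classes of RV as invariant relations on the home sort\<close>

definition rv_inv2 :: "('a \<Rightarrow> 'a \<Rightarrow> bool) \<Rightarrow> bool" where
  "rv_inv2 P \<longleftrightarrow> (\<forall>x. rv_inv (P x)) \<and> (\<forall>y. rv_inv (\<lambda>x. P x y))"

abbreviation rv_set2 :: "('a \<Rightarrow> 'a \<Rightarrow> bool) \<Rightarrow> ('a set \<times> 'a set) set" where
  "rv_set2 P \<equiv> {(rv v x, rv v y) | x y. P x y}"

lemma rv_inv2D:
  assumes "rv_inv2 P" "P x y"
  shows "x \<noteq> 0" "y \<noteq> 0"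
    and "x' \<noteq> 0 \<Longrightarrow> y' \<noteq> 0 \<Longrightarrow> rv v x = rv v x' \<Longrightarrow> rv v y = rv v y' \<Longrightarrow> P x' y'"
  using assms unfolding rv_inv2_def by (meson rv_invD)+

lemma rv_set2_mem: "rv_inv2 P \<Longrightarrow> x \<noteq> 0 \<Longrightarrow> y \<noteq> 0 \<Longrightarrow> (rv v x, rv v y) \<in> rv_set2 P \<longleftrightarrow> P x y"
  using rv_inv2D(3)[of P _ _ x y] by force

text \<open>The full preimage is invariant even where \<open>\<phi>\<close> distinguishes
  representatives of one class.\<close>

definition pullback :: "('f vf_fun, 'r vf_rel) form \<Rightarrow> 'a \<Rightarrow> 'a \<Rightarrow> (nat \<Rightarrow> 'a) \<Rightarrow> bool" where
  "pullback \<phi> x y b \<longleftrightarrow> x \<noteq> 0 \<and> y \<noteq> 0 \<and> (rv v x, rv v y) \<in> RV2_set M v \<phi> b"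

lemma rv_inv2_pullback: "rv_inv2 (\<lambda>x y. pullback \<phi> x y b)"
  unfolding rv_inv2_def rv_inv_def pullback_def by auto

lemma rv_set2_pullback: "rv_set2 (\<lambda>x y. pullback \<phi> x y b) = RV2_set M v \<phi> b"
  unfolding pullback_def RV2_set_def by blast

lemma def2_pullback:
  assumes "\<phi> \<in> formulas L"
  shows "def2 (pullback \<phi>)"
proof -
  have "pullback \<phi> x y b \<longleftrightarrow> (\<exists>x' y'. rveq x x' \<and> rveq y y' \<and> sat M (b(0 := x', 1 := y')) \<phi>)" for x y b
    unfolding pullback_def RV2_set_def rveq_def by blast
  moreover have "Dfn (\<lambda>e. sat M ((\<lambda>i. e (Suc (Suc (Suc (Suc i)))))(0 := e 1, 1 := e 0)) \<phi>)"
  proof (rule def_pred_subst[of L M "\<lambda>e. sat M e \<phi>"])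
    show "Dfn (\<lambda>e. sat M e \<phi>)" using assms by (rule def_predI) simp
    show "Dtm (\<lambda>e. ((\<lambda>i. e (Suc (Suc (Suc (Suc i)))))(0 := e 1, 1 := e 0)) i)" for i
      by (cases "i = 0"; cases "i = 1") (simp_all add: def_term_var)
  qed
  ultimately show ?thesis
    unfolding def2_def by (simp only:) (intro vf_intros, simp)
qed

text \<open>\<open>RV2_set\<close> overwrites entries \<open>0\<close> and \<open>1\<close>, so the
  parameters have to start at entry \<open>2\<close>.\<close>

lemma def2_formula:
  assumes "def2 F"
  shows "\<exists>\<phi> \<in> formulas L. \<forall>b. RV2_set M v \<phi> (\<lambda>i. b (i - 2)) = rv_set2 (\<lambda>x y. x \<noteq> 0 \<and> y \<noteq> 0 \<and> F x y b)"
proof -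
  obtain \<phi> where \<phi>: "\<phi> \<in> formulas L" "\<And>e. sat M e \<phi> \<longleftrightarrow> F (e 0) (e 1) (\<lambda>i. e (Suc (Suc i)))"
    using assms unfolding def2_def def_pred_def by blast
  then show ?thesis by (intro bexI[of _ \<phi>]) (simp_all add: RV2_set_def)
qed

lemma rv_set2_definable:
  assumes "def2 F" "rv_inv2 (\<lambda>x y. F x y b)"
  shows "rv_set2 (\<lambda>x y. F x y b) \<in> definable_RV2 L M v"
proof -
  from def2_formula[OF assms(1)] obtain \<phi> where \<phi>: "\<phi> \<in> formulas L" and
    "\<forall>b. RV2_set M v \<phi> (\<lambda>i. b (i - 2)) = rv_set2 (\<lambda>x y. x \<noteq> 0 \<and> y \<noteq> 0 \<and> F x y b)" by (elim bexE)
  from this(2)[THEN spec, of b]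
  have RV2: "RV2_set M v \<phi> (\<lambda>i. b (i - 2)) = rv_set2 (\<lambda>x y. x \<noteq> 0 \<and> y \<noteq> 0 \<and> F x y b)" .
  have "(x \<noteq> 0 \<and> y \<noteq> 0 \<and> F x y b) \<longleftrightarrow> F x y b" for x y using rv_inv2D(1,2)[OF assms(2)] by blast
  with RV2 have "RV2_set M v \<phi> (\<lambda>i. b (i - 2)) = rv_set2 (\<lambda>x y. F x y b)" by simp
  then show ?thesis using \<phi> unfolding definable_RV2_def by (metis (mono_tags, lifting) mem_Collect_eq)
qed

text \<open>The value is given by a field element \<open>w\<close>, so that the locus of infinite
  fibers is a definable family with \<open>w\<close> as a variable, as \<open>orthogonality\<close>
  requires.\<close>

definition big :: "('a \<Rightarrow> 'a \<Rightarrow> (nat \<Rightarrow> 'a) \<Rightarrow> bool) \<Rightarrow> 'a \<Rightarrow> 'a \<Rightarrow> (nat \<Rightarrow> 'a) \<Rightarrow> bool" where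
  "big G x w b \<longleftrightarrow> w \<noteq> 0 \<and> infinite (rv_part (\<lambda>y. G x y b) (v w))"

lemma def2_big:
  assumes G: "def2 G" and inv: "\<And>b. rv_inv2 (\<lambda>x y. G x y b)"
  shows "def2 (big G)"
proof -
  have "def1 (\<lambda>y e. G (e 0) y (\<lambda>i. e (Suc i)))"
    unfolding def1_def by (intro vf_intros def2_subst[OF G])
  from def1_infinite_rv_part[OF this]
  have "def1 (\<lambda>w e. w \<noteq> 0 \<and> infinite (rv_part (\<lambda>y. G (e 0) y (\<lambda>i. e (Suc i))) (v w)))"
    using inv unfolding rv_inv2_def by blast
  moreover have "Dtm (\<lambda>e. case_nat (e 0) (\<lambda>i. e (Suc (Suc i))) i)" for i
    by (cases i) (simp_all add: def_term_var)
  ultimately show ?thesis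
    using def1_subst[OF _ def_term_var[of _ _ 1], where g = "\<lambda>e. case_nat (e 0) (\<lambda>i. e (Suc (Suc i)))"]
    unfolding def2_def big_def by fastforce
qed

lemma rv_inv_big:
  assumes "rv_inv2 (\<lambda>x y. G x y b)"
  shows "rv_inv (\<lambda>x. big G x w b)"
proof -
  have "x \<noteq> 0" if "big G x w b" for x
  proof -
    have "rv_part (\<lambda>y. G x y b) (v w) \<noteq> {}" using that unfolding big_def by (metis finite.emptyI)
    then show ?thesis using rv_inv2D(1)[OF assms] by blast
  qed
  moreover have "big G x' w b" if "big G x w b" "x \<noteq> 0" "x' \<noteq> 0" "rv v x = rv v x'" for x x'
  proof -
    have "G x y b \<longleftrightarrow> G x' y b" for y
      using rv_inv2D(2,3)[OF assms, of x y] rv_inv2D(2,3)[OF assms, of x' y] that by metis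
    then show ?thesis using that(1) unfolding big_def by simp
  qed
  ultimately show ?thesis unfolding rv_inv_def by blast
qed

lemma big_v_eq: "big G x w b \<Longrightarrow> w \<noteq> 0 \<and> (w' \<noteq> 0 \<longrightarrow> v w' = v w \<longrightarrow> big G x w' b)"
  unfolding big_def by simp

end

section \<open>Morley rank and ict-patterns\<close>

lemma morley_rank_ge_mono:
  assumes "morley_rank_ge \<D> n X" "X \<subseteq> X'"
  shows "morley_rank_ge \<D> n X'"
proof (cases n)
  case 0
  then show ?thesis using assms by auto
next
  case (Suc k)
  then obtain Y where "disjoint_family Y" "\<forall>i::nat. Y i \<in> \<D> \<and> Y i \<subseteq> X \<and> morley_rank_ge \<D> k (Y i)"
    using assms(1) by auto
  then show ?thesis unfolding Suc morley_rank_ge.simps using assms(2) by blast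
qed

lemma morley_rank_ge_Suc:
  assumes "morley_rank_ge \<D> (Suc n) X"
  shows "morley_rank_ge \<D> n X"
proof -
  from assms obtain Y where "\<forall>i::nat. Y i \<in> \<D> \<and> Y i \<subseteq> X \<and> morley_rank_ge \<D> n (Y i)" by auto
  from this[THEN spec, of 0] show ?thesis using morley_rank_ge_mono by blast
qed

lemma morley_rank_ge_le: "morley_rank_ge \<D> n X \<Longrightarrow> m \<le> n \<Longrightarrow> morley_rank_ge \<D> m X"
  by (induction n) (auto simp: le_Suc_eq simp del: morley_rank_ge.simps dest: morley_rank_ge_Suc)

lemma morley_rank_less_Suc_iff: "morley_rank \<D> X < enat (Suc n) \<longleftrightarrow> \<not> morley_rank_ge \<D> (Suc n) X"
proof
  assume *: "morley_rank \<D> X < enat (Suc n)"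
  show "\<not> morley_rank_ge \<D> (Suc n) X"
  proof
    assume "morley_rank_ge \<D> (Suc n) X"
    then have "enat (Suc n) \<le> morley_rank \<D> X" unfolding morley_rank_def by (intro Sup_upper) blast
    then show False using * by simp
  qed
next
  assume *: "\<not> morley_rank_ge \<D> (Suc n) X"
  have "morley_rank \<D> X \<le> enat n"
    unfolding morley_rank_def
  proof (rule Sup_least, clarify)
    fix k assume "morley_rank_ge \<D> k X"
    then have "\<not> Suc n \<le> k" using * morley_rank_ge_le by blast
    then show "enat k \<le> enat n" by simp
  qed
  then show "morley_rank \<D> X < enat (Suc n)" using less_enat_def by (metis enat_ord_simps(2) le_less_trans lessI)
qed

lemma infinite_if_disjoint_parts:
  assumes "disjoint_family Y" "\<And>i::nat. Y i \<noteq> {} \<and> Y i \<subseteq> X"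
  shows "infinite X"
proof -
  have "\<forall>i. \<exists>z. z \<in> Y i" using assms(2) by blast
  from choice[OF this] obtain y where "\<forall>i. y i \<in> Y i" ..
  then have y: "y i \<in> Y i" for i by simp
  have "inj y"
  proof (rule injI)
    fix i j assume "y i = y j"
    then have "y i \<in> Y i \<inter> Y j" using y[of i] y[of j] by simp
    then show "i = j" using assms(1) unfolding disjoint_family_on_def by blast
  qed
  moreover have "range y \<subseteq> X" using y assms(2) by blast
  ultimately show ?thesis using infinite_iff_countable_subset by blast
qed

lemma RV2_ict_pattern_mono:
  "RV2_ict_pattern L M v D n \<phi> b \<Longrightarrow> m \<le> n \<Longrightarrow> RV2_ict_pattern L M v D m \<phi> b"
  unfolding RV2_ict_pattern_def by (meson order_less_le_trans)

lemma dp_rank_le_1_iff: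
  "dp_rank L M v D \<le> 1 \<longleftrightarrow> (\<forall>\<phi> b. \<not> RV2_ict_pattern L M v D 2 \<phi> b)"
proof (intro iffI allI notI)
  fix \<phi> b assume *: "dp_rank L M v D \<le> 1" and "RV2_ict_pattern L M v D 2 \<phi> b"
  then have "enat 2 \<le> dp_rank L M v D" unfolding dp_rank_def by (intro Sup_upper) blast
  then have "enat 2 \<le> enat 1" using * unfolding one_enat_def by (rule order_trans)
  then show False by simp
next
  assume *: "\<forall>\<phi> b. \<not> RV2_ict_pattern L M v D 2 \<phi> b"
  show "dp_rank L M v D \<le> 1"
    unfolding dp_rank_def
  proof (rule Sup_least, clarify)
    fix n \<phi> b assume "RV2_ict_pattern L M v D n \<phi> b"
    then have "\<not> 2 \<le> n" using * RV2_ict_pattern_mono by blast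
    then show "enat n \<le> 1" by (simp add: one_enat_def)
  qed
qed

section \<open>Patterns and rank two in terms of infinitely many large fibers\<close>

context c_minimal_monster
begin

text \<open>Any finite part of an enumeration is avoided by some class of the infinite fiber, hence
  by countable saturation the whole enumeration is.\<close>

lemma uncountable_RV_fiber: "uncountable (RV_fiber v \<gamma>)"
proof
  assume count: "countable (RV_fiber v \<gamma>)"
  obtain d where d: "d \<noteq> 0" "v d = \<gamma>" using v_surj by blast
  have ne: "RV_fiber v \<gamma> \<noteq> {}" using infinite_RV_fiber[of \<gamma>] by auto
  have "\<exists>y. y \<noteq> 0 \<and> v y = \<gamma> \<and> from_nat_into (RV_fiber v \<gamma>) n = rv v y" for n
    using from_nat_into[OF ne, of n] unfolding RV_fiber_def by blast
  then obtain y where y: "\<And>n. y n \<noteq> 0 \<and> v (y n) = \<gamma> \<and> from_nat_into (RV_fiber v \<gamma>) n = rv v (y n)"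
    by metis
  define P where "P n e \<longleftrightarrow> veq (e 0) (e 1) \<and> \<not> rveq (e 0) (e 2)" for n :: nat and e :: "nat \<Rightarrow> 'a"
  define c where "c n i = (if i = 0 then d else y n)" for n and i :: nat
  have P: "P n (case_nat x (c n)) \<longleftrightarrow> veq x d \<and> \<not> rveq x (y n)" for n x
    by (simp add: P_def c_def numeral_2_eq_2)
  have "\<exists>x. \<forall>n. P n (case_nat x (c n))"
  proof (rule countable_saturation[OF monster])
    show "Dfn (P n)" for n unfolding P_def by (intro vf_intros)
    fix m
    have "\<not> RV_fiber v \<gamma> \<subseteq> (\<lambda>n. rv v (y n)) ` {..<m}"
      using infinite_RV_fiber finite_subset by blast
    then obtain x where "x \<noteq> 0" "v x = \<gamma>" "rv v x \<notin> (\<lambda>n. rv v (y n)) ` {..<m}"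
      by (auto simp: RV_fiber_def)
    then show "\<exists>x. \<forall>n<m. P n (case_nat x (c n))"
      unfolding P using d by (intro exI[of _ x]) (auto simp: veq_def rveq_def)
  qed
  then obtain x where x: "\<And>n. veq x d \<and> \<not> rveq x (y n)" unfolding P by blast
  then have "rv v x \<in> RV_fiber v \<gamma>" using d by (auto simp: veq_def RV_fiber_def)
  then obtain n where "rv v x = rv v (y n)" using y from_nat_into_surj[OF count] by metis
  then show False using x[of n] y[of n] by (auto simp: veq_def rveq_def)
qed

lemma rv_inv2_fst: "rv_inv2 P \<Longrightarrow> rv_inv (P x)"
  unfolding rv_inv2_def by blast

lemma ball_comb_fst:
  assumes "def2 G"
  shows "\<exists>N. \<forall>x b. ball_comb N (\<lambda>y. G x y b)"
proof -
  have "def1 (\<lambda>y e. G (e 0) y (\<lambda>i. e (Suc i)))"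
    unfolding def1_def by (intro vf_intros def2_subst[OF assms])
  from uniform_ball_comb[OF this] obtain N where
    "\<forall>e. ball_comb N (\<lambda>y. G (e 0) y (\<lambda>i. e (Suc i)))" ..
  from this[THEN spec, of "case_nat _ _"] show ?thesis by auto
qed

lemma infinite_rv_reps:
  assumes "infinite (rv_part A \<gamma>)"
  shows "\<exists>x :: nat \<Rightarrow> 'a. (\<forall>i. A (x i) \<and> v (x i) = \<gamma>) \<and> (\<forall>i j. rv v (x i) = rv v (x j) \<longrightarrow> i = j)"
proof -
  from infinite_countable_subset[OF assms] obtain f :: "nat \<Rightarrow> 'a set"
    where f: "inj f" "range f \<subseteq> rv_part A \<gamma>" by (elim exE conjE)
  have "\<forall>i. \<exists>x. (A x \<and> v x = \<gamma>) \<and> f i = rv v x"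
  proof
    fix i
    have "f i \<in> rv_part A \<gamma>" using f(2) by auto
    then show "\<exists>x. (A x \<and> v x = \<gamma>) \<and> f i = rv v x" by auto
  qed
  from choice[OF this] obtain x where x: "\<forall>i. (A (x i) \<and> v (x i) = \<gamma>) \<and> f i = rv v (x i)" ..
  then have "rv v (x i) = rv v (x j) \<longrightarrow> i = j" for i j using injD[OF f(1), of i j] by simp
  then show ?thesis using x by (intro exI[of _ x]) simp
qed

lemma infinite_big_imp_ict_pattern:
  assumes G: "def2 G" and inv: "\<And>b. rv_inv2 (\<lambda>x y. G x y b)"
    and big: "infinite (rv_part (\<lambda>x. big G x d b) \<gamma>)"
  shows "\<exists>\<phi> b'. RV2_ict_pattern L M v (rv_set2 (\<lambda>x y. G x y b)) 2 \<phi> b'"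
proof -
  from infinite_rv_reps[OF big] obtain x :: "nat \<Rightarrow> 'a" where "\<forall>i. big G (x i) d b \<and> v (x i) = \<gamma>"
    "\<forall>i j. rv v (x i) = rv v (x j) \<longrightarrow> i = j" by (elim exE conjE)
  then have x: "big G (x i) d b \<and> v (x i) = \<gamma>" "rv v (x i) = rv v (x j) \<Longrightarrow> i = j" for i j
    by simp_all
  obtain N where N: "\<And>x b. ball_comb N (\<lambda>y. G x y b)" using ball_comb_fst[OF G] by blast
  have inv1: "rv_inv (\<lambda>y. G x y b)" for x using rv_inv2_fst[OF inv] .
  define U where "U y \<longleftrightarrow> (\<forall>i. G (x i) y b)" for y
  have fin: "finite (RV_fiber v (v d) - rv_part (\<lambda>y. G (x i) y b) (v d))" for i
    using infinite_rv_part_iff(1)[OF inv1 N] x(1)[of i] unfolding big_def by blast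
  have count: "countable (\<Union>i. RV_fiber v (v d) - rv_part (\<lambda>y. G (x i) y b) (v d))"
    by (rule countable_UN) (simp, rule countable_finite[OF fin])
  have sub: "RV_fiber v (v d) \<subseteq> (\<Union>i. RV_fiber v (v d) - rv_part (\<lambda>y. G (x i) y b) (v d)) \<union> rv_part U (v d)"
  proof
    fix p assume p: "p \<in> RV_fiber v (v d)"
    then obtain y where y: "y \<noteq> 0" "v y = v d" "p = rv v y" unfolding RV_fiber_def by blast
    have "U y" if "\<And>i. p \<in> rv_part (\<lambda>y. G (x i) y b) (v d)"
      using that rv_mem_part_iff[OF inv1 y(1)] unfolding U_def y(3) by blast
    then show "p \<in> (\<Union>i. RV_fiber v (v d) - rv_part (\<lambda>y. G (x i) y b) (v d)) \<union> rv_part U (v d)"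
      using p y by blast
  qed
  have "infinite (rv_part U (v d))"
    using uncountable_RV_fiber[of "v d"] count countable_subset[OF sub] countable_finite by blast
  from infinite_rv_reps[OF this] obtain y :: "nat \<Rightarrow> 'a" where "\<forall>j. U (y j) \<and> v (y j) = v d"
    "\<forall>i j. rv v (y i) = rv v (y j) \<longrightarrow> i = j" by (elim exE conjE)
  then have y: "U (y j) \<and> v (y j) = v d" "rv v (y i) = rv v (y j) \<Longrightarrow> i = j" for i j
    by simp_all
  have Gxy: "G (x i) (y j) b" for i j using y(1)[of j] unfolding U_def by blast
  then have nz: "x i \<noteq> 0" "y j \<noteq> 0" for i j using rv_inv2D(1,2)[OF inv] by blast+
  \<comment> \<open>The formulas of the pattern fix the class of one coordinate. All pairs of the
    chosen classes lie in the relation, so every path is realized.\<close>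
  have "def2 (\<lambda>x y e. rveq x (e 0))" unfolding def2_def by (intro vf_intros)
  from def2_formula[OF this] obtain \<phi>0 where \<phi>0: "\<phi>0 \<in> formulas L"
    "\<forall>b. RV2_set M v \<phi>0 (\<lambda>i. b (i - 2)) = rv_set2 (\<lambda>x y. x \<noteq> 0 \<and> y \<noteq> 0 \<and> rveq x (b 0))" by (elim bexE)
  have "def2 (\<lambda>x y e. rveq y (e 0))" unfolding def2_def by (intro vf_intros)
  from def2_formula[OF this] obtain \<phi>1 where \<phi>1: "\<phi>1 \<in> formulas L"
    "\<forall>b. RV2_set M v \<phi>1 (\<lambda>i. b (i - 2)) = rv_set2 (\<lambda>x y. x \<noteq> 0 \<and> y \<noteq> 0 \<and> rveq y (b 0))" by (elim bexE)
  have mem0: "(rv v (x i), rv v (y j)) \<in> RV2_set M v \<phi>0 (\<lambda>_. x k) \<longleftrightarrow> k = i" for i j k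
    using spec[OF \<phi>0(2), of "\<lambda>_. x k"] nz x(2) by (auto simp: rveq_def) blast+
  have mem1: "(rv v (x i), rv v (y j)) \<in> RV2_set M v \<phi>1 (\<lambda>_. y k) \<longleftrightarrow> k = j" for i j k
    using spec[OF \<phi>1(2), of "\<lambda>_. y k"] nz y(2) by (auto simp: rveq_def) blast+
  show ?thesis
  proof (intro exI)
    show "RV2_ict_pattern L M v (rv_set2 (\<lambda>x y. G x y b)) 2 (\<lambda>i. if i = 0 then \<phi>0 else \<phi>1)
      (\<lambda>i j _. if i = 0 then x j else y j)"
      unfolding RV2_ict_pattern_def
    proof (intro conjI allI)
      fix \<eta> :: "nat \<Rightarrow> nat"
      show "\<exists>p \<in> rv_set2 (\<lambda>x y. G x y b). \<forall>i<2. \<forall>j. p \<in> RV2_set M v (if i = 0 then \<phi>0 else \<phi>1)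
          (\<lambda>_. if i = 0 then x j else y j) \<longleftrightarrow> j = \<eta> i"
      proof (rule bexI[of _ "(rv v (x (\<eta> 0)), rv v (y (\<eta> 1)))"])
        show "(rv v (x (\<eta> 0)), rv v (y (\<eta> 1))) \<in> rv_set2 (\<lambda>x y. G x y b)" using Gxy by blast
      qed (auto simp: mem0 mem1 less_2_cases_iff)
    qed (simp add: \<phi>0 \<phi>1)
  qed
qed

lemma ict_pattern_imp_ict_grid:
  assumes "rv_inv2 (\<lambda>x y. G x y b)" and "RV2_ict_pattern L M v (rv_set2 (\<lambda>x y. G x y b)) 2 \<phi> b'"
  shows "ict_grid (pullback (\<phi> 0)) (pullback (\<phi> 1)) (\<lambda>x y. G x y b) UNIV UNIV (b' 0) (b' 1)"
  unfolding ict_grid_def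
proof (intro ballI)
  fix i j :: nat
  have "\<exists>p \<in> rv_set2 (\<lambda>x y. G x y b). \<forall>k<2. \<forall>l. p \<in> RV2_set M v (\<phi> k) (b' k l) \<longleftrightarrow> l = (if k = 0 then i else j)"
    using assms(2) unfolding RV2_ict_pattern_def by (elim conjE allE[of _ "\<lambda>k. if k = 0 then i else j"])
  then obtain p where p: "p \<in> rv_set2 (\<lambda>x y. G x y b)"
    "\<forall>k<2. \<forall>l. p \<in> RV2_set M v (\<phi> k) (b' k l) \<longleftrightarrow> l = (if k = 0 then i else j)" by (elim bexE)
  then obtain x y where xy: "p = (rv v x, rv v y)" "G x y b" by blast
  have "x \<noteq> 0" "y \<noteq> 0" using rv_inv2D(1,2)[OF assms(1) xy(2)] .
  moreover from p(2)[THEN spec, of 0] p(2)[THEN spec, of 1]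
  have "p \<in> RV2_set M v (\<phi> 0) (b' 0 l) \<longleftrightarrow> l = i" "p \<in> RV2_set M v (\<phi> 1) (b' 1 l) \<longleftrightarrow> l = j" for l
    by simp_all
  ultimately show "\<exists>x y. G x y b \<and> (\<forall>i' \<in> UNIV. pullback (\<phi> 0) x y (b' 0 i') \<longleftrightarrow> i' = i) \<and>
      (\<forall>j' \<in> UNIV. pullback (\<phi> 1) x y (b' 1 j') \<longleftrightarrow> j' = j)"
    using xy by (intro exI[of _ x] exI[of _ y]) (simp add: pullback_def)
qed

lemma rv_inv2I:
  assumes "\<And>x y. P x y \<Longrightarrow> x \<noteq> 0 \<and> y \<noteq> 0"
    and "\<And>x y x' y'. P x y \<Longrightarrow> x' \<noteq> 0 \<Longrightarrow> y' \<noteq> 0 \<Longrightarrow> rv v x = rv v x' \<Longrightarrow> rv v y = rv v y' \<Longrightarrow> P x' y'"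
  shows "rv_inv2 P"
  unfolding rv_inv2_def rv_inv_def
proof (intro conjI allI impI)
  show "y \<noteq> 0" if "P x y" for x y using assms(1)[OF that] by simp
  show "x \<noteq> 0" if "P x y" for x y using assms(1)[OF that] by simp
  show "P x y'" if "P x y" "y' \<noteq> 0" "rv v y = rv v y'" for x y y'
    using assms(1)[OF that(1)] by (intro assms(2)[OF that(1) _ that(2) refl that(3)]) simp
  show "P x' y" if "P x y" "x' \<noteq> 0" "rv v x = rv v x'" for x y x'
    using assms(1)[OF that(1)] by (intro assms(2)[OF that(1,2) _ that(3) refl]) simp
qed

lemma rv_inv2_rveq:
  assumes "rv_inv2 P"
  shows "rv_inv2 (\<lambda>x y. rveq x z \<and> P x y)"
proof (rule rv_inv2I)
  fix x y assume xy: "rveq x z \<and> P x y"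
  then show "x \<noteq> 0 \<and> y \<noteq> 0" using rv_inv2D(1,2)[OF assms, of x y] by simp
  fix x' y' assume "x' \<noteq> 0" "y' \<noteq> 0" "rv v x = rv v x'" "rv v y = rv v y'"
  then show "rveq x' z \<and> P x' y'" using xy rv_inv2D(3)[OF assms, of x y x' y'] by (simp add: rveq_def)
qed

lemma rv_inv2_point: "rv_inv2 (\<lambda>x y. rveq x z \<and> rveq y z')"
  by (rule rv_inv2I) (auto simp: rveq_def)

text \<open>The slices over infinitely many classes of first coordinates are disjoint and definable,
  and each has rank at least one because it contains infinitely many points.\<close>

lemma infinite_big_imp_morley_rank_ge_2:
  assumes H: "def2 H" and inv: "\<And>b. rv_inv2 (\<lambda>x y. H x y b)"
    and big: "infinite (rv_part (\<lambda>x. big H x 1 b) 0)"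
  shows "morley_rank_ge (definable_RV2 L M v) (Suc (Suc 0)) (rv_set2 (\<lambda>x y. H x y b))"
proof -
  from infinite_rv_reps[OF big] obtain x :: "nat \<Rightarrow> 'a" where "\<forall>i. big H (x i) 1 b \<and> v (x i) = 0"
    "\<forall>i j. rv v (x i) = rv v (x j) \<longrightarrow> i = j" by (elim exE conjE)
  then have x: "big H (x i) 1 b \<and> v (x i) = 0" "rv v (x i) = rv v (x j) \<Longrightarrow> i = j" for i j
    by simp_all
  define Y where "Y i = rv_set2 (\<lambda>x' y. rveq x' (x i) \<and> H x' y b)" for i
  have "disjoint_family Y"
    unfolding disjoint_family_on_def
  proof (intro ballI impI)
    fix i j :: nat assume "i \<noteq> j"
    then have "rv v (x i) \<noteq> rv v (x j)" using x(2) by blast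
    then show "Y i \<inter> Y j = {}" unfolding Y_def rveq_def by auto
  qed
  moreover have "Y i \<in> definable_RV2 L M v" for i
  proof -
    have "def2 (\<lambda>x' y e. rveq x' (e 0) \<and> H x' y (\<lambda>i. e (Suc i)))"
      unfolding def2_def by (intro vf_intros def2_subst[OF H])
    from rv_set2_definable[OF this, of "case_nat (x i) b"] show ?thesis
      using rv_inv2_rveq[OF inv, of "x i" b] by (simp add: Y_def)
  qed
  moreover have "Y i \<subseteq> rv_set2 (\<lambda>x y. H x y b)" for i unfolding Y_def by blast
  moreover have "morley_rank_ge (definable_RV2 L M v) (Suc 0) (Y i)" for i
  proof -
    have "infinite (rv_part (\<lambda>y. H (x i) y b) (v 1))" using x(1) unfolding big_def by blast
    from infinite_rv_reps[OF this] obtain y :: "nat \<Rightarrow> 'a" where "\<forall>j. H (x i) (y j) b \<and> v (y j) = v 1"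
      "\<forall>j k. rv v (y j) = rv v (y k) \<longrightarrow> j = k" by (elim exE conjE)
    then have y: "H (x i) (y j) b \<and> v (y j) = v 1" "rv v (y j) = rv v (y k) \<Longrightarrow> j = k" for j k
      by simp_all
    have nz: "x i \<noteq> 0" "y j \<noteq> 0" for j using rv_inv2D(1,2)[OF inv] y(1)[of j] by blast+
    define Z where "Z j = rv_set2 (\<lambda>x' y'. rveq x' (x i) \<and> rveq y' (y j))" for j
    have Z: "Z j = {(rv v (x i), rv v (y j))}" for j unfolding Z_def rveq_def using nz by auto
    have "disjoint_family Z" unfolding disjoint_family_on_def Z using y(2) by auto
    moreover have "Z j \<in> definable_RV2 L M v" for j
    proof -
      have "def2 (\<lambda>x' y' e. rveq x' (e 0) \<and> rveq y' (e 1))"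
        unfolding def2_def by (intro vf_intros)
      from rv_set2_definable[OF this, of "\<lambda>k. if k = 0 then x i else y j"] show ?thesis
        using rv_inv2_point[of "x i" "y j"] by (simp add: Z_def)
    qed
    moreover have "Z j \<subseteq> Y i \<and> Z j \<noteq> {}" for j
      using y(1)[of j] nz unfolding Z Y_def rveq_def by blast
    ultimately show ?thesis by auto
  qed
  ultimately show ?thesis
    by (subst morley_rank_ge.simps(2), intro exI[of _ Y]) (simp del: morley_rank_ge.simps)
qed

text \<open>Suppose only finitely many classes of \<open>x\<close> have an infinite fiber in
  \<open>H\<close>, and take infinitely many disjoint infinite definable parts. Two parts cannot
  both be cofinite over the same \<open>x\<close>, so all but finitely many parts have only finite
  fibers and hence cofinite projections. Sufficiently many of these share some \<open>x\<close>
  whose fiber in \<open>H\<close> is finite, and overfill that fiber.\<close>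

lemma morley_rank_ge_2_imp_infinite_big:
  assumes H: "def2 H" and inv: "\<And>b. rv_inv2 (\<lambda>x y. H x y b)"
    and v0: "\<And>x y. H x y b \<Longrightarrow> v x = 0 \<and> v y = 0"
    and rank: "morley_rank_ge (definable_RV2 L M v) (Suc (Suc 0)) (rv_set2 (\<lambda>x y. H x y b))"
  shows "infinite (rv_part (\<lambda>x. big H x 1 b) 0)"
proof
  assume fin: "finite (rv_part (\<lambda>x. big H x 1 b) 0)"
  obtain Y where Y: "disjoint_family Y" "\<And>i::nat. Y i \<in> definable_RV2 L M v"
    "\<And>i. Y i \<subseteq> rv_set2 (\<lambda>x y. H x y b)" "\<And>i. morley_rank_ge (definable_RV2 L M v) (Suc 0) (Y i)"
    using rank by (subst (asm) morley_rank_ge.simps(2)) (auto simp del: morley_rank_ge.simps)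
  have Y_inf: "infinite (Y i)" for i
  proof -
    obtain Z where Z: "disjoint_family Z" "\<forall>j::nat. Z j \<in> definable_RV2 L M v \<and> Z j \<subseteq> Y i \<and> Z j \<noteq> {}"
      using Y(4)[of i] by auto
    then show ?thesis by (intro infinite_if_disjoint_parts[OF Z(1)]) blast
  qed
  have "\<exists>\<phi> e. \<phi> \<in> formulas L \<and> Y i = RV2_set M v \<phi> e" for i using Y(2)[of i] unfolding definable_RV2_def by blast
  then obtain \<phi> e where Y_eq: "\<And>i. \<phi> i \<in> formulas L \<and> Y i = RV2_set M v (\<phi> i) (e i)" by metis
  define P where "P i x y \<longleftrightarrow> pullback (\<phi> i) x y (e i)" for i x y
  have P_inv: "rv_inv2 (P i)" for i
    using rv_inv2_pullback[of "\<phi> i" "e i"] unfolding P_def[abs_def] .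
  have Y_P: "Y i = rv_set2 (P i)" for i
    unfolding P_def[abs_def] rv_set2_pullback using Y_eq by blast
  have P_H: "H x y b" if "P i x y" for i x y
  proof -
    have "(rv v x, rv v y) \<in> Y i" unfolding Y_P using that by blast
    then have "(rv v x, rv v y) \<in> rv_set2 (\<lambda>x y. H x y b)" using Y(3) by blast
    then show ?thesis using rv_set2_mem[OF inv] rv_inv2D(1,2)[OF P_inv that] by blast
  qed
  have P_disj: "i = j" if "P i x y" "P j x' y" "rv v x = rv v x'" for i j x x' y
  proof -
    have "(rv v x, rv v y) \<in> Y i \<inter> Y j" unfolding Y_P using that by auto
    then show ?thesis using Y(1) unfolding disjoint_family_on_def by blast
  qed
  have P_def2: "def2 (pullback (\<phi> i))" for i using def2_pullback Y_eq by blast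
  have P_fst: "\<exists>N. ball_comb N (P i x)" for i x
    using ball_comb_fst[OF P_def2, of i] unfolding P_def[abs_def] by blast
  obtain N where N: "\<And>x b. ball_comb N (\<lambda>y. H x y b)" using ball_comb_fst[OF H] by blast
  have H_inv: "rv_inv (\<lambda>y. H x y b)" for x using rv_inv2_fst[OF inv] .
  define I where "I = {i. \<exists>x. infinite (rv_part (P i x) 0)}"
  have "finite I"
  proof -
    have "\<forall>i \<in> I. \<exists>x. infinite (rv_part (P i x) 0)" by (simp add: I_def)
    from bchoice[OF this] obtain x where "\<forall>i \<in> I. infinite (rv_part (P i (x i)) 0)" ..
    then have x: "infinite (rv_part (P i (x i)) 0)" if "i \<in> I" for i using that by simp
    have big_x: "rv v (x i) \<in> rv_part (\<lambda>x. big H x 1 b) 0" if "i \<in> I" for i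
    proof -
      have "rv_part (P i (x i)) 0 \<subseteq> rv_part (\<lambda>y. H (x i) y b) 0" using P_H by blast
      then have "infinite (rv_part (\<lambda>y. H (x i) y b) 0)" using x[OF that] finite_subset by blast
      then have "big H (x i) 1 b" by (simp add: big_def v_one)
      moreover have "rv_part (P i (x i)) 0 \<noteq> {}" using x[OF that] by (metis finite.emptyI)
      then have "v (x i) = 0" using P_H v0 by blast
      ultimately show ?thesis by blast
    qed
    have "inj_on (\<lambda>i. rv v (x i)) I"
    proof (rule inj_onI)
      fix i j assume ij: "i \<in> I" "j \<in> I" "rv v (x i) = rv v (x j)"
      obtain n where n: "ball_comb n (P i (x i))" using P_fst by blast
      obtain m where m: "ball_comb m (P j (x j))" using P_fst by blast
      have "finite (RV_fiber v 0 - rv_part (P i (x i)) 0)" "finite (RV_fiber v 0 - rv_part (P j (x j)) 0)"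
        using infinite_rv_part_iff(1)[OF rv_inv2_fst[OF P_inv] n, of 0]
          infinite_rv_part_iff(1)[OF rv_inv2_fst[OF P_inv] m, of 0] x ij by blast+
      then have "finite ((RV_fiber v 0 - rv_part (P i (x i)) 0) \<union> (RV_fiber v 0 - rv_part (P j (x j)) 0))" by simp
      then have "\<not> RV_fiber v 0 \<subseteq> (RV_fiber v 0 - rv_part (P i (x i)) 0) \<union> (RV_fiber v 0 - rv_part (P j (x j)) 0)"
        using infinite_RV_fiber finite_subset by blast
      then obtain y where y: "y \<noteq> 0" "rv v y \<in> rv_part (P i (x i)) 0" "rv v y \<in> rv_part (P j (x j)) 0"
        unfolding RV_fiber_def by blast
      then have "P i (x i) y" "P j (x j) y"
        using rv_mem_part_iff[OF rv_inv2_fst[OF P_inv]] by blast+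
      then show "i = j" using P_disj ij(3) by blast
    qed
    then show ?thesis using inj_on_finite[OF _ _ fin] big_x by blast
  qed
  then have "infinite (- I)" by simp
  \<comment> \<open>One part more than a finite fiber of \<open>H\<close> has room for.\<close>
  then obtain J where J: "J \<subseteq> - I" "finite J" "card J = Suc N"
    using infinite_arbitrarily_large[of "- I" "Suc N"] by blast
  define Q where "Q i x \<longleftrightarrow> (\<exists>y. P i x y)" for i x
  have Q_cofin: "finite (RV_fiber v 0 - rv_part (Q i) 0)" if "i \<in> J" for i
  proof -
    have Q_inv: "rv_inv (Q i)"
      unfolding rv_inv_def
    proof (intro conjI allI impI)
      fix x assume "Q i x"
      then obtain y where xy: "P i x y" unfolding Q_def by blast
      note nz = rv_inv2D(1,2)[OF P_inv xy]
      show "x \<noteq> 0" by (rule nz)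
      show "Q i x'" if "x' \<noteq> 0" "rv v x = rv v x'" for x'
        using rv_inv2D(3)[OF P_inv xy that(1) nz(2) that(2) refl] unfolding Q_def by blast
    qed
    have "def1 (\<lambda>x e. \<exists>y. pullback (\<phi> i) x y e)"
      unfolding def1_def by (intro vf_intros def2_subst[OF P_def2])
    from definable_ball_comb[OF this, of "e i"] obtain n where n: "ball_comb n (Q i)"
      unfolding Q_def[abs_def] P_def by blast
    \<comment> \<open>A finite projection together with finite fibers would make \<open>Y i\<close>
      finite.\<close>
    have "infinite (rv_part (Q i) 0)"
    proof
      assume finQ: "finite (rv_part (Q i) 0)"
      have "\<forall>p \<in> rv_part (Q i) 0. \<exists>x. v x = 0 \<and> Q i x \<and> p = rv v x" by blast
      then obtain r where r: "\<And>p. p \<in> rv_part (Q i) 0 \<Longrightarrow> Q i (r p) \<and> p = rv v (r p)" by metis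
      have "Y i \<subseteq> (SIGMA p : rv_part (Q i) 0. rv_part (P i (r p)) 0)"
      proof
        fix z assume "z \<in> Y i"
        then obtain x y where xy: "z = (rv v x, rv v y)" "P i x y" unfolding Y_P by blast
        have p: "rv v x \<in> rv_part (Q i) 0" using xy(2) v0[OF P_H[OF xy(2)]] unfolding Q_def by blast
        have "P i (r (rv v x)) y"
          using rv_inv2D[OF P_inv xy(2)] r[OF p] rv_invD(1)[OF Q_inv] by metis
        then show "z \<in> (SIGMA p : rv_part (Q i) 0. rv_part (P i (r p)) 0)"
          using p xy v0[OF P_H[OF xy(2)]] by blast
      qed
      moreover have "finite (rv_part (P i x) 0)" for x using that J(1) unfolding I_def by blast
      then have "finite (SIGMA p : rv_part (Q i) 0. rv_part (P i (r p)) 0)" using finQ by blast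
      ultimately show False using Y_inf finite_subset by blast
    qed
    then show ?thesis using infinite_rv_part_iff(1)[OF Q_inv n] by blast
  qed
  have "finite ((\<Union>i\<in>J. RV_fiber v 0 - rv_part (Q i) 0) \<union> rv_part (\<lambda>x. big H x 1 b) 0)"
    using J(2) Q_cofin fin by blast
  then have "\<not> RV_fiber v 0 \<subseteq> (\<Union>i\<in>J. RV_fiber v 0 - rv_part (Q i) 0) \<union> rv_part (\<lambda>x. big H x 1 b) 0"
    using infinite_RV_fiber finite_subset by blast
  then obtain p where p: "p \<in> RV_fiber v 0" "p \<notin> (\<Union>i\<in>J. RV_fiber v 0 - rv_part (Q i) 0)"
    "p \<notin> rv_part (\<lambda>x. big H x 1 b) 0" by auto
  obtain x where p_eq: "p = rv v x" and x: "x \<noteq> 0" "v x = 0"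
    using p(1) unfolding RV_fiber_def by auto
  have x_Q: "rv v x \<in> rv_part (Q i) 0" if "i \<in> J" for i using p(1,2) that unfolding p_eq by simp
  have x_big: "rv v x \<notin> rv_part (\<lambda>x. big H x 1 b) 0" using p(3) unfolding p_eq .
  have "\<exists>y. P i x y" if "i \<in> J" for i
  proof -
    have "rv v x \<in> rv_part (Q i) 0" using x_Q that by simp
    then obtain x' z where xz: "P i x' z" "rv v x' = rv v x" unfolding Q_def by auto
    show ?thesis using rv_inv2D(3)[OF P_inv xz(1) x(1) _ xz(2) refl] rv_inv2D(2)[OF P_inv xz(1)] by blast
  qed
  then have "\<forall>i \<in> J. \<exists>y. P i x y" by blast
  from bchoice[OF this] obtain y where "\<forall>i \<in> J. P i x (y i)" ..
  then have y: "P i x (y i)" if "i \<in> J" for i using that by simp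
  have "finite (rv_part (\<lambda>y. H x y b) 0)"
    using x(2) x_big unfolding big_def v_one by auto
  then have card: "finite (rv_part (\<lambda>y. H x y b) 0)" "card (rv_part (\<lambda>y. H x y b) 0) \<le> N"
    using infinite_rv_part_iff(3)[OF H_inv N] by blast+
  have "inj_on (\<lambda>i. rv v (y i)) J"
  proof (rule inj_onI)
    fix i j assume ij: "i \<in> J" "j \<in> J" "rv v (y i) = rv v (y j)"
    have "P j x (y i)"
      using rv_inv2D(3)[OF P_inv y[OF ij(2)], of x "y i"] ij(3) x(1) rv_inv2D(2)[OF P_inv y[OF ij(1)]] by simp
    then show "i = j" using P_disj[OF y[OF ij(1)]] by blast
  qed
  moreover have "(\<lambda>i. rv v (y i)) ` J \<subseteq> rv_part (\<lambda>y. H x y b) 0" using y P_H v0 by blast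
  ultimately have "card J \<le> card (rv_part (\<lambda>y. H x y b) 0)" using card(1) card_inj_on_le by blast
  then show False using J(3) card(2) by simp
qed

end

section \<open>The main equivalence\<close>

context c_minimal_monster
begin

lemma finite_rv_part_mult:
  assumes "\<And>x. A x \<Longrightarrow> x \<noteq> 0" "c \<noteq> 0"
  shows "finite (rv_part (\<lambda>x. A (c * x)) 0) \<longleftrightarrow> finite (rv_part A (v c))"
proof -
  let ?f = "\<lambda>p. (\<lambda>z. z / c) ` p"
  have "inj ?f"
    using assms(2) by (intro injI) (simp add: inj_image_eq_iff inj_def)
  moreover have "rv_part (\<lambda>x. A (c * x)) 0 = ?f ` rv_part A (v c)"
  proof (intro equalityI subsetI)
    fix p assume "p \<in> rv_part (\<lambda>x. A (c * x)) 0"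
    then obtain x where x: "p = rv v x" "A (c * x)" "v x = 0" by blast
    have "x \<noteq> 0" using assms(1)[OF x(2)] by auto
    then have "v (c * x) = v c" using v_mult[OF assms(2)] x(3) by simp
    moreover have "p = ?f (rv v (c * x))" using assms(2) x(1) by (simp add: rv_divide)
    ultimately show "p \<in> ?f ` rv_part A (v c)" using x(2) by blast
  next
    fix p assume "p \<in> ?f ` rv_part A (v c)"
    then obtain x where x: "p = ?f (rv v x)" "A x" "v x = v c" by blast
    then have "p = rv v (x / c)" "v (x / c) = 0" "c * (x / c) = x"
      using assms v_divide[OF assms(1)[OF x(2)] assms(2)] by (simp_all add: rv_divide)
    then show "p \<in> rv_part (\<lambda>x. A (c * x)) 0" using x(2) by force
  qed
  ultimately show ?thesis by (simp add: finite_image_iff inj_on_subset[of ?f UNIV])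
qed

lemma RV2_translate_rv_set2:
  assumes inv: "rv_inv2 P" and nz: "c \<noteq> 0" "d \<noteq> 0"
  shows "RV2_translate c d ` (rv_set2 P \<inter> (RV_fiber v (v c) \<times> RV_fiber v (v d))) =
    rv_set2 (\<lambda>x y. v x = 0 \<and> v y = 0 \<and> P (c * x) (d * y))"
proof (intro equalityI subsetI)
  fix p assume "p \<in> RV2_translate c d ` (rv_set2 P \<inter> (RV_fiber v (v c) \<times> RV_fiber v (v d)))"
  then obtain x y where xy: "p = RV2_translate c d (rv v x, rv v y)" "P x y"
    "rv v x \<in> RV_fiber v (v c)" "rv v y \<in> RV_fiber v (v d)" by blast
  have xy_nz: "x \<noteq> 0" "y \<noteq> 0" using rv_inv2D(1,2)[OF inv xy(2)] .
  obtain x' y' where x': "x' \<noteq> 0" "v x' = v c" "rv v x = rv v x'"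
    and y': "y' \<noteq> 0" "v y' = v d" "rv v y = rv v y'" using xy(3,4) unfolding RV_fiber_def by blast
  have "v x = v c" "v y = v d"
    using rv_eq_imp_v_eq[OF xy_nz(1) x'(1,3)] rv_eq_imp_v_eq[OF xy_nz(2) y'(1,3)] x'(2) y'(2) by simp_all
  then have "v (x / c) = 0" "v (y / d) = 0" using v_divide xy_nz nz by simp_all
  moreover have "c * (x / c) = x" "d * (y / d) = y" using nz by simp_all
  moreover have "p = (rv v (x / c), rv v (y / d))" unfolding xy(1) RV2_translate_def by (simp add: rv_divide)
  ultimately show "p \<in> rv_set2 (\<lambda>x y. v x = 0 \<and> v y = 0 \<and> P (c * x) (d * y))" using xy(2) by force
next
  fix p assume "p \<in> rv_set2 (\<lambda>x y. v x = 0 \<and> v y = 0 \<and> P (c * x) (d * y))"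
  then obtain x y where xy: "p = (rv v x, rv v y)" "v x = 0" "v y = 0" "P (c * x) (d * y)" by blast
  have xy_nz: "x \<noteq> 0" "y \<noteq> 0" using rv_inv2D(1,2)[OF inv xy(4)] by auto
  have "p = RV2_translate c d (rv v (c * x), rv v (d * y))"
    unfolding xy(1) RV2_translate_def using nz by (simp add: rv_divide)
  moreover have "rv v (c * x) \<in> RV_fiber v (v c)" "rv v (d * y) \<in> RV_fiber v (v d)"
    using nz xy_nz xy(2,3) v_mult[of c x] v_mult[of d y] unfolding RV_fiber_def by auto
  ultimately show "p \<in> RV2_translate c d ` (rv_set2 P \<inter> (RV_fiber v (v c) \<times> RV_fiber v (v d)))"
    using xy(4) by blast
qed

lemma RV2_dim_less_2_iff:
  assumes G: "def2 G" and inv: "\<And>b. rv_inv2 (\<lambda>x y. G x y b)" and w: "w \<noteq> 0"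
  shows "RV2_dim L M v \<alpha> (v w) (rv_set2 (\<lambda>x y. G x y b) \<inter> (RV_fiber v \<alpha> \<times> RV_fiber v (v w))) < 2 \<longleftrightarrow>
    finite (rv_part (\<lambda>x. big G x w b) \<alpha>)"
proof -
  define c where "c = (SOME c. c \<noteq> 0 \<and> v c = \<alpha>)"
  define d where "d = (SOME d. d \<noteq> 0 \<and> v d = v w)"
  have c: "c \<noteq> 0" "v c = \<alpha>" using someI_ex[OF v_surj[of \<alpha>]] unfolding c_def by blast+
  have d: "d \<noteq> 0" "v d = v w" using someI_ex[OF v_surj[of "v w"]] unfolding d_def by blast+
  \<comment> \<open>The translate to the fibers over \<open>0\<close>, where the rank criterion is
    available. Its parameters are \<open>c\<close>, \<open>d\<close> and the element
    \<open>1\<close>, the last one expressing that \<open>x\<close> and \<open>y\<close> have value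
    \<open>0\<close>.\<close>
  define H where "H x y e \<longleftrightarrow> veq x (e (Suc (Suc 0))) \<and> veq y (e (Suc (Suc 0))) \<and>
    G (e 0 * x) (e (Suc 0) * y) (\<lambda>i. e (Suc (Suc (Suc i))))" for x y e
  define e where "e = case_nat c (case_nat d (case_nat 1 b))"
  have H_iff: "H x y e \<longleftrightarrow> v x = 0 \<and> v y = 0 \<and> G (c * x) (d * y) b" for x y
    using rv_inv2D(1,2)[OF inv, of "c * x" "d * y" b] by (auto simp: H_def e_def veq_def v_one)
  have H: "def2 H"
    unfolding def2_def H_def by (intro vf_intros def2_subst[OF G])
  have H_inv: "rv_inv2 (\<lambda>x y. H x y b)" for b
  proof (rule rv_inv2I)
    fix x y assume xy: "H x y b"
    then show nz: "x \<noteq> 0 \<and> y \<noteq> 0" by (simp add: H_def veq_def)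
    fix x' y' assume x': "x' \<noteq> 0" "y' \<noteq> 0" "rv v x = rv v x'" "rv v y = rv v y'"
    have G_xy: "G (b 0 * x) (b (Suc 0) * y) (\<lambda>i. b (Suc (Suc (Suc i))))" using xy by (simp add: H_def)
    have b_nz: "b 0 \<noteq> 0" "b (Suc 0) \<noteq> 0" using rv_inv2D(1,2)[OF inv G_xy] by auto
    have "v x = v x'" "v y = v y'" using rv_eq_imp_v_eq nz x' by blast+
    moreover have "G (b 0 * x') (b (Suc 0) * y') (\<lambda>i. b (Suc (Suc (Suc i))))"
      by (rule rv_inv2D(3)[OF inv G_xy]) (use b_nz x' nz rv_mult_iff in auto)
    ultimately show "H x' y' b" using xy x' by (simp add: H_def veq_def)
  qed
  have dim: "RV2_dim L M v \<alpha> (v w) (rv_set2 (\<lambda>x y. G x y b) \<inter> (RV_fiber v \<alpha> \<times> RV_fiber v (v w))) =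
      morley_rank (definable_RV2 L M v) (rv_set2 (\<lambda>x y. H x y e))"
    using RV2_translate_rv_set2[OF inv c(1) d(1), of b]
    unfolding RV2_dim_def Let_def c_def[symmetric] d_def[symmetric] H_iff c(2) d(2) by simp
  have two: "(2 :: enat) = enat (Suc (Suc 0))" by (simp add: numeral_eq_enat)
  have rank: "morley_rank_ge (definable_RV2 L M v) (Suc (Suc 0)) (rv_set2 (\<lambda>x y. H x y e)) \<longleftrightarrow>
      infinite (rv_part (\<lambda>x. big H x 1 e) 0)"
    using infinite_big_imp_morley_rank_ge_2[OF H H_inv] morley_rank_ge_2_imp_infinite_big[OF H H_inv]
      H_iff by blast
  have part: "rv_part (\<lambda>x. big H x 1 e) 0 = rv_part (\<lambda>x. big G (c * x) w b) 0"
  proof -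
    have "big H x 1 e \<longleftrightarrow> big G (c * x) w b" if "v x = 0" for x
    proof -
      have "rv_part (\<lambda>y. H x y e) 0 = rv_part (\<lambda>y. G (c * x) (d * y) b) 0"
        using that unfolding H_iff by auto
      moreover have "finite (rv_part (\<lambda>y. G (c * x) (d * y) b) 0) \<longleftrightarrow> finite (rv_part (\<lambda>y. G (c * x) y b) (v d))"
        using finite_rv_part_mult[of "\<lambda>y. G (c * x) y b" d] rv_inv2D(2)[OF inv] d(1) by blast
      ultimately show ?thesis unfolding big_def v_one using d(2) w by simp
    qed
    then show ?thesis by (metis (mono_tags, lifting))
  qed
  have "finite (rv_part (\<lambda>x. big G (c * x) w b) 0) \<longleftrightarrow> finite (rv_part (\<lambda>x. big G x w b) \<alpha>)"
    using finite_rv_part_mult[of "\<lambda>x. big G x w b" c] rv_invD(1)[OF rv_inv_big[of G b w, OF inv]] c by simp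
  then show ?thesis unfolding dim two morley_rank_less_Suc_iff rank part by simp
qed

lemma small_over_value_group_iff:
  assumes G: "def2 G" and inv: "\<And>b. rv_inv2 (\<lambda>x y. G x y b)"
  shows "small_over_value_group L M v (rv_set2 (\<lambda>x y. G x y b)) \<longleftrightarrow>
    (\<forall>w \<gamma>. finite (rv_part (\<lambda>x. big G x w b) \<gamma>))"
proof
  assume small: "small_over_value_group L M v (rv_set2 (\<lambda>x y. G x y b))"
  show "\<forall>w \<gamma>. finite (rv_part (\<lambda>x. big G x w b) \<gamma>)"
  proof (intro allI)
    fix w \<gamma>
    show "finite (rv_part (\<lambda>x. big G x w b) \<gamma>)"
    proof (cases "w = 0")
      case True
      then show ?thesis by (simp add: big_def)
    next
      case False
      then show ?thesis
        using small RV2_dim_less_2_iff[OF G inv False] unfolding small_over_value_group_def by blast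
    qed
  qed
next
  assume fin: "\<forall>w \<gamma>. finite (rv_part (\<lambda>x. big G x w b) \<gamma>)"
  show "small_over_value_group L M v (rv_set2 (\<lambda>x y. G x y b))"
    unfolding small_over_value_group_def
  proof (intro allI)
    fix \<alpha> \<beta>
    obtain w where w: "w \<noteq> 0" "v w = \<beta>" using v_surj by blast
    show "RV2_dim L M v \<alpha> \<beta> (rv_set2 (\<lambda>x y. G x y b) \<inter> (RV_fiber v \<alpha> \<times> RV_fiber v \<beta>)) < 2"
      using RV2_dim_less_2_iff[OF G inv w(1), of \<alpha> b] fin w(2) by simp
  qed
qed

text \<open>Among \<open>r + s\<close> rows, the set of rows in which \<open>P\<close> holds at the
  chosen point is the same for infinitely many columns. It has at least \<open>r\<close> elements or
  its complement at least \<open>s\<close>.\<close>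

lemma ict_grid_Un:
  assumes "ict_grid F0 F1 D UNIV UNIV b0 b1"
  obtains (left) R C where "finite R" "r \<le> card R" "infinite C"
      "ict_grid F0 F1 (\<lambda>x y. D x y \<and> P x y) R C b0 b1"
    | (right) R C where "finite R" "s \<le> card R" "infinite C"
      "ict_grid F0 F1 (\<lambda>x y. D x y \<and> \<not> P x y) R C b0 b1"
proof -
  have "\<forall>i j. \<exists>p. D (fst p) (snd p) \<and> (\<forall>i'. F0 (fst p) (snd p) (b0 i') \<longleftrightarrow> i' = i) \<and>
      (\<forall>j'. F1 (fst p) (snd p) (b1 j') \<longleftrightarrow> j' = j)"
    using assms unfolding ict_grid_def by simp
  then obtain p where p: "\<And>i j. D (fst (p i j)) (snd (p i j)) \<and>
      (\<forall>i'. F0 (fst (p i j)) (snd (p i j)) (b0 i') \<longleftrightarrow> i' = i) \<and>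
      (\<forall>j'. F1 (fst (p i j)) (snd (p i j)) (b1 j') \<longleftrightarrow> j' = j)" by metis
  define T where "T j = {i. i < r + s \<and> P (fst (p i j)) (snd (p i j))}" for j
  have "range T \<subseteq> Pow {..<r + s}" by (auto simp: T_def)
  then have "finite (range T)" using finite_subset by blast
  then obtain j0 where inf: "infinite {j. T j = T j0}"
    using pigeonhole_infinite[of "UNIV :: nat set" T] by auto
  define C where "C = {j. T j = T j0}"
  show ?thesis
  proof (cases "r \<le> card (T j0)")
    case True
    show ?thesis
    proof (rule left[OF _ True, of C])
      show "ict_grid F0 F1 (\<lambda>x y. D x y \<and> P x y) (T j0) C b0 b1"
        unfolding ict_grid_def
      proof (intro ballI)
        fix i j assume "i \<in> T j0" "j \<in> C"
        then have "P (fst (p i j)) (snd (p i j))" by (auto simp: C_def T_def)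
        then show "\<exists>x y. (D x y \<and> P x y) \<and> (\<forall>i'\<in>T j0. F0 x y (b0 i') = (i' = i)) \<and>
            (\<forall>j'\<in>C. F1 x y (b1 j') = (j' = j))"
          using p[of i j] by blast
      qed
    qed (use inf in \<open>simp_all add: C_def T_def\<close>)
  next
    case False
    define R where "R = {..<r + s} - T j0"
    have "card R = r + s - card (T j0)" unfolding R_def by (subst card_Diff_subset) (auto simp: T_def)
    then have card: "s \<le> card R" using False by simp
    show ?thesis
    proof (rule right[OF _ card, of C])
      show "ict_grid F0 F1 (\<lambda>x y. D x y \<and> \<not> P x y) R C b0 b1"
        unfolding ict_grid_def
      proof (intro ballI)
        fix i j assume "i \<in> R" "j \<in> C"
        then have "\<not> P (fst (p i j)) (snd (p i j))" by (auto simp: C_def T_def R_def)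
        then show "\<exists>x y. (D x y \<and> \<not> P x y) \<and> (\<forall>i'\<in>R. F0 x y (b0 i') = (i' = i)) \<and>
            (\<forall>j'\<in>C. F1 x y (b1 j') = (j' = j))"
          using p[of i j] by blast
      qed
    qed (use inf in \<open>simp_all add: C_def R_def\<close>)
  qed
qed

text \<open>Allows finite fibers over the second coordinate to be treated as fibers over the
  first.\<close>

lemma ict_grid_swap:
  "ict_grid F0 F1 D R C b0 b1 \<Longrightarrow> ict_grid (\<lambda>y x. F0 x y) (\<lambda>y x. F1 x y) (\<lambda>y x. D x y) R C b0 b1"
  unfolding ict_grid_def by blast

lemma rv_eq_nonzero: "rv v x = rv v y \<Longrightarrow> y \<noteq> 0 \<Longrightarrow> x \<noteq> 0"
proof
  assume "rv v x = rv v y" "y \<noteq> 0" "x = 0"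
  moreover have "y \<in> rv v y" unfolding rv_def max_ideal_def by (intro image_eqI[of _ _ 0]) auto
  moreover have "rv v 0 \<subseteq> {0}" unfolding rv_def by auto
  ultimately show False by auto
qed

lemma snd_inv_pullback: "snd_inv (pullback \<phi>)" "snd_inv (\<lambda>y x. pullback \<phi> x y)"
  unfolding snd_inv_def pullback_def using rv_eq_nonzero by auto

lemma no_ict_pattern:
  assumes G: "def2 G" and inv: "\<And>b. rv_inv2 (\<lambda>x y. G x y b)"
    and fin: "\<And>w \<gamma>. finite (rv_part (\<lambda>x. big G x w b) \<gamma>)"
  shows "\<not> RV2_ict_pattern L M v (rv_set2 (\<lambda>x y. G x y b)) 2 \<phi> b'"
proof
  assume pat: "RV2_ict_pattern L M v (rv_set2 (\<lambda>x y. G x y b)) 2 \<phi> b'"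
  have "finite (rv_set (\<lambda>x. \<exists>w. big G x w b))"
    by (rule orthogonality[OF def2_big[OF G inv] rv_inv_big[OF inv] big_v_eq fin])
  define X where "X x e \<longleftrightarrow> (\<exists>w. big G x w e)" for x e
  have finX: "finite (rv_set (\<lambda>x. X x b))" unfolding X_def by fact
  have \<phi>: "\<phi> 0 \<in> formulas L" "\<phi> 1 \<in> formulas L" using pat by (simp_all add: RV2_ict_pattern_def)
  have defX: "def1 X" unfolding def1_def X_def by (intro vf_intros def2_subst[OF def2_big[OF G inv]])
  have F: "def2 (pullback (\<phi> 0))" "def2 (pullback (\<phi> 1))" using def2_pullback \<phi> by blast+
  have F': "def2 (\<lambda>y x. pullback (\<phi> 0) x y)" "def2 (\<lambda>y x. pullback (\<phi> 1) x y)"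
    unfolding def2_def by (intro def2_subst[OF F(1)] def2_subst[OF F(2)] def_term_var)+
  have G1: "def2 (\<lambda>x y e. G x y e \<and> \<not> X x e)"
    unfolding def2_def by (intro vf_intros def2_subst[OF G] def1_subst[OF defX])
  have G2: "def2 (\<lambda>y x e. G x y e \<and> X x e)"
    unfolding def2_def by (intro vf_intros def2_subst[OF G] def1_subst[OF defX])
  obtain N where N: "\<And>x b. ball_comb N (\<lambda>y. G x y b)" using ball_comb_fst[OF G] by blast
  \<comment> \<open>Off \<open>X\<close> the fiber is finite over every value, hence has at most
    \<open>N\<close> classes altogether.\<close>
  have fib1: "finite (rv_set (\<lambda>y. G x y b \<and> \<not> X x b)) \<and> card (rv_set (\<lambda>y. G x y b \<and> \<not> X x b)) \<le> N" for x
  proof (cases "X x b")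
    case False
    have "finite (rv_part (\<lambda>y. G x y b) \<gamma>)" for \<gamma>
      using False v_surj[of \<gamma>] unfolding X_def big_def by blast
    then show ?thesis using finite_rv_set[OF rv_inv2_fst[OF inv] N] False by simp
  qed simp
  \<comment> \<open>In the other direction the fibers are subsets of the finite set of classes of
    \<open>X\<close>, whatever \<open>y\<close> is.\<close>
  have fib2: "finite (rv_set (\<lambda>x. G x y b \<and> X x b)) \<and>
      card (rv_set (\<lambda>x. G x y b \<and> X x b)) \<le> card (rv_set (\<lambda>x. X x b))" for y
  proof -
    have sub: "rv_set (\<lambda>x. G x y b \<and> X x b) \<subseteq> rv_set (\<lambda>x. X x b)" by blast
    show ?thesis using finite_subset[OF sub finX] card_mono[OF finX sub] by simp
  qed
  from no_grid_finite_fibers[OF F snd_inv_pullback(1) snd_inv_pullback(1) G1, of N]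
  obtain r1 where r1: "\<forall>c R C b0 b1. (\<forall>x. finite (rv_set (\<lambda>y. G x y c \<and> \<not> X x c)) \<and>
      card (rv_set (\<lambda>y. G x y c \<and> \<not> X x c)) \<le> N) \<longrightarrow> finite R \<longrightarrow> r1 \<le> card R \<longrightarrow> infinite C \<longrightarrow>
      \<not> ict_grid (pullback (\<phi> 0)) (pullback (\<phi> 1)) (\<lambda>x y. G x y c \<and> \<not> X x c) R C b0 b1" ..
  from no_grid_finite_fibers[OF F' snd_inv_pullback(2) snd_inv_pullback(2) G2, of "card (rv_set (\<lambda>x. X x b))"]
  obtain r2 where r2: "\<forall>c R C b0 b1. (\<forall>y. finite (rv_set (\<lambda>x. G x y c \<and> X x c)) \<and>
      card (rv_set (\<lambda>x. G x y c \<and> X x c)) \<le> card (rv_set (\<lambda>x. X x b))) \<longrightarrow>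
      finite R \<longrightarrow> r2 \<le> card R \<longrightarrow> infinite C \<longrightarrow>
      \<not> ict_grid (\<lambda>y x. pullback (\<phi> 0) x y) (\<lambda>y x. pullback (\<phi> 1) x y) (\<lambda>y x. G x y c \<and> X x c) R C b0 b1" ..
  show False
  proof (rule ict_grid_Un[OF ict_pattern_imp_ict_grid[OF inv pat], where P = "\<lambda>x y. X x b" and r = r2 and s = r1])
    fix R C :: "nat set"
    assume R: "finite R" "r2 \<le> card R" "infinite C"
      and "ict_grid (pullback (\<phi> 0)) (pullback (\<phi> 1)) (\<lambda>x y. G x y b \<and> X x b) R C (b' 0) (b' 1)"
    from ict_grid_swap[OF this(4)] show False using r2 R fib2 by blast
  next
    fix R C :: "nat set"
    assume R: "finite R" "r1 \<le> card R" "infinite C"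
      and "ict_grid (pullback (\<phi> 0)) (pullback (\<phi> 1)) (\<lambda>x y. G x y b \<and> \<not> X x b) R C (b' 0) (b' 1)"
    then show False using r1 fib1 by blast
  qed
qed

lemma dp_rank_le_1_iff_small:
  assumes "D \<in> definable_RV2 L M v"
  shows "dp_rank L M v D \<le> 1 \<longleftrightarrow> small_over_value_group L M v D"
proof -
  obtain \<psi> b where \<psi>: "\<psi> \<in> formulas L" "D = RV2_set M v \<psi> b"
    using assms unfolding definable_RV2_def by blast
  have D: "D = rv_set2 (\<lambda>x y. pullback \<psi> x y b)" using rv_set2_pullback \<psi>(2) by simp
  note G = def2_pullback[OF \<psi>(1)] rv_inv2_pullback
  show ?thesis
    unfolding D small_over_value_group_iff[OF G] dp_rank_le_1_iff
    using infinite_big_imp_ict_pattern[OF G] no_ict_pattern[OF G] by blast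
qed

end

theorem theorem4p21:
  fixes L :: "('f vf_fun, 'r vf_rel) language"
    and M :: "('f vf_fun, 'r vf_rel, 'a::alg_closed_field) struct"
    and v :: "'a \<Rightarrow> 'g::linordered_ab_group_add"
    and t :: "'f vf_fun"
    and D :: "('a set \<times> 'a set) set"
  assumes "nontrivial_valuation v"
    and "vf_expansion L M v"
    and "C_minimal L M v"
    and "monster_model L M"
    and "farity L t = Some 0" and "fint M t [] \<noteq> 0" and "0 < v (fint M t [])"
    and "D \<in> definable_RV2 L M v"
  shows "dp_rank L M v D \<le> 1 \<longleftrightarrow> small_over_value_group L M v D"
proof -
  interpret c_minimal_monster v L M
    using assms(1-4) by unfold_locales
  show ?thesis by (rule dp_rank_le_1_iff_small) (rule assms(8))
qed

end
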